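(* For $g\in SO_0(1,2)$ let $U(g)$ denote the action of the de Sitter group on test functions, $(U(g)f)(x)=f(g^{-1}x)$ for $f\in\mathcal D(X_2)$. The representation $U(g)$ of the de Sitter group has a unique continuous extension from $\mathcal D(X_2)$ to $\mathcal K^{(1)}$, and $$U(g)v_0=v_0\qquad\text{for all } g\in SO_0(1,2),$$ where $v_0\in\mathcal K^{(1)}$ is the class of the function $-4\pi R^2\,\square h$.
   Context: Fix $R>0$. On $\mathbb R^3$ (and bilinearly on $\mathbb C^3$) put $x\cdot y=x^{(0)}y^{(0)}-x^{(1)}y^{(1)}-x^{(2)}y^{(2)}$, $x^2=x\cdot x$. Two-dimensional de Sitter space is $X_2=\{x\in\mathbb R^3:x^2=-R^2\}$ with the induced metric of signature $(+,-)$, its $SO_0(1,2)$-invariant volume form $\mathrm d\sigma$, and Laplace–Beltrami (d'Alembert) operator $\square$ (sign such that the Klein–Gordon equation is $\square\phi+\mu^2\phi=0$). Let $X_2^{(c)}=\{z\in\mathbb C^3:z^2=-R^2\}$, $V^+=\{y\in\mathbb R^3:y^2>0,y^{(0)}>0\}$, $V^-=-V^+$, $\mathcal T^\pm=(\mathbb R^3+iV^\pm)\cap X_2^{(c)}$. The distribution $\mathcal W_0(x,x')$ on $X_2\times X_2$ is the boundary value, from $z\in\mathcal T^-$, $z'\in\mathcal T^+$, of $W_0(z,z')=-\frac1{4\pi}\ln\left[-\frac{(z-z')^2}{R^2}\right]$ (principal branch). It is $SO_0(1,2)$-invariant and satisfies $\square_x\mathcal W_0=\square_{x'}\mathcal W_0=-\frac1{4\pi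 R^2}$. $\mathcal D(X_2)$ is the space of complex-valued smooth compactly supported functions, $\langle f,g\rangle=\int_{X_2\times X_2}\mathcal W_0(x,x')\overline{f(x)}g(x')\,\mathrm d\sigma(x)\mathrm d\sigma(x')$, and $\mathcal D_0=\{f\in\mathcal D(X_2):\int_{X_2}f\,\mathrm d\sigma=0\}$, on which $\langle\cdot,\cdot\rangle$ is positive semidefinite. A real function $h\in\mathcal D(X_2)$ with $\int_{X_2}h\,\mathrm d\sigma=1$ and $\langle h,h\rangle=0$ is fixed. For $f\in\mathcal D(X_2)$ put $f_0=f-\left(\int_{X_2}f\,\mathrm d\sigma\right)h\in\mathcal D_0$. The Krein inner product on $\mathcal D(X_2)$ is $$(f,g)=\langle f_0,g_0\rangle+\langle f,h\rangle\langle h,g\rangle+\int_{X_2}\overline{f}\,\mathrm d\sigma\int_{X_2}g\,\mathrm d\sigma .$$ It is positive semidefinite with null space $\mathcal I_h=\{f\in\mathcal D_0:\langle f,f\rangle=0,\ \langle h,f\rangle=0\}$, and $\mathcal K^{(1)}$ is the Hilbert space completion of $\mathcal D(X_2)/\mathcal I_h$ for $(\cdot,\cdot)$. "Continuous extension" means that, for each $g$, the map $f\mapsto U(g)f$ induces a bounded operator on $\mathcal K^{(1)}$ (continuity for the norm of $(\cdot,\cdot)$). *)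

theory Defs
  imports "HOL-Analysis.Analysis"
begin

section \<open>De Sitter space and the tubes\<close>

text \<open>Vectors of \<open>\<real>\<^sup>3\<close> and \<open>\<complex>\<^sup>3\<close> are indexed by the three elements \<open>0, 1, 2\<close> of the numeral
  type \<open>3\<close>, so that \<open>x $ 0\<close> is the time component.\<close>

definition mink :: "'a::comm_ring_1 ^ 3 \<Rightarrow> 'a ^ 3 \<Rightarrow> 'a" where
  "mink x y = x $ 0 * y $ 0 - x $ 1 * y $ 1 - x $ 2 * y $ 2"

definition dS :: "real \<Rightarrow> (real ^ 3) set" where
  "dS R = {x. mink x x = - R\<^sup>2}"

definition dS_complex :: "real \<Rightarrow> (complex ^ 3) set" where
  "dS_complex R = {z. mink z z = - (of_real R)\<^sup>2}"

definition Vplus :: "(real ^ 3) set" where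
  "Vplus = {y. mink y y > 0 \<and> y $ 0 > 0}"

definition Vminus :: "(real ^ 3) set" where
  "Vminus = uminus ` Vplus"

definition tube_plus :: "real \<Rightarrow> (complex ^ 3) set" where
  "tube_plus R = {z \<in> dS_complex R. (\<chi> i. Im (z $ i)) \<in> Vplus}"

definition tube_minus :: "real \<Rightarrow> (complex ^ 3) set" where
  "tube_minus R = {z \<in> dS_complex R. (\<chi> i. Im (z $ i)) \<in> Vminus}"

definition W0 :: "real \<Rightarrow> complex ^ 3 \<Rightarrow> complex ^ 3 \<Rightarrow> complex" where
  "W0 R z z' = - (1 / (4 * of_real pi)) * Ln (- (mink (z - z') (z - z') / (of_real R)\<^sup>2))"


section \<open>Metric, volume form and d'Alembertian\<close>

text \<open>The global conformal chart \<open>(\<tau>, \<theta>) \<mapsto> R (tan \<tau>, cos \<theta> / cos \<tau>, sin \<theta> / cos \<tau>)\<close>; the index type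
  \<open>2\<close> has the elements \<open>0\<close> (for \<open>\<tau>\<close>) and \<open>1\<close> (for \<open>\<theta>\<close>). The chart maps \<open>chart_domain\<close> bijectively
  onto \<open>dS R\<close> and is an immersion on the strip \<open>\<bar>\<tau>\<bar> < \<pi>/2\<close>. Over \<open>complex\<close> the same formula is its
  holomorphic extension, with values in \<open>dS_complex R\<close>.\<close>

definition chart :: "real \<Rightarrow> 'a::{real_normed_field,banach} ^ 2 \<Rightarrow> 'a ^ 3" where
  "chart R p = (\<chi> i. of_real R *
     (if i = 0 then tan (p $ 0)
      else if i = 1 then cos (p $ 1) / cos (p $ 0)
      else sin (p $ 1) / cos (p $ 0)))"

definition chart_domain :: "(real ^ 2) set" where
  "chart_domain = {p. - (pi / 2) < p $ 0 \<and> p $ 0 < pi / 2 \<and> - pi < p $ 1 \<and> p $ 1 \<le> pi}"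

definition partial :: "2 \<Rightarrow> (real ^ 2 \<Rightarrow> 'b::real_normed_vector) \<Rightarrow> real ^ 2 \<Rightarrow> 'b" where
  "partial i u p = vector_derivative (\<lambda>s. u (p + s *\<^sub>R axis i 1)) (at 0)"

definition metric :: "real \<Rightarrow> real ^ 2 \<Rightarrow> real ^ 2 ^ 2" where
  "metric R p = (\<chi> i j. mink (partial i (chart R) p) (partial j (chart R) p))"

definition vol_density :: "real \<Rightarrow> real ^ 2 \<Rightarrow> real" where
  "vol_density R p = sqrt \<bar>det (metric R p)\<bar>"

definition chart_volume :: "real \<Rightarrow> (real ^ 2) measure" where
  "chart_volume R = density lborel (\<lambda>p. ennreal (indicator chart_domain p * vol_density R p))"

definition dS_volume :: "real \<Rightarrow> (real ^ 3) measure" where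
  "dS_volume R = distr (chart_volume R) borel (chart R)"

text \<open>The Laplace--Beltrami operator
  \<open>\<bar>det g\<bar>\<^sup>-\<^sup>1\<^sup>/\<^sup>2 \<Sum>\<^sub>i \<partial>\<^sub>i (\<bar>det g\<bar>\<^sup>1\<^sup>/\<^sup>2 \<Sum>\<^sub>j g\<^sup>i\<^sup>j \<partial>\<^sub>j u)\<close> in the chart. As the metric has signature \<open>(+,-)\<close>,
  second time derivatives come with a positive sign.\<close>

definition box_chart :: "real \<Rightarrow> (real ^ 2 \<Rightarrow> complex) \<Rightarrow> real ^ 2 \<Rightarrow> complex" where
  "box_chart R u p = (1 / vol_density R p) *\<^sub>R
     (\<Sum>i\<in>UNIV. partial i
        (\<lambda>q. vol_density R q *\<^sub>R (\<Sum>j\<in>UNIV. matrix_inv (metric R q) $ i $ j *\<^sub>R partial j u q)) p)"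

definition dalembert :: "real \<Rightarrow> (real ^ 3 \<Rightarrow> complex) \<Rightarrow> real ^ 3 \<Rightarrow> complex" where
  "dalembert R f x =
     (if x \<in> dS R then box_chart R (f \<circ> chart R) (the_inv_into chart_domain (chart R) x) else 0)"


section \<open>Test functions and the action of the de Sitter group\<close>

primrec Ck_on :: "nat \<Rightarrow> 'a::euclidean_space set \<Rightarrow> ('a \<Rightarrow> 'b::real_normed_vector) \<Rightarrow> bool" where
  "Ck_on 0 U F \<longleftrightarrow> continuous_on U F"
| "Ck_on (Suc k) U F \<longleftrightarrow> (\<forall>x\<in>U. F differentiable (at x)) \<and>
     (\<forall>b\<in>Basis. Ck_on k U (\<lambda>x. frechet_derivative F (at x) b))"

text \<open>Smoothness on the embedded submanifold \<open>S\<close>: local extendability to a smooth function on an open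
  subset of the ambient space.\<close>

definition smooth_on_subset :: "'a::euclidean_space set \<Rightarrow> ('a \<Rightarrow> 'b::real_normed_vector) \<Rightarrow> bool" where
  "smooth_on_subset S f \<longleftrightarrow>
     (\<forall>x\<in>S. \<exists>V F. open V \<and> x \<in> V \<and> (\<forall>k. Ck_on k V F) \<and> (\<forall>y\<in>V \<inter> S. F y = f y))"

text \<open>Functions on \<open>dS R\<close> are represented by functions on the ambient space that vanish off \<open>dS R\<close>.\<close>

definition test_fun :: "real \<Rightarrow> (real ^ 3 \<Rightarrow> complex) set" where
  "test_fun R = {f. smooth_on_subset (dS R) f \<and>
     (\<exists>K. compact K \<and> K \<subseteq> dS R \<and> (\<forall>x. x \<notin> K \<longrightarrow> f x = 0))}"

definition integ :: "real \<Rightarrow> (real ^ 3 \<Rightarrow> complex) \<Rightarrow> complex" where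
  "integ R f = (LINT x|dS_volume R. f x)"

definition test_fun0 :: "real \<Rightarrow> (real ^ 3 \<Rightarrow> complex) set" where
  "test_fun0 R = {f \<in> test_fun R. integ R f = 0}"

definition SO0_1_2 :: "(real ^ 3 ^ 3) set" where
  "SO0_1_2 = {g. (\<forall>x y. mink (g *v x) (g *v y) = mink x y) \<and> det g = 1 \<and> g $ 0 $ 0 > 0}"

definition dS_act :: "real ^ 3 ^ 3 \<Rightarrow> (real ^ 3 \<Rightarrow> complex) \<Rightarrow> real ^ 3 \<Rightarrow> complex" where
  "dS_act g f x = f (matrix_inv g *v x)"


section \<open>The two-point function and the Krein inner product\<close>

text \<open>The distributional boundary value, taken in the holomorphic chart: the real chart points \<open>p\<close> and
  \<open>p'\<close> are displaced by imaginary vectors \<open>- \<i> y\<close> and \<open>\<i> y'\<close>, which may tend to zero in an arbitrary way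
  as long as the displaced points stay in the tubes \<open>tube_minus\<close> and \<open>tube_plus\<close>.\<close>

definition displace :: "real ^ 2 \<Rightarrow> real ^ 2 \<Rightarrow> complex ^ 2" where
  "displace p y = (\<chi> i. Complex (p $ i) (y $ i))"

definition tube_displacements :: "real \<Rightarrow> ((real ^ 2) \<times> (real ^ 2)) set" where
  "tube_displacements R = {(y, y'). \<forall>p\<in>chart_domain.
     chart R (displace p (- y)) \<in> tube_minus R \<and> chart R (displace p y') \<in> tube_plus R}"

definition pairing :: "real \<Rightarrow> (real ^ 3 \<Rightarrow> complex) \<Rightarrow> (real ^ 3 \<Rightarrow> complex) \<Rightarrow> complex" where
  "pairing R f g = Lim (at (0, 0) within tube_displacements R) (\<lambda>(y, y').
     LINT (p, p')|(chart_volume R \<Otimes>\<^sub>M chart_volume R).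
       W0 R (chart R (displace p (- y))) (chart R (displace p' y'))
         * cnj (f (chart R p)) * g (chart R p'))"

definition proj0 :: "real \<Rightarrow> (real ^ 3 \<Rightarrow> complex) \<Rightarrow> (real ^ 3 \<Rightarrow> complex) \<Rightarrow> real ^ 3 \<Rightarrow> complex" where
  "proj0 R h f = (\<lambda>x. f x - integ R f * h x)"

definition krein ::
  "real \<Rightarrow> (real ^ 3 \<Rightarrow> complex) \<Rightarrow> (real ^ 3 \<Rightarrow> complex) \<Rightarrow> (real ^ 3 \<Rightarrow> complex) \<Rightarrow> complex" where
  "krein R h f g = pairing R (proj0 R h f) (proj0 R h g)
     + pairing R f h * pairing R h g
     + integ R (\<lambda>x. cnj (f x)) * integ R g"

definition krein_null :: "real \<Rightarrow> (real ^ 3 \<Rightarrow> complex) \<Rightarrow> (real ^ 3 \<Rightarrow> complex) set" where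
  "krein_null R h = {f \<in> test_fun0 R. pairing R f f = 0 \<and> pairing R h f = 0}"


section \<open>Complex Hilbert spaces and the completion\<close>

text \<open>The real vector space structure, the norm and the completeness come from the type class; the inner
  product is antilinear in its first argument.\<close>

locale complex_hilbert_space = vector_space scaleC
  for scaleC :: "complex \<Rightarrow> 'k::banach \<Rightarrow> 'k" +
  fixes cinner :: "'k \<Rightarrow> 'k \<Rightarrow> complex"
  assumes scaleC_of_real: "scaleC (of_real r) x = r *\<^sub>R x"
    and cinner_add_right: "cinner x (y + z) = cinner x y + cinner x z"
    and cinner_scaleC_right: "cinner x (scaleC c y) = c * cinner x y"
    and cinner_commute: "cinner y x = cnj (cinner x y)"
    and cinner_self: "cinner x x = of_real ((norm x)\<^sup>2)"

text \<open>A realisation of the completion of \<open>test_fun R / krein_null R h\<close>: a complex Hilbert space together with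
  the map \<open>\<iota>\<close> sending a test function to its class.\<close>

locale krein_completion = complex_hilbert_space scaleC cinner
  for scaleC :: "complex \<Rightarrow> 'k::banach \<Rightarrow> 'k" and cinner :: "'k \<Rightarrow> 'k \<Rightarrow> complex" +
  fixes R :: real and h :: "real ^ 3 \<Rightarrow> complex" and \<iota> :: "(real ^ 3 \<Rightarrow> complex) \<Rightarrow> 'k"
  assumes class_add:
      "\<lbrakk>f \<in> test_fun R; g \<in> test_fun R\<rbrakk> \<Longrightarrow> \<iota> (\<lambda>x. f x + g x) = \<iota> f + \<iota> g"
    and class_scale: "f \<in> test_fun R \<Longrightarrow> \<iota> (\<lambda>x. c * f x) = scaleC c (\<iota> f)"
    and class_eq_iff:
      "\<lbrakk>f \<in> test_fun R; g \<in> test_fun R\<rbrakk> \<Longrightarrow> \<iota> f = \<iota> g \<longleftrightarrow> (\<lambda>x. f x - g x) \<in> krein_null R h"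
    and cinner_class:
      "\<lbrakk>f \<in> test_fun R; g \<in> test_fun R\<rbrakk> \<Longrightarrow> cinner (\<iota> f) (\<iota> g) = krein R h f g"
    and class_dense: "closure (\<iota> ` test_fun R) = UNIV"

definition continuous_extension ::
  "(complex \<Rightarrow> 'k::banach \<Rightarrow> 'k) \<Rightarrow> real \<Rightarrow> ((real ^ 3 \<Rightarrow> complex) \<Rightarrow> 'k) \<Rightarrow> real ^ 3 ^ 3 \<Rightarrow> ('k \<Rightarrow> 'k) \<Rightarrow> bool"
where
  "continuous_extension scaleC R \<iota> g T \<longleftrightarrow>
     bounded_linear T \<and> (\<forall>c v. T (scaleC c v) = scaleC c (T v)) \<and>
     (\<forall>f\<in>test_fun R. T (\<iota> f) = \<iota> (dS_act g f))"

end

theory Submission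
  imports Defs
begin

text \<open>
  In the conformal chart the tubes are the half spaces \<open>\<bar>Im \<theta>\<bar> < \<plusminus> Im \<tau>\<close>, and \<open>W0\<close> splits into logarithms of
  sines of the null coordinates \<open>u = \<theta> - \<theta>' + \<tau> - \<tau>'\<close> and \<open>v = \<theta> - \<theta>' - (\<tau> - \<tau>')\<close>. Dominated
  convergence turns \<open>pairing\<close> into integration against a locally integrable kernel which depends only
  on the invariant \<open>(x - x')\<^sup>2\<close> and on the time order, so \<open>pairing\<close> is invariant, because the volume is a
  cone measure and \<open>det g = 1\<close>. Up to a function of \<open>\<tau>\<close> alone the kernel is a function of \<open>u\<close> plus a
  function of \<open>v\<close>; these are killed by the d'Alembertian, which leaves the constant \<open>- 1 / (4 \<pi> R\<^sup>2)\<close>.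
  Hence \<open>v = - 4 \<pi> R\<^sup>2 \<box> h\<close> has \<open>\<langle>f, v\<rangle> = cnj (\<integral> f)\<close> and \<open>(v, f) = \<langle>h, f\<rangle>\<close>, so that \<open>f \<mapsto> \<langle>h, f\<rangle>\<close> is
  bounded for the Krein norm, as is \<open>f \<mapsto> \<integral> f = (h, f)\<close>. Since \<open>U g\<close> changes the Krein form only through
  these functionals and \<open>\<langle>f, U h - h\<rangle>\<close>, it is bounded. Invariance of \<open>\<integral> f\<close> puts \<open>U g v - v\<close> into the
  null space.
\<close>

section \<open>The group \<open>SO0_1_2\<close>\<close>

text \<open>The boundary value is defined in one chart, with displacements that are not covariant,
  and the Krein form refers to \<open>h\<close>. So invariance is not visible in the definitions,
  and \<open>U g\<close> need not be isometric. Invariance is read off after the limit, from a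
  kernel on \<open>dS R\<close> written without the chart. The kernel is singular on the light cone
  and cannot be differentiated there. Derivatives are therefore moved onto \<open>h\<close> along
  null lines, on which the singular factor is constant. The phase is a step function; it is split
  into sawtooth functions so that each piece is periodic in the angle. The constant arises from the
  remaining term \<open>- ln (cos \<tau>)\<close>, whose second derivative
  \<open>1 / cos^2 \<tau>\<close> is the volume density divided by \<open>R^2\<close>. Positivity of
  the pairing on functions of zero integral enters through the Hilbert space of
  \<open>krein_completion\<close>, by Cauchy--Schwarz. For \<open>f\<close> and \<open>k\<close> of
  zero integral, \<open>\<langle>f, k\<rangle>\<close> is the Krein product minus
  \<open>\<langle>f, h\<rangle> \<langle>h, k\<rangle>\<close>; this is how the functional built
  from the translate of \<open>h\<close> minus \<open>h\<close> is bounded.\<close>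

lemma three_eq_0: "(3::3) = 0" by simp
lemma two_eq_0: "(2::2) = 0" by simp

text \<open>The library enumerates these index types as \<open>1, 2, 3\<close> and
  \<open>1, 2\<close>. Here time is component \<open>0\<close>, which is the numeral
  \<open>3\<close> of the type \<open>3\<close> and the numeral \<open>2\<close> of the type
  \<open>2\<close>; the variants below rewrite library facts accordingly.\<close>

lemma forall_three: "(\<forall>i::3. P i) \<longleftrightarrow> P 0 \<and> P 1 \<and> P 2"
  by (metis forall_3 three_eq_0)

lemma sum_three: "sum f (UNIV::3 set) = f 0 + f 1 + f 2"
  using sum_3[of f] by (simp only: three_eq_0 ac_simps)

lemma forall_two: "(\<forall>i::2. P i) \<longleftrightarrow> P 0 \<and> P 1"
  by (metis forall_2 two_eq_0)

lemma sum_two: "sum f (UNIV::2 set) = f 0 + f 1"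
  using sum_2[of f] by (simp only: two_eq_0 ac_simps)

lemma mink_diff_self: "mink (x - y) (x - y) = mink x x + mink y y - 2 * mink x (y :: 'a::comm_ring_1^3)"
  by (simp add: mink_def algebra_simps)

lemma mink_scaleR: "mink (a *\<^sub>R x) (b *\<^sub>R y) = a * b * mink x (y::real^3)"
  by (simp add: mink_def algebra_simps)

text \<open>The Gram matrix of \<open>mink\<close>. It turns invariance into the matrix equation
  \<open>transpose g ** minkI ** g = minkI\<close> and thereby makes the inverse of \<open>g\<close>
  explicit.\<close>

definition minkI :: "real^3^3" where
  "minkI = (\<chi> i j. if i = j then (if i = 0 then 1 else -1) else 0)"

lemma mink_eq_inner: "mink x y = x \<bullet> (minkI *v y)"
  by (simp add: mink_def inner_vec_def sum_three minkI_def matrix_vector_mult_def)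

lemma minkI_sq: "minkI ** minkI = mat 1"
  by (simp add: vec_eq_iff forall_three matrix_matrix_mult_def sum_three minkI_def mat_def)

lemma SO_mink: "g \<in> SO0_1_2 \<Longrightarrow> mink (g *v x) (g *v y) = mink x y"
  by (auto simp: SO0_1_2_def)

lemma SO_gram:
  assumes "g \<in> SO0_1_2"
  shows "transpose g ** minkI ** g = minkI"
proof -
  have "x \<bullet> ((transpose g ** minkI ** g) *v y) = x \<bullet> (minkI *v y)" for x y
  proof -
    have "x \<bullet> ((transpose g ** minkI ** g) *v y) = x \<bullet> (transpose g *v (minkI *v (g *v y)))"
      by (simp only: matrix_vector_mul_assoc matrix_mul_assoc)
    also have "\<dots> = (g *v x) \<bullet> (minkI *v (g *v y))"
      by (metis dot_lmul_matrix inner_commute transpose_matrix_vector vector_transpose_matrix)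
    finally show ?thesis using SO_mink[OF assms, of x y] by (simp only: mink_eq_inner)
  qed
  then have "(transpose g ** minkI ** g) *v y = minkI *v y" for y
    by (metis vector_eq_ldot)
  then show ?thesis by (simp add: matrix_eq)
qed

lemma SO_inv_eq:
  assumes "g \<in> SO0_1_2"
  shows "(minkI ** transpose g ** minkI) ** g = mat 1" "g ** (minkI ** transpose g ** minkI) = mat 1"
proof -
  show 1: "(minkI ** transpose g ** minkI) ** g = mat 1"
    using SO_gram[OF assms] minkI_sq by (metis matrix_mul_assoc)
  then show "g ** (minkI ** transpose g ** minkI) = mat 1"
    using matrix_left_right_inverse by blast
qed

lemma matrix_inv_eqI:
  fixes A :: "'a::semiring_1^'n^'m"
  assumes "A ** B = mat 1" "B ** A = mat 1"
  shows "matrix_inv A = B"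
proof -
  have "\<exists>A'. A ** A' = mat 1 \<and> A' ** A = mat 1" using assms by blast
  then have "A ** matrix_inv A = mat 1 \<and> matrix_inv A ** A = mat 1"
    unfolding matrix_inv_def by (rule someI_ex)
  then show ?thesis
    using assms by (metis matrix_mul_assoc matrix_mul_lid matrix_mul_rid)
qed

lemma SO_inverse:
  assumes "g \<in> SO0_1_2"
  shows "matrix_inv g = minkI ** transpose g ** minkI"
  using SO_inv_eq[OF assms] by (intro matrix_inv_eqI)

lemma SO_inv_mult:
  assumes "g \<in> SO0_1_2"
  shows "matrix_inv g *v (g *v x) = x" "g *v (matrix_inv g *v x) = x"
  using SO_inv_eq[OF assms] by (simp_all add: SO_inverse[OF assms] matrix_vector_mul_assoc)

text \<open>The formula \<open>minkI ** transpose g ** minkI\<close> keeps the time-time entry of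
  \<open>g\<close>, so the inverse does not reverse time either.\<close>

lemma SO_matrix_inv:
  assumes g: "g \<in> SO0_1_2"
  shows "matrix_inv g \<in> SO0_1_2"
proof -
  have "det g * det (matrix_inv g) = 1"
    using SO_inv_eq[OF g] by (metis SO_inverse[OF g] det_I det_mul)
  then have "det (matrix_inv g) = 1"
    using g by (simp add: SO0_1_2_def)
  moreover have "mink (matrix_inv g *v x) (matrix_inv g *v y) = mink x y" for x y
    using SO_mink[OF g, of "matrix_inv g *v x" "matrix_inv g *v y"] by (simp add: SO_inv_mult[OF g])
  moreover have "matrix_inv g $ 0 $ 0 = g $ 0 $ 0"
    by (simp add: SO_inverse[OF g] matrix_matrix_mult_def sum_three minkI_def transpose_def)
  ultimately show ?thesis using g by (simp add: SO0_1_2_def)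
qed

lemma SO_matrix_inv_inv: "g \<in> SO0_1_2 \<Longrightarrow> matrix_inv (matrix_inv g) *v x = g *v x"
  by (metis SO_inv_mult SO_matrix_inv)

lemma SO_dS_iff: "g \<in> SO0_1_2 \<Longrightarrow> g *v x \<in> dS R \<longleftrightarrow> x \<in> dS R"
  by (simp add: dS_def SO_mink)

text \<open>Time-time entry of \<open>g ** minkI ** transpose g = minkI\<close>: row
  \<open>0\<close> of \<open>g\<close> is a unit timelike vector.\<close>

lemma SO_time_row:
  assumes g: "g \<in> SO0_1_2"
  shows "(g$0$0)\<^sup>2 = 1 + (g$0$1)\<^sup>2 + (g$0$2)\<^sup>2"
proof -
  have "(g ** (minkI ** transpose g ** minkI)) $ 0 $ 0 = 1"
    using SO_inv_eq(2)[OF g] by (simp add: mat_def)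
  then show ?thesis
    by (simp add: matrix_matrix_mult_def sum_three minkI_def transpose_def power2_eq_square)
qed

text \<open>By Cauchy--Schwarz the spatial part of row \<open>0\<close> contributes less than
  \<open>g$0$0 * \<bar>x$0\<bar>\<close> on a timelike vector, so it cannot reverse the sign of the
  time component. This makes the phase of the kernel invariant.\<close>

lemma SO_sgn_time:
  assumes g: "g \<in> SO0_1_2" and x: "mink x x > 0"
  shows "sgn ((g *v x) $ 0) = sgn (x $ 0)"
proof -
  define r where "r = g$0$1 * x$1 + g$0$2 * x$2"
  have gx: "(g *v x) $ 0 = g$0$0 * x$0 + r"
    by (simp add: matrix_vector_mult_def sum_three r_def)
  have x2: "(x$0)\<^sup>2 > (x$1)\<^sup>2 + (x$2)\<^sup>2" using x by (simp add: mink_def power2_eq_square)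
  have pos: "g$0$0 > 0" using g by (simp add: SO0_1_2_def)
  have "r\<^sup>2 \<le> ((g$0$1)\<^sup>2 + (g$0$2)\<^sup>2) * ((x$1)\<^sup>2 + (x$2)\<^sup>2)"
  proof -
    \<comment> \<open>Lagrange's identity: the defect in Cauchy--Schwarz is a square.\<close>
    have "((g$0$1)\<^sup>2 + (g$0$2)\<^sup>2) * ((x$1)\<^sup>2 + (x$2)\<^sup>2) - r\<^sup>2 = (g$0$1 * x$2 - g$0$2 * x$1)\<^sup>2"
      by (simp add: r_def power2_eq_square algebra_simps)
    then show ?thesis by (metis diff_ge_0_iff_ge zero_le_power2)
  qed
  also have "\<dots> \<le> (g$0$0)\<^sup>2 * ((x$1)\<^sup>2 + (x$2)\<^sup>2)"
    by (intro mult_right_mono) (auto simp: SO_time_row[OF g])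
  also have "\<dots> < (g$0$0)\<^sup>2 * (x$0)\<^sup>2"
    using x2 pos by simp
  finally have "\<bar>r\<bar> < g$0$0 * \<bar>x$0\<bar>"
    using pos power2_less_imp_less[of "\<bar>r\<bar>" "g$0$0 * \<bar>x$0\<bar>"] by (simp add: power_mult_distrib)
  then show ?thesis
    using pos by (cases "x $ 0 \<ge> 0") (auto simp: gx sgn_if abs_if split: if_splits)
qed

section \<open>Calculus of \<open>Ck_on\<close>\<close>

lemma Ck_on_subset: "Ck_on k U F \<Longrightarrow> V \<subseteq> U \<Longrightarrow> Ck_on k V F"
  by (induction k arbitrary: F) (auto intro: continuous_on_subset)

lemma Ck_on_transform:
  assumes "Ck_on k U F" "open U" "\<And>x. x \<in> U \<Longrightarrow> F x = G x"
  shows "Ck_on k U G"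
  using assms(1,3)
proof (induction k arbitrary: F G)
  case 0
  then show ?case by (simp cong: continuous_on_cong)
next
  case (Suc k)
  have G: "(G has_derivative frechet_derivative F (at x)) (at x)" if "x \<in> U" for x
  proof (rule has_derivative_transform_within_open)
    show "(F has_derivative frechet_derivative F (at x)) (at x)"
      using Suc.prems(1) that by (simp add: frechet_derivative_works)
  qed (use that assms(2) Suc.prems(2) in auto)
  then have fr: "frechet_derivative F (at x) b = frechet_derivative G (at x) b" if "x \<in> U" for x b
    using that frechet_derivative_at by fastforce
  have "Ck_on k U (\<lambda>x. frechet_derivative G (at x) b)" if "b \<in> Basis" for b
    by (rule Suc.IH[of "\<lambda>x. frechet_derivative F (at x) b"]) (use Suc.prems(1) that fr in auto)
  then show ?case using G by (auto simp: differentiable_def)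
qed

lemma Ck_on_cont: "open U \<Longrightarrow> Ck_on k U F \<Longrightarrow> continuous_on U F"
  by (cases k) (auto intro!: differentiable_imp_continuous_on differentiable_at_imp_differentiable_on)

lemma Ck_on_SucD: "open U \<Longrightarrow> Ck_on (Suc k) U F \<Longrightarrow> Ck_on k U F"
  by (induction k arbitrary: F) (auto dest: Ck_on_cont[of U "Suc 0"])

text \<open>\<open>Ck_on\<close> speaks of \<open>frechet_derivative\<close>, which is a Hilbert
  choice; this introduction rule accepts any derivative \<open>D\<close> found by calculus.\<close>

lemma Ck_on_SucI:
  assumes U: "open U"
    and D: "\<And>x. x \<in> U \<Longrightarrow> (F has_derivative D x) (at x)"
    and C: "\<And>b. b \<in> Basis \<Longrightarrow> Ck_on k U (\<lambda>x. D x b)"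
  shows "Ck_on (Suc k) U F"
proof -
  have "frechet_derivative F (at x) = D x" if "x \<in> U" for x
    using D[OF that] frechet_derivative_at by metis
  have "Ck_on k U (\<lambda>x. frechet_derivative F (at x) b)" if "b \<in> Basis" for b
    by (rule Ck_on_transform[OF C[OF that] U]) (use \<open>\<And>x. x \<in> U \<Longrightarrow> frechet_derivative F (at x) = D x\<close> in simp)
  then show ?thesis
    using D by (auto simp: differentiable_def)
qed

lemma Ck_on_SucE:
  assumes "Ck_on (Suc k) U F" "x \<in> U"
  shows "(F has_derivative frechet_derivative F (at x)) (at x)"
  using assms by (simp add: frechet_derivative_works)

lemma Ck_on_const: "Ck_on k (U::'a::euclidean_space set) (\<lambda>x. c)"
proof (induction k arbitrary: c)
  case (Suc k)
  have "frechet_derivative (\<lambda>x::'a. c) (at x) = (\<lambda>_. 0)" for x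
    by (metis frechet_derivative_at has_derivative_const)
  then show ?case using Suc.IH[of 0] by simp
qed simp

lemma Ck_on_bounded_linear:
  assumes "open U" "bounded_linear f"
  shows "Ck_on k U f"
proof (cases k)
  case 0
  then show ?thesis using assms by (simp add: linear_continuous_on)
next
  case (Suc m)
  then show ?thesis
    using assms by (auto simp del: Ck_on.simps intro!: Ck_on_SucI[where D="\<lambda>_. f"] Ck_on_const
        bounded_linear_imp_has_derivative)
qed

lemma Ck_on_add:
  assumes "open U" "Ck_on k U F" "Ck_on k U G"
  shows "Ck_on k U (\<lambda>x. F x + G x)"
  using assms(2,3)
proof (induction k arbitrary: F G)
  case 0
  then show ?case by (simp add: continuous_on_add)
next
  case (Suc k)
  show ?case
    by (rule Ck_on_SucI[OF assms(1) has_derivative_add[OF Ck_on_SucE[OF Suc.prems(1)] Ck_on_SucE[OF Suc.prems(2)]]])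
      (use Suc in auto)
qed

text \<open>The product rule for an arbitrary bounded bilinear map treats scalar multiplication and
  multiplication at once. Each summand of the derivative pairs a factor with a derivative of the
  other, hence the step down in order by \<open>Ck_on_SucD\<close>.\<close>

lemma Ck_on_bilinear:
  fixes F :: "'a::euclidean_space \<Rightarrow> 'b::real_normed_vector" and G :: "'a \<Rightarrow> 'c::real_normed_vector"
    and p :: "'b \<Rightarrow> 'c \<Rightarrow> 'd::real_normed_vector"
  assumes "open U" "bounded_bilinear p" "Ck_on k U F" "Ck_on k U G"
  shows "Ck_on k U (\<lambda>x. p (F x) (G x))"
  using assms(3,4)
proof (induction k arbitrary: F G)
  case 0
  then show ?case using bounded_bilinear.continuous_on[OF assms(2)] by simp
next
  case (Suc k)
  show ?case
  proof (rule Ck_on_SucI[OF assms(1)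
        bounded_bilinear.FDERIV[OF assms(2) Ck_on_SucE[OF Suc.prems(1)] Ck_on_SucE[OF Suc.prems(2)]]])
    fix b :: 'a assume b: "b \<in> Basis"
    show "Ck_on k U (\<lambda>x. p (F x) (frechet_derivative G (at x) b) + p (frechet_derivative F (at x) b) (G x))"
      using Suc.prems b Ck_on_SucD[OF assms(1) Suc.prems(1)] Ck_on_SucD[OF assms(1) Suc.prems(2)]
      by (intro Ck_on_add assms(1) Suc.IH) auto
  qed
qed

lemmas Ck_on_scaleR = Ck_on_bilinear[OF _ bounded_bilinear_scaleR]
lemmas Ck_on_mult = Ck_on_bilinear[OF _ bounded_bilinear_mult]

lemma Ck_on_sum:
  assumes "open U" "\<And>i. i \<in> A \<Longrightarrow> Ck_on k U (F i)"
  shows "Ck_on k U (\<lambda>x. \<Sum>i\<in>A. F i x)"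
  using assms(2) by (induction A rule: infinite_finite_induct) (auto intro: Ck_on_const Ck_on_add assms(1))

lemma Ck_on_linear_comp:
  assumes "open U" "bounded_linear f" "Ck_on k U F"
  shows "Ck_on k U (\<lambda>x. f (F x))"
  using assms(3)
proof (induction k arbitrary: F)
  case 0
  then show ?case using bounded_linear.continuous_on[OF assms(2)] by simp
next
  case (Suc k)
  show ?case
    by (rule Ck_on_SucI[OF assms(1) bounded_linear.has_derivative[OF assms(2) Ck_on_SucE[OF Suc.prems]]])
      (use Suc in auto)
qed

lemmas Ck_on_uminus = Ck_on_linear_comp[OF _ bounded_linear_minus[OF bounded_linear_ident]]

lemma Ck_on_componentwise:
  fixes F :: "'a::euclidean_space \<Rightarrow> 'b::euclidean_space"
  assumes "open U" "\<And>b. b \<in> Basis \<Longrightarrow> Ck_on k U (\<lambda>x. F x \<bullet> b)"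
  shows "Ck_on k U F"
proof -
  have "Ck_on k U (\<lambda>x. \<Sum>b\<in>Basis. (F x \<bullet> b) *\<^sub>R b)"
    using assms by (intro Ck_on_sum Ck_on_scaleR Ck_on_const) auto
  then show ?thesis by (simp add: euclidean_representation)
qed

lemma Ck_on_compose:
  fixes F :: "'b::euclidean_space \<Rightarrow> 'c::real_normed_vector" and c :: "'a::euclidean_space \<Rightarrow> 'b"
  assumes U: "open U" and c: "Ck_on k U c" and F: "Ck_on k V F" and V: "\<And>x. x \<in> U \<Longrightarrow> c x \<in> V"
  shows "Ck_on k U (\<lambda>x. F (c x))"
  using c F
proof (induction k arbitrary: F)
  case 0
  then show ?case using V by (auto intro!: continuous_on_compose2[of V F U c])
next
  case (Suc k)
  have der: "((\<lambda>x. F (c x)) has_derivative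
      (\<lambda>b. frechet_derivative F (at (c x)) (frechet_derivative c (at x) b))) (at x)" if "x \<in> U" for x
    using has_derivative_compose[OF Ck_on_SucE[OF Suc.prems(1) that] Ck_on_SucE[OF Suc.prems(2) V[OF that]]] .
  show ?case
  proof (rule Ck_on_SucI[OF U der])
    fix b :: 'a assume b: "b \<in> Basis"
    \<comment> \<open>The chain rule applies a derivative that varies with the point to a direction
      that varies too. Expanding the direction in \<open>Basis\<close> leaves scalar functions times
      directional derivatives of \<open>F\<close> along \<open>c\<close>, to which the induction
      hypothesis applies.\<close>
    have eq: "frechet_derivative F (at (c x)) (frechet_derivative c (at x) b) =
      (\<Sum>e\<in>Basis. (frechet_derivative c (at x) b \<bullet> e) *\<^sub>R frechet_derivative F (at (c x)) e)" if "x \<in> U" for x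
    proof -
      interpret bounded_linear "frechet_derivative F (at (c x))"
        using Ck_on_SucE[OF Suc.prems(2) V[OF that]] has_derivative_bounded_linear by blast
      have "frechet_derivative F (at (c x)) (frechet_derivative c (at x) b) =
        frechet_derivative F (at (c x)) (\<Sum>e\<in>Basis. (frechet_derivative c (at x) b \<bullet> e) *\<^sub>R e)"
        by (simp add: euclidean_representation)
      also have "\<dots> = (\<Sum>e\<in>Basis. (frechet_derivative c (at x) b \<bullet> e) *\<^sub>R frechet_derivative F (at (c x)) e)"
        by (simp only: sum scaleR)
      finally show ?thesis .
    qed
    have "Ck_on k U (\<lambda>x. \<Sum>e\<in>Basis. (frechet_derivative c (at x) b \<bullet> e) *\<^sub>R frechet_derivative F (at (c x)) e)"
      using Suc.prems b Ck_on_SucD[OF U Suc.prems(1)]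
      by (intro Ck_on_sum U Ck_on_scaleR Ck_on_linear_comp[OF U bounded_linear_inner_left] Suc.IH) auto
    then show "Ck_on k U (\<lambda>x. frechet_derivative F (at (c x)) (frechet_derivative c (at x) b))"
      by (rule Ck_on_transform[OF _ U]) (simp add: eq)
  qed
qed

text \<open>Proved jointly: each function is, up to sign, the derivative of the other, so the
  induction on the order needs both.\<close>

lemma Ck_on_cos_sin:
  fixes g :: "'a::euclidean_space \<Rightarrow> real"
  assumes U: "open U" and g: "Ck_on k U g"
  shows "Ck_on k U (\<lambda>x. cos (g x)) \<and> Ck_on k U (\<lambda>x. sin (g x))"
  using g
proof (induction k)
  case 0
  then show ?case by (auto intro: continuous_intros)
next
  case (Suc k)
  have IH: "Ck_on k U (\<lambda>x. cos (g x))" "Ck_on k U (\<lambda>x. sin (g x))"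
    using Suc.IH Ck_on_SucD[OF U Suc.prems] by auto
  have g': "Ck_on k U (\<lambda>x. frechet_derivative g (at x) b)" if "b \<in> Basis" for b
    using Suc.prems that by simp
  have "Ck_on (Suc k) U (\<lambda>x. cos (g x))"
  proof (rule Ck_on_SucI[OF U])
    show "((\<lambda>x. cos (g x)) has_derivative (\<lambda>b. - (sin (g x) * frechet_derivative g (at x) b))) (at x)"
      if "x \<in> U" for x
      by (auto intro!: derivative_eq_intros Ck_on_SucE[OF Suc.prems that])
    show "Ck_on k U (\<lambda>x. - (sin (g x) * frechet_derivative g (at x) b))" if "b \<in> Basis" for b
      by (rule Ck_on_uminus[OF U Ck_on_mult[OF U IH(2) g'[OF that]]])
  qed
  moreover have "Ck_on (Suc k) U (\<lambda>x. sin (g x))"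
  proof (rule Ck_on_SucI[OF U])
    show "((\<lambda>x. sin (g x)) has_derivative (\<lambda>b. cos (g x) * frechet_derivative g (at x) b)) (at x)"
      if "x \<in> U" for x
      by (auto intro!: derivative_eq_intros Ck_on_SucE[OF Suc.prems that])
    show "Ck_on k U (\<lambda>x. cos (g x) * frechet_derivative g (at x) b)" if "b \<in> Basis" for b
      by (rule Ck_on_mult[OF U IH(1) g'[OF that]])
  qed
  ultimately show ?case by blast
qed

lemma Ck_on_inverse:
  fixes g :: "'a::euclidean_space \<Rightarrow> real"
  assumes U: "open U" and g: "Ck_on k U g" and nz: "\<And>x. x \<in> U \<Longrightarrow> g x \<noteq> 0"
  shows "Ck_on k U (\<lambda>x. inverse (g x))"
  using g
proof (induction k)
  case 0
  then show ?case using nz by (auto intro: continuous_intros)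
next
  case (Suc k)
  have IH: "Ck_on k U (\<lambda>x. inverse (g x))"
    using Suc.IH Ck_on_SucD[OF U Suc.prems] by auto
  have g': "Ck_on k U (\<lambda>x. frechet_derivative g (at x) b)" if "b \<in> Basis" for b
    using Suc.prems that by simp
  show ?case
  proof (rule Ck_on_SucI[OF U])
    show "((\<lambda>x. inverse (g x)) has_derivative
        (\<lambda>b. - (inverse (g x) * frechet_derivative g (at x) b * inverse (g x)))) (at x)"
      if "x \<in> U" for x
      by (rule Deriv.has_derivative_inverse[OF nz[OF that] Ck_on_SucE[OF Suc.prems that]])
    show "Ck_on k U (\<lambda>x. - (inverse (g x) * frechet_derivative g (at x) b * inverse (g x)))"
      if "b \<in> Basis" for b
      by (rule Ck_on_uminus[OF U Ck_on_mult[OF U Ck_on_mult[OF U IH g'[OF that]] IH]])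
  qed
qed

section \<open>Test functions\<close>

lemma smooth_on_subsetE:
  assumes "smooth_on_subset S f" "x \<in> S"
  obtains V F where "open V" "x \<in> V" "\<And>k. Ck_on k V F" "\<And>y. y \<in> V \<Longrightarrow> y \<in> S \<Longrightarrow> F y = f y"
  using assms unfolding smooth_on_subset_def by (metis IntI)

lemma smooth_on_subset_continuous:
  assumes "smooth_on_subset S f"
  shows "continuous_on S f"
  unfolding continuous_on_eq_continuous_within
proof
  fix x assume x: "x \<in> S"
  then obtain V F where V: "open V" "x \<in> V" "Ck_on 0 V F" and eq: "\<And>y. y \<in> V \<Longrightarrow> y \<in> S \<Longrightarrow> F y = f y"
    using smooth_on_subsetE[OF assms] by metis
  then have "(F \<longlongrightarrow> F x) (at x within S)"
    by (auto simp: continuous_on_eq_continuous_at isCont_def intro: tendsto_within_subset)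
  then have "(F \<longlongrightarrow> f x) (at x within S)" using eq[of x] V x by simp
  moreover have "\<forall>\<^sub>F y in at x within S. F y = f y"
    using V eq by (auto simp: eventually_at_topological)
  ultimately show "continuous (at x within S) f"
    unfolding continuous_within by (rule Lim_transform_eventually)
qed

lemma closed_dS: "closed (dS R)"
  unfolding dS_def mink_def by (intro closed_Collect_eq continuous_intros)

lemma test_fun_smooth: "f \<in> test_fun R \<Longrightarrow> smooth_on_subset (dS R) f"
  by (simp add: test_fun_def)

lemma test_fun_supportE:
  assumes "f \<in> test_fun R"
  obtains K where "compact K" "K \<subseteq> dS R" "\<And>x. x \<notin> K \<Longrightarrow> f x = 0"
  using assms unfolding test_fun_def by blast

lemma test_fun_off: "f \<in> test_fun R \<Longrightarrow> x \<notin> dS R \<Longrightarrow> f x = 0"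
  using test_fun_supportE by blast

lemma test_fun_continuous_on: "f \<in> test_fun R \<Longrightarrow> continuous_on (dS R) f"
  by (simp add: test_fun_def smooth_on_subset_continuous)

text \<open>Continuity is available only on \<open>dS R\<close>; a Borel function results because
  \<open>dS R\<close> is closed and \<open>f\<close> vanishes off it.\<close>

lemma test_fun_measurable [measurable]:
  assumes "f \<in> test_fun R"
  shows "f \<in> borel_measurable borel"
proof -
  have "(\<lambda>x. if x \<in> dS R then f x else 0) \<in> borel_measurable borel"
    using closed_dS test_fun_continuous_on[OF assms]
    by (intro borel_measurable_continuous_on_if) auto
  also have "(\<lambda>x. if x \<in> dS R then f x else 0) = f"
    using test_fun_off[OF assms] by auto
  finally show ?thesis .
qed

lemma test_fun_bounded:
  assumes "f \<in> test_fun R"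
  obtains C where "C > 0" "\<And>x. norm (f x) \<le> C"
proof -
  obtain K where K: "compact K" "K \<subseteq> dS R" "\<And>x. x \<notin> K \<Longrightarrow> f x = 0"
    using test_fun_supportE[OF assms] by blast
  then have "bounded (f ` K)"
    using test_fun_continuous_on[OF assms] by (meson compact_continuous_image compact_imp_bounded continuous_on_subset)
  then obtain C where "C > 0" "\<And>x. x \<in> K \<Longrightarrow> norm (f x) \<le> C"
    unfolding bounded_pos by auto
  then show thesis using K(3) that by (metis less_imp_le norm_zero)
qed

text \<open>On the hyperboloid a bound on \<open>x $ 0\<close> bounds the other two components as
  well, so this is the form in which later estimates use compact support.\<close>

lemma test_fun_time_bounded:
  assumes "f \<in> test_fun R"
  obtains T where "T > 0" "\<And>x. f x \<noteq> 0 \<Longrightarrow> \<bar>x $ 0\<bar> \<le> T"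
proof -
  obtain K where K: "compact K" "K \<subseteq> dS R" "\<And>x. x \<notin> K \<Longrightarrow> f x = 0"
    using test_fun_supportE[OF assms] by blast
  obtain C where "C > 0" "\<And>x. x \<in> K \<Longrightarrow> norm x \<le> C"
    using compact_imp_bounded[OF K(1)] unfolding bounded_pos by auto
  then show thesis
    using K(3) that by (metis Finite_Cartesian_Product.norm_nth_le order_trans real_norm_def)
qed

lemma test_fun_add:
  assumes "f \<in> test_fun R" "g \<in> test_fun R"
  shows "(\<lambda>x. f x + g x) \<in> test_fun R"
proof -
  have "smooth_on_subset (dS R) (\<lambda>x. f x + g x)"
    unfolding smooth_on_subset_def
  proof
    fix x assume x: "x \<in> dS R"
    obtain V F where V: "open V" "x \<in> V" "\<And>k. Ck_on k V F" "\<And>y. y \<in> V \<Longrightarrow> y \<in> dS R \<Longrightarrow> F y = f y"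
      using smooth_on_subsetE[OF test_fun_smooth[OF assms(1)] x] by metis
    obtain W G where W: "open W" "x \<in> W" "\<And>k. Ck_on k W G" "\<And>y. y \<in> W \<Longrightarrow> y \<in> dS R \<Longrightarrow> G y = g y"
      using smooth_on_subsetE[OF test_fun_smooth[OF assms(2)] x] by metis
    have "Ck_on k (V \<inter> W) (\<lambda>x. F x + G x)" for k
      using V W by (intro Ck_on_add) (auto intro: Ck_on_subset[of _ V F] Ck_on_subset[of _ W G])
    then show "\<exists>V F. open V \<and> x \<in> V \<and> (\<forall>k. Ck_on k V F) \<and> (\<forall>y\<in>V \<inter> dS R. F y = f y + g y)"
      using V W by (intro exI[of _ "V \<inter> W"] exI[of _ "\<lambda>x. F x + G x"]) auto
  qed
  moreover obtain K where "compact K" "K \<subseteq> dS R" "\<And>x. x \<notin> K \<Longrightarrow> f x = 0"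
    using test_fun_supportE[OF assms(1)] by blast
  moreover obtain L where "compact L" "L \<subseteq> dS R" "\<And>x. x \<notin> L \<Longrightarrow> g x = 0"
    using test_fun_supportE[OF assms(2)] by blast
  ultimately show ?thesis
    unfolding test_fun_def using compact_Un[of K L] by (auto intro!: exI[of _ "K \<union> L"] simp del: add_eq_0_iff) (metis add_0)
qed

lemma test_fun_linear_comp:
  assumes "bounded_linear l" and f: "f \<in> test_fun R"
  shows "(\<lambda>x. l (f x)) \<in> test_fun R"
proof -
  have "smooth_on_subset (dS R) (\<lambda>x. l (f x))"
    unfolding smooth_on_subset_def
  proof
    fix x assume x: "x \<in> dS R"
    obtain V F where V: "open V" "x \<in> V" "\<And>k. Ck_on k V F" "\<And>y. y \<in> V \<Longrightarrow> y \<in> dS R \<Longrightarrow> F y = f y"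
      using smooth_on_subsetE[OF test_fun_smooth[OF f] x] by metis
    then show "\<exists>V F. open V \<and> x \<in> V \<and> (\<forall>k. Ck_on k V F) \<and> (\<forall>y\<in>V \<inter> dS R. F y = l (f y))"
      using Ck_on_linear_comp[OF V(1) assms(1) V(3)] by (intro exI[of _ V] exI[of _ "\<lambda>x. l (F x)"]) auto
  qed
  moreover obtain K where "compact K" "K \<subseteq> dS R" "\<And>x. x \<notin> K \<Longrightarrow> f x = 0"
    using test_fun_supportE[OF f] by blast
  moreover have "l 0 = 0" by (rule linear_0[OF bounded_linear.linear[OF assms(1)]])
  ultimately show ?thesis
    unfolding test_fun_def by (auto intro!: exI[of _ K])
qed

lemma test_fun_scale: "f \<in> test_fun R \<Longrightarrow> (\<lambda>x. c * f x) \<in> test_fun R"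
  by (rule test_fun_linear_comp[OF bounded_linear_mult_right])

lemma test_fun_diff:
  assumes "f \<in> test_fun R" "g \<in> test_fun R"
  shows "(\<lambda>x. f x - g x) \<in> test_fun R"
  using test_fun_add[OF assms(1) test_fun_scale[OF assms(2), of "-1"]] by simp

lemma test_fun_dS_act:
  assumes g: "g \<in> SO0_1_2" and f: "f \<in> test_fun R"
  shows "dS_act g f \<in> test_fun R"
proof -
  let ?A = "\<lambda>x. matrix_inv g *v x"
  have cont: "continuous_on U ?A" for U by (simp add: matrix_vector_mult_linear_continuous_on)
  have dS: "?A x \<in> dS R \<longleftrightarrow> x \<in> dS R" for x
    using SO_dS_iff[OF SO_matrix_inv[OF g]] .
  have "smooth_on_subset (dS R) (dS_act g f)"
    unfolding smooth_on_subset_def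
  proof
    fix x assume x: "x \<in> dS R"
    obtain V F where V: "open V" "?A x \<in> V" "\<And>k. Ck_on k V F" "\<And>y. y \<in> V \<Longrightarrow> y \<in> dS R \<Longrightarrow> F y = f y"
      using smooth_on_subsetE[OF test_fun_smooth[OF f]] dS x by metis
    have op: "open (?A -` V)" using V(1) cont by (simp add: continuous_on_open_vimage open_vimage)
    have "Ck_on k (?A -` V) (\<lambda>x. F (?A x))" for k
      using op V by (intro Ck_on_compose[OF op _ V(3)] Ck_on_bounded_linear) (auto simp: matrix_vector_mul_bounded_linear)
    then show "\<exists>V F. open V \<and> x \<in> V \<and> (\<forall>k. Ck_on k V F) \<and> (\<forall>y\<in>V \<inter> dS R. F y = dS_act g f y)"
      using op V dS by (intro exI[of _ "?A -` V"] exI[of _ "\<lambda>x. F (?A x)"]) (auto simp: dS_act_def)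
  qed
  moreover obtain K where K: "compact K" "K \<subseteq> dS R" "\<And>x. x \<notin> K \<Longrightarrow> f x = 0"
    using test_fun_supportE[OF f] by blast
  have "compact ((\<lambda>x. g *v x) ` K)"
    using K(1) by (intro compact_continuous_image) (simp add: matrix_vector_mult_linear_continuous_on)
  moreover have "(\<lambda>x. g *v x) ` K \<subseteq> dS R"
    using K(2) SO_dS_iff[OF g] by auto
  moreover have "dS_act g f x = 0" if "x \<notin> (\<lambda>x. g *v x) ` K" for x
    using that K(3)[of "?A x"] SO_inv_mult(2)[OF g, of x] unfolding dS_act_def by (metis imageI)
  ultimately show ?thesis unfolding test_fun_def by blast
qed

section \<open>The chart\<close>

definition pt :: "'a \<Rightarrow> 'a \<Rightarrow> 'a ^ 2" where
  "pt \<tau> \<theta> = (\<chi> i. if i = 0 then \<tau> else \<theta>)"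

lemma pt_nth [simp]: "pt \<tau> \<theta> $ 0 = \<tau>" "pt \<tau> \<theta> $ 1 = \<theta>"
  by (simp_all add: pt_def)

lemma pt_eta [simp]: "pt (p $ 0) (p $ 1) = p"
  by (simp add: vec_eq_iff forall_two)

lemma vec2_eq_iff: "p = q \<longleftrightarrow> p $ 0 = q $ 0 \<and> p $ 1 = (q::'a^2) $ 1"
  by (simp add: vec_eq_iff forall_two)

lemma vec3_eq_iff: "p = q \<longleftrightarrow> p $ 0 = q $ 0 \<and> p $ 1 = (q::'a^3) $ 1 \<and> p $ 2 = q $ 2"
  by (simp add: vec_eq_iff forall_three)

text \<open>\<open>chart_domain\<close> is half open in the angle and so unsuitable for derivatives.
  The strip is the open set on which the chart is an immersion, periodic in the angle.\<close>

definition strip :: "(real ^ 2) set" where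
  "strip = {p. - (pi / 2) < p $ 0 \<and> p $ 0 < pi / 2}"

lemma open_strip: "open strip"
  unfolding strip_def by (intro open_Collect_conj open_Collect_less continuous_intros)

lemma chart_domain_subset_strip: "chart_domain \<subseteq> strip"
  by (auto simp: chart_domain_def strip_def)

lemma strip_cos_pos: "p \<in> strip \<Longrightarrow> cos (p $ 0) > 0"
  by (simp add: strip_def cos_gt_zero_pi)

lemma chart_nth:
  "chart R p $ 0 = of_real R * tan (p $ 0)"
  "chart R p $ 1 = of_real R * (cos (p $ 1) / cos (p $ 0))"
  "chart R p $ 2 = of_real R * (sin (p $ 1) / cos (p $ 0))"
  by (simp_all add: chart_def)

text \<open>Stated over a general field because the same identity serves real points and points
  displaced in imaginary directions.\<close>

lemma mink_chart:
  fixes p q :: "'a::{real_normed_field,banach} ^ 2"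
  assumes "cos (p $ 0) \<noteq> 0" "cos (q $ 0) \<noteq> 0"
  shows "mink (chart R p) (chart R q) = (of_real R)\<^sup>2 *
    (sin (p $ 0) * sin (q $ 0) - cos (p $ 1 - q $ 1)) / (cos (p $ 0) * cos (q $ 0))"
  using assms by (simp add: mink_def chart_nth tan_def cos_diff field_simps power2_eq_square)

lemma chart_self:
  fixes p :: "'a::{real_normed_field,banach} ^ 2"
  assumes "cos (p $ 0) \<noteq> 0"
  shows "mink (chart R p) (chart R p) = - (of_real R)\<^sup>2"
proof -
  have "sin (p $ 0) * sin (p $ 0) - 1 = - (cos (p $ 0) * cos (p $ 0))"
    using sin_cos_squared_add[of "p $ 0"] by (simp add: power2_eq_square algebra_simps)
  then show ?thesis using assms by (simp add: mink_chart)
qed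

lemma chart_in_dS: "p \<in> strip \<Longrightarrow> chart R p \<in> dS R"
  using chart_self[of p R] strip_cos_pos[of p] by (simp add: dS_def)

lemma chart_inj:
  assumes "R > 0"
  shows "inj_on (chart R) chart_domain"
proof (rule inj_onI)
  fix p q :: "real^2"
  assume p: "p \<in> chart_domain" and q: "q \<in> chart_domain" and eq: "chart R p = chart R q"
  have tan: "tan (p $ 0) = tan (q $ 0)"
    using arg_cong[OF eq, of "\<lambda>x. x $ 0"] assms by (simp add: chart_nth)
  have "p $ 0 = q $ 0"
    using p q tan tan_monotone[of "p $ 0" "q $ 0"] tan_monotone[of "q $ 0" "p $ 0"]
    by (cases "p $ 0" "q $ 0" rule: linorder_cases) (auto simp: chart_domain_def)
  moreover have "cos (q $ 0) > 0" using q chart_domain_subset_strip strip_cos_pos by blast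
  ultimately have "cos (p $ 1) = cos (q $ 1)" "sin (p $ 1) = sin (q $ 1)"
    using arg_cong[OF eq, of "\<lambda>x. x $ 1"] arg_cong[OF eq, of "\<lambda>x. x $ 2"] assms by (simp_all add: chart_nth)
  then have "cis (p $ 1) = cis (q $ 1)" by (simp add: cis.ctr)
  then have "p $ 1 = q $ 1"
    using p q cis_Arg_unique[of "cis (p$1)" "p $ 1"] cis_Arg_unique[of "cis (p$1)" "q $ 1"]
    by (simp add: chart_domain_def sgn_eq)
  with \<open>p $ 0 = q $ 0\<close> show "p = q" by (simp add: vec2_eq_iff)
qed

text \<open>The time coordinate is \<open>arctan (x $ 0 / R)\<close>; the angle is the argument of
  the complex number with parts \<open>x $ 1\<close> and \<open>x $ 2\<close>, whose modulus is
  \<open>R / cos \<tau>\<close>.\<close>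

lemma chart_surj:
  assumes "R > 0" "x \<in> dS R"
  obtains p where "p \<in> chart_domain" "chart R p = x"
proof -
  define t where "t = arctan (x $ 0 / R)"
  define z where "z = Complex (x $ 1) (x $ 2)"
  have x: "(x$1)\<^sup>2 + (x$2)\<^sup>2 = R\<^sup>2 + (x$0)\<^sup>2" using assms(2) by (simp add: dS_def mink_def power2_eq_square)
  have "R\<^sup>2 + (x$0)\<^sup>2 > 0" using assms(1) by (simp add: add_pos_nonneg)
  then have z0: "z \<noteq> 0" using x by (auto simp: z_def complex_eq_iff)
  have "cmod z = sqrt (R\<^sup>2 * (1 + (x $ 0 / R)\<^sup>2))"
    using x assms(1) by (simp add: z_def cmod_def field_simps)
  then have cz: "cmod z = R / cos t"
    using assms(1) by (simp add: t_def cos_arctan real_sqrt_mult)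
  have "pt t (Arg z) \<in> chart_domain"
    using arctan[of "x $ 0 / R"] Arg_bounded[of z] by (simp add: chart_domain_def t_def)
  moreover have "chart R (pt t (Arg z)) = x"
  proof -
    have "cos t \<noteq> 0" by (simp add: t_def)
    then have "R * (cos (Arg z) / cos t) = cmod z * cos (Arg z)" "R * (sin (Arg z) / cos t) = cmod z * sin (Arg z)"
      by (simp_all add: cz)
    then show ?thesis
      using z0 assms(1) by (simp add: vec3_eq_iff chart_nth cos_Arg sin_Arg t_def arctan) (simp add: z_def)
  qed
  ultimately show thesis by (rule that)
qed

lemma the_inv_into_chart:
  "R > 0 \<Longrightarrow> p \<in> chart_domain \<Longrightarrow> the_inv_into chart_domain (chart R) (chart R p) = p"
  by (rule the_inv_into_f_f[OF chart_inj])

section \<open>Partial derivatives and the induced metric in the chart\<close>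

lemma has_vector_derivative_vecI:
  fixes f :: "real \<Rightarrow> real^'n"
  assumes "\<And>i. ((\<lambda>s. f s $ i) has_real_derivative f' $ i) (at x)"
  shows "(f has_vector_derivative f') (at x)"
proof -
  have "(f has_derivative (\<lambda>h. h *\<^sub>R f')) (at x)"
  proof (subst has_derivative_componentwise_within, intro ballI)
    fix b :: "real^'n" assume "b \<in> Basis"
    then obtain i where "b = axis i 1" by (auto simp: Basis_vec_def)
    then show "((\<lambda>s. f s \<bullet> b) has_derivative (\<lambda>h. (h *\<^sub>R f') \<bullet> b)) (at x)"
      using assms[of i] by (simp add: inner_axis has_field_derivative_def mult_commute_abs)
  qed
  then show ?thesis by (simp add: has_vector_derivative_def)
qed

lemma axis_two_nth [simp]:
  "axis (0::2) a $ 0 = a" "axis (0::2) a $ 1 = 0" "axis (1::2) a $ 0 = 0" "axis (1::2) a $ 1 = a"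
  by (simp_all add: axis_def)

lemma has_vector_derivative_partial:
  assumes "(u has_derivative D) (at p)"
  shows "((\<lambda>s. u (p + s *\<^sub>R axis i 1)) has_vector_derivative D (axis i 1)) (at 0)"
proof -
  have 1: "((\<lambda>s. p + s *\<^sub>R axis i 1) has_vector_derivative axis i 1) (at 0)"
    by (auto intro!: derivative_eq_intros)
  have 2: "(u has_derivative D) (at (p + 0 *\<^sub>R axis i 1))" using assms by simp
  show ?thesis
    using vector_derivative_diff_chain_within[of "\<lambda>s. p + s *\<^sub>R axis i 1" "axis i 1" 0 UNIV u D] 1 2
    by (simp add: o_def has_derivative_at_withinI)
qed

lemma partial_eq: "(u has_derivative D) (at p) \<Longrightarrow> partial i u p = D (axis i 1)"
  unfolding partial_def using has_vector_derivative_partial vector_derivative_at by blast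

lemma partial_cong:
  assumes "open U" "p \<in> U" "\<And>q. q \<in> U \<Longrightarrow> u q = v q"
  shows "partial i u p = partial i v p"
  unfolding partial_def
proof (rule vector_derivative_cong_eq)
  have "((\<lambda>s. p + s *\<^sub>R axis i 1) \<longlongrightarrow> p) (at (0::real))"
    by (auto intro!: tendsto_eq_intros)
  then have "\<forall>\<^sub>F s in at 0. p + s *\<^sub>R axis i 1 \<in> U"
    using assms topological_tendstoD by blast
  then have "\<forall>\<^sub>F s in nhds 0. p + s *\<^sub>R axis i 1 \<in> U"
    using assms(2) by (simp add: eventually_nhds_conv_at)
  then show "\<forall>\<^sub>F s in nhds 0. s \<in> UNIV \<longrightarrow> u (p + s *\<^sub>R axis i 1) = v (p + s *\<^sub>R axis i 1)"
    using assms(3) by (auto elim: eventually_mono)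
qed auto

lemma partial_uminus:
  assumes "(u has_derivative D) (at p)"
  shows "partial i (\<lambda>q. - u q) p = - partial i u p"
  using partial_eq[OF has_derivative_minus[OF assms]] partial_eq[OF assms] by simp

definition chart_t :: "real \<Rightarrow> real^2 \<Rightarrow> real^3" where
  "chart_t R p = (\<chi> i. R * (if i = 0 then 1 / (cos (p$0))\<^sup>2
      else if i = 1 then cos (p$1) * sin (p$0) / (cos (p$0))\<^sup>2 else sin (p$1) * sin (p$0) / (cos (p$0))\<^sup>2))"

definition chart_th :: "real \<Rightarrow> real^2 \<Rightarrow> real^3" where
  "chart_th R p = (\<chi> i. R * (if i = 0 then 0 else if i = 1 then - sin (p$1) / cos (p$0) else cos (p$1) / cos (p$0)))"

lemma partial_chart:
  assumes "p \<in> strip"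
  shows "partial 0 (chart R) p = chart_t R p" "partial 1 (chart R) p = chart_th R p"
proof -
  have c: "cos (p$0) \<noteq> 0" using strip_cos_pos[OF assms] by simp
  have "((\<lambda>s. chart R (p + s *\<^sub>R axis 0 1)) has_vector_derivative chart_t R p) (at 0)"
    by (rule has_vector_derivative_vecI)
      (use c in \<open>auto simp: chart_def chart_t_def intro!: derivative_eq_intros simp: field_simps power2_eq_square\<close>)
  then show "partial 0 (chart R) p = chart_t R p"
    unfolding partial_def by (rule vector_derivative_at)
  have "((\<lambda>s. chart R (p + s *\<^sub>R axis 1 1)) has_vector_derivative chart_th R p) (at 0)"
    by (rule has_vector_derivative_vecI)
      (use c in \<open>auto simp: chart_def chart_th_def intro!: derivative_eq_intros simp: field_simps power2_eq_square\<close>)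
  then show "partial 1 (chart R) p = chart_th R p"
    unfolding partial_def by (rule vector_derivative_at)
qed

text \<open>Conformal flatness, the reason for working in this chart: the null directions become the
  diagonals of the coordinate plane.\<close>

lemma metric_eq:
  assumes "p \<in> strip"
  shows "metric R p = (\<chi> i j. if i = j then (if i = 0 then R\<^sup>2 / (cos (p$0))\<^sup>2 else - R\<^sup>2 / (cos (p$0))\<^sup>2) else 0)"
proof -
  have c: "cos (p$0) \<noteq> 0" using strip_cos_pos[OF assms] by simp
  have s: "sin (p$0) * sin (p$0) = 1 - cos (p$0) * cos (p$0)" "sin (p$1) * sin (p$1) = 1 - cos (p$1) * cos (p$1)"
    using sin_cos_squared_add[of "p $ 0"] sin_cos_squared_add[of "p $ 1"] by (simp_all add: power2_eq_square algebra_simps)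
  have "mink (chart_t R p) (chart_t R p) = R\<^sup>2 * (1 - (cos (p$1) * cos (p$1)) * (sin (p$0) * sin (p$0))
      - (sin (p$1) * sin (p$1)) * (sin (p$0) * sin (p$0))) / (cos (p$0))^4"
    by (simp add: mink_def chart_t_def power2_eq_square power4_eq_xxxx diff_divide_distrib right_diff_distrib mult_ac)
  also have "\<dots> = R\<^sup>2 * (1 - (sin (p$0) * sin (p$0))) / (cos (p$0))^4"
    by (simp add: s(2) algebra_simps)
  also have "\<dots> = R\<^sup>2 / (cos (p$0))\<^sup>2"
    using c by (simp add: s(1) power2_eq_square power4_eq_xxxx)
  finally have 1: "mink (chart_t R p) (chart_t R p) = R\<^sup>2 / (cos (p$0))\<^sup>2" .
  have "mink (chart_th R p) (chart_th R p) =
      - R\<^sup>2 * ((sin (p$1) * sin (p$1)) / (cos (p$0))\<^sup>2) - R\<^sup>2 * ((cos (p$1) * cos (p$1)) / (cos (p$0))\<^sup>2)"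
    by (simp add: mink_def chart_th_def power2_eq_square mult_ac)
  then have 2: "mink (chart_th R p) (chart_th R p) = - R\<^sup>2 / (cos (p$0))\<^sup>2"
    unfolding s(2) by (simp add: diff_divide_distrib right_diff_distrib)
  have 3: "mink (chart_t R p) (chart_th R p) = 0" "mink (chart_th R p) (chart_t R p) = 0"
    by (simp_all add: mink_def chart_th_def chart_t_def field_simps)
  show ?thesis
    using 1 2 3 by (simp add: metric_def vec_eq_iff forall_two partial_chart[OF assms])
qed

lemma det_two: "det (A::'a::comm_ring_1^2^2) = A$0$0 * A$1$1 - A$0$1 * A$1$0"
  using det_2[of A] by (simp only: two_eq_0) (simp add: algebra_simps)

lemma vol_density_eq:
  assumes "p \<in> strip"
  shows "vol_density R p = R\<^sup>2 / (cos (p$0))\<^sup>2"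
proof -
  have "\<bar>det (metric R p)\<bar> = (R\<^sup>2 / (cos (p$0))\<^sup>2)\<^sup>2"
    by (simp add: det_two metric_eq[OF assms] abs_mult power2_eq_square)
  then show ?thesis by (simp add: vol_density_def)
qed

lemma matrix_inv_metric:
  assumes "p \<in> strip" "R > 0"
  shows "matrix_inv (metric R p) = (\<chi> i j. if i = j then (if i = 0 then (cos (p$0))\<^sup>2 / R\<^sup>2 else - (cos (p$0))\<^sup>2 / R\<^sup>2) else 0)"
  using strip_cos_pos[OF assms(1)] assms(2)
  by (intro matrix_inv_eqI)
     (auto simp: metric_eq[OF assms(1)] vec_eq_iff forall_two matrix_matrix_mult_def sum_two mat_def)

lemma not_zero_two: "i \<noteq> 0 \<longleftrightarrow> i = (1::2)"
  using forall_two[of "\<lambda>i. i \<noteq> 0 \<longleftrightarrow> i = 1"] by auto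

text \<open>In two dimensions the product of \<open>sqrt \<bar>det g\<bar>\<close> with the inverse
  metric does not change under conformal rescaling. The coefficients under the outer derivatives
  reduce to \<open>1\<close> and \<open>-1\<close>, and the conformal factor survives only in
  front.\<close>

lemma box_chart_eq:
  assumes p: "p \<in> strip" and R: "R > 0" and u: "(partial 1 u has_derivative D) (at p)"
  shows "box_chart R u p = ((cos (p$0))\<^sup>2 / R\<^sup>2) *\<^sub>R (partial 0 (partial 0 u) p - partial 1 (partial 1 u) p)"
proof -
  have f: "vol_density R q *\<^sub>R (\<Sum>j\<in>UNIV. matrix_inv (metric R q) $ i $ j *\<^sub>R partial j u q)
      = (if i = 0 then partial 0 u q else - partial 1 u q)" if q: "q \<in> strip" for q i
    using strip_cos_pos[OF q] R
    by (cases "i = 0") (auto simp: sum_two vol_density_eq[OF q] matrix_inv_metric[OF q R] not_zero_two)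
  have "partial 0 (\<lambda>q. vol_density R q *\<^sub>R (\<Sum>j\<in>UNIV. matrix_inv (metric R q) $ 0 $ j *\<^sub>R partial j u q)) p
      = partial 0 (partial 0 u) p"
    by (rule partial_cong[OF open_strip p]) (simp add: f)
  moreover have "partial 1 (\<lambda>q. vol_density R q *\<^sub>R (\<Sum>j\<in>UNIV. matrix_inv (metric R q) $ 1 $ j *\<^sub>R partial j u q)) p
      = partial 1 (\<lambda>q. - partial 1 u q) p"
    by (rule partial_cong[OF open_strip p]) (simp add: f)
  ultimately show ?thesis
    by (simp add: box_chart_def sum_two partial_uminus[OF u] vol_density_eq[OF p])
qed

lemma Ck_on_local:
  assumes "\<And>x. x \<in> U \<Longrightarrow> \<exists>V. open V \<and> x \<in> V \<and> Ck_on k V F"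
  shows "Ck_on k U F"
  using assms
proof (induction k arbitrary: F)
  case 0
  then have "isCont F x" if "x \<in> U" for x
    using that by (metis Ck_on.simps(1) continuous_on_eq_continuous_at)
  then show ?case by (simp add: continuous_at_imp_continuous_on)
next
  case (Suc k)
  have "F differentiable (at x)" if "x \<in> U" for x
    using Suc.prems[OF that] by auto
  moreover have "Ck_on k U (\<lambda>x. frechet_derivative F (at x) b)" if "b \<in> Basis" for b
    by (rule Suc.IH) (use Suc.prems that in fastforce)
  ultimately show ?case by simp
qed

lemma Ck_on_nth:
  assumes "open U"
  shows "Ck_on k U (\<lambda>p. p $ i :: real)"
  using assms by (intro Ck_on_bounded_linear bounded_linear_vec_nth)

lemma Ck_on_chart: "Ck_on k strip (chart R)"
proof (rule Ck_on_componentwise[OF open_strip])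
  fix b :: "real^3" assume "b \<in> Basis"
  then obtain i where i: "b = axis i 1" by (auto simp: Basis_vec_def)
  note [simp] = open_strip
  have n: "Ck_on k strip (\<lambda>p. p $ j :: real)" for j by (rule Ck_on_nth[OF open_strip])
  have inv: "Ck_on k strip (\<lambda>p. inverse (cos (p $ 0)))"
    using Ck_on_cos_sin[OF open_strip n] by (intro Ck_on_inverse) (auto dest: strip_cos_pos)
  have *: "Ck_on k strip (\<lambda>p. R * (f p * inverse (cos (p $ 0))))" if "Ck_on k strip f" for f
    using that inv by (intro Ck_on_mult Ck_on_const) auto
  have "Ck_on k strip (\<lambda>p. chart R p $ 0)" "Ck_on k strip (\<lambda>p. chart R p $ 1)" "Ck_on k strip (\<lambda>p. chart R p $ 2)"
    using *[of "\<lambda>p. sin (p $ 0)"] *[of "\<lambda>p. cos (p $ 1)"] *[of "\<lambda>p. sin (p $ 1)"] Ck_on_cos_sin[OF open_strip n]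
    by (simp_all add: chart_nth tan_def divide_inverse)
  then have "\<forall>i. Ck_on k strip (\<lambda>p. chart R p $ i)" by (simp add: forall_three)
  then show "Ck_on k strip (\<lambda>p. chart R p \<bullet> b)" by (simp add: i inner_axis)
qed

lemma continuous_on_chart: "continuous_on strip (chart R)"
  using Ck_on_chart[of 0] by simp

lemma Ck_on_chart_pullback:
  assumes "Ck_on k V F" "open V" "U \<subseteq> strip" "open U" "chart R ` U \<subseteq> V"
  shows "Ck_on k U (F \<circ> chart R)"
  using Ck_on_compose[OF assms(4) Ck_on_subset[OF Ck_on_chart assms(3)] assms(1)] assms(5)
  by (auto simp: o_def)

lemma local_extension_pullback:
  assumes "smooth_on_subset (dS R) h" "p \<in> strip"
  obtains V F U where "open V" "chart R p \<in> V" "\<And>k. Ck_on k V F" "\<And>y. y \<in> V \<Longrightarrow> y \<in> dS R \<Longrightarrow> F y = h y"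
    "open U" "p \<in> U" "U \<subseteq> strip" "chart R ` U \<subseteq> V" "\<And>q. q \<in> U \<Longrightarrow> (h \<circ> chart R) q = (F \<circ> chart R) q"
proof -
  obtain V F where V: "open V" "chart R p \<in> V" "\<And>k. Ck_on k V F" "\<And>y. y \<in> V \<Longrightarrow> y \<in> dS R \<Longrightarrow> F y = h y"
    using smooth_on_subsetE[OF assms(1) chart_in_dS[OF assms(2)]] by metis
  define U where "U = strip \<inter> chart R -` V"
  have "open U"
    unfolding U_def Int_commute[of strip]
    using continuous_on_chart open_strip V(1) continuous_on_open_vimage by blast
  moreover have "p \<in> U" "U \<subseteq> strip" "chart R ` U \<subseteq> V" using V(2) assms(2) by (auto simp: U_def)
  ultimately show thesis
    using V by (intro that[of V F U]) (auto simp: chart_in_dS subset_iff)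
qed

lemma Ck_on_pullback:
  assumes "smooth_on_subset (dS R) h"
  shows "Ck_on k strip (h \<circ> chart R)"
proof (rule Ck_on_local)
  fix p assume "p \<in> strip"
  then obtain V F U where *: "open V" "Ck_on k V F"
    "open U" "p \<in> U" "U \<subseteq> strip" "chart R ` U \<subseteq> V" "\<And>q. q \<in> U \<Longrightarrow> (h \<circ> chart R) q = (F \<circ> chart R) q"
    using local_extension_pullback[OF assms, of p] by metis
  then have "Ck_on k U (F \<circ> chart R)" by (intro Ck_on_chart_pullback[of k V])
  then have "Ck_on k U (h \<circ> chart R)"
    by (rule Ck_on_transform[OF _ *(3)]) (metis *(7))
  then show "\<exists>V. open V \<and> p \<in> V \<and> Ck_on k V (h \<circ> chart R)" using * by blast
qed

lemma Ck_on_partial: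
  assumes "open U" "Ck_on (Suc k) U u"
  shows "Ck_on k U (partial i u)"
proof (rule Ck_on_transform)
  have "axis i (1::real) \<in> Basis" by (simp add: axis_in_Basis_iff)
  then show "Ck_on k U (\<lambda>x. frechet_derivative u (at x) (axis i 1))" using assms by simp
  show "frechet_derivative u (at x) (axis i 1) = partial i u x" if "x \<in> U" for x
    using partial_eq[OF Ck_on_SucE[OF assms(2) that]] by simp
qed fact

lemma has_derivative_partials:
  assumes "Ck_on (Suc k) U u" "x \<in> U"
  shows "(u has_derivative (\<lambda>v. v $ 0 *\<^sub>R partial 0 u x + v $ 1 *\<^sub>R partial 1 u x)) (at x)"
proof -
  let ?D = "frechet_derivative u (at x)"
  note D = Ck_on_SucE[OF assms]
  interpret bounded_linear ?D using D by (rule has_derivative_bounded_linear)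
  have "?D v = v $ 0 *\<^sub>R partial 0 u x + v $ 1 *\<^sub>R partial 1 u x" for v
  proof -
    have "v = v $ 0 *\<^sub>R axis 0 1 + v $ 1 *\<^sub>R axis 1 1" by (simp add: vec2_eq_iff)
    then have "?D v = ?D (v $ 0 *\<^sub>R axis 0 1 + v $ 1 *\<^sub>R axis 1 1)" by simp
    then show ?thesis using partial_eq[OF D] by (simp add: add scaleR)
  qed
  then have "?D = (\<lambda>v. v $ 0 *\<^sub>R partial 0 u x + v $ 1 *\<^sub>R partial 1 u x)" by blast
  with D show ?thesis by simp
qed

section \<open>The d'Alembertian\<close>

text \<open>Schwarz's theorem by the second difference over a square of side \<open>k\<close>. The
  mean value theorem, used once in each variable and in both orders, equates a value of
  \<open>gs\<close> with a value of \<open>gt\<close> close to the origin.\<close>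

lemma mixed_derivatives_eq:
  fixes f :: "real \<Rightarrow> real \<Rightarrow> real"
  assumes e: "e > 0"
    and fs: "\<And>s t. \<bar>s\<bar> < e \<Longrightarrow> \<bar>t\<bar> < e \<Longrightarrow> ((\<lambda>s. f s t) has_real_derivative fs s t) (at s)"
    and ft: "\<And>s t. \<bar>s\<bar> < e \<Longrightarrow> \<bar>t\<bar> < e \<Longrightarrow> ((\<lambda>t. f s t) has_real_derivative ft s t) (at t)"
    and gs: "\<And>s t. \<bar>s\<bar> < e \<Longrightarrow> \<bar>t\<bar> < e \<Longrightarrow> ((\<lambda>t. fs s t) has_real_derivative gs s t) (at t)"
    and gt: "\<And>s t. \<bar>s\<bar> < e \<Longrightarrow> \<bar>t\<bar> < e \<Longrightarrow> ((\<lambda>s. ft s t) has_real_derivative gt s t) (at s)"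
    and c1: "((\<lambda>(s,t). gs s t) \<longlongrightarrow> gs 0 0) (nhds (0,0))"
    and c2: "((\<lambda>(s,t). gt s t) \<longlongrightarrow> gt 0 0) (nhds (0,0))"
  shows "gs 0 0 = gt 0 0"
proof (rule ccontr)
  assume ne: "gs 0 0 \<noteq> gt 0 0"
  define d where "d = \<bar>gs 0 0 - gt 0 0\<bar> / 2"
  have d: "d > 0" using ne by (simp add: d_def)
  obtain r1 where r1: "r1 > 0" "\<And>z. dist z (0,0) < r1 \<Longrightarrow> dist (case z of (s,t) \<Rightarrow> gs s t) (gs 0 0) < d"
    using tendstoD[OF c1 d] unfolding eventually_nhds_metric by blast
  obtain r2 where r2: "r2 > 0" "\<And>z. dist z (0,0) < r2 \<Longrightarrow> dist (case z of (s,t) \<Rightarrow> gt s t) (gt 0 0) < d"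
    using tendstoD[OF c2 d] unfolding eventually_nhds_metric by blast
  \<comment> \<open>A third of the smallest radius: the points of the square have distance at most
    \<open>2 * k\<close> from the origin, so they stay within both radii of continuity and inside
    the domain.\<close>
  define k where "k = min e (min r1 r2) / 3"
  have k: "k > 0" "k < e" "2 * k < r1" "2 * k < r2"
    using e r1(1) r2(1) by (auto simp: k_def min_def)
  have near: "dist (s, t) (0, 0) < min r1 r2" if "0 < s" "s < k" "0 < t" "t < k" for s t
  proof -
    have "dist (s, t) (0, 0) \<le> \<bar>s\<bar> + \<bar>t\<bar>"
      by (simp add: dist_Pair_Pair sqrt_sum_squares_le_sum_abs)
    then show ?thesis using that k by linarith
  qed
  define \<Delta> where "\<Delta> = f k k - f k 0 - f 0 k + f 0 0"
  have "\<exists>z. 0 < z \<and> z < k \<and> (f k k - f k 0) - (f 0 k - f 0 0) = (k - 0) * (fs z k - fs z 0)"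
    using k by (intro MVT2[where f="\<lambda>s. f s k - f s 0"] DERIV_diff fs) auto
  then obtain z where z: "0 < z" "z < k" "\<Delta> = k * (fs z k - fs z 0)"
    by (auto simp: \<Delta>_def algebra_simps)
  have "\<exists>w. 0 < w \<and> w < k \<and> fs z k - fs z 0 = (k - 0) * gs z w"
    using k z by (intro MVT2[where f="\<lambda>t. fs z t"] gs) auto
  then obtain w where w: "0 < w" "w < k" "\<Delta> = k * k * gs z w" using z by auto
  have "\<exists>z. 0 < z \<and> z < k \<and> (f k k - f 0 k) - (f k 0 - f 0 0) = (k - 0) * (ft k z - ft 0 z)"
    using k by (intro MVT2[where f="\<lambda>t. f k t - f 0 t"] DERIV_diff ft) auto
  then obtain z' where z': "0 < z'" "z' < k" "\<Delta> = k * (ft k z' - ft 0 z')"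
    by (auto simp: \<Delta>_def algebra_simps)
  have "\<exists>w. 0 < w \<and> w < k \<and> ft k z' - ft 0 z' = (k - 0) * gt w z'"
    using k z' by (intro MVT2[where f="\<lambda>s. ft s z'"] gt) auto
  then obtain w' where w': "0 < w'" "w' < k" "\<Delta> = k * k * gt w' z'" using z' by auto
  have "gs z w = gt w' z'" using w(3) w'(3) k by simp
  moreover have "dist (gs z w) (gs 0 0) < d" using r1(2)[of "(z,w)"] near z w by simp
  moreover have "dist (gt w' z') (gt 0 0) < d" using r2(2)[of "(w',z')"] near z' w' by simp
  moreover have "dist (gs 0 0) (gt 0 0) \<le> dist (gs z w) (gs 0 0) + dist (gs z w) (gt 0 0)"
    by (rule dist_triangle3)
  moreover have "dist (gs 0 0) (gt 0 0) = 2 * d" by (simp add: d_def dist_real_def)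
  ultimately show False by simp
qed

lemma Ck_on_DERIV_line:
  fixes u :: "real^2 \<Rightarrow> real"
  assumes "Ck_on (Suc k) U u" "x + s *\<^sub>R axis i 1 \<in> U"
  shows "((\<lambda>s. u (x + s *\<^sub>R axis i 1)) has_real_derivative partial i u (x + s *\<^sub>R axis i 1)) (at s)"
proof -
  have "((\<lambda>r. x + r *\<^sub>R axis i 1) has_derivative (\<lambda>r. r *\<^sub>R axis i 1)) (at s)"
    by (auto intro!: derivative_eq_intros)
  from has_derivative_compose[OF this Ck_on_SucE[OF assms]] 
  have "((\<lambda>r. u (x + r *\<^sub>R axis i 1)) has_derivative (\<lambda>r. frechet_derivative u (at (x + s *\<^sub>R axis i 1)) (r *\<^sub>R axis i 1))) (at s)" .
  moreover have "frechet_derivative u (at (x + s *\<^sub>R axis i 1)) (r *\<^sub>R axis i 1) = r * partial i u (x + s *\<^sub>R axis i 1)" for r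
    using partial_eq[OF Ck_on_SucE[OF assms]] linear_scale[OF has_derivative_linear[OF Ck_on_SucE[OF assms]]] by simp
  ultimately show ?thesis by (simp add: has_field_derivative_def mult_commute_abs)
qed

lemma partial_commute_real:
  fixes u :: "real^2 \<Rightarrow> real"
  assumes U: "open U" "x \<in> U" and u: "Ck_on 2 U u"
  shows "partial 0 (partial 1 u) x = partial 1 (partial 0 u) x"
proof -
  have u2: "Ck_on (Suc 1) U u" using u by (simp add: numeral_2_eq_2)
  have u1: "Ck_on (Suc 0) U (partial i u)" for i using Ck_on_partial[OF U(1) u2] by simp
  have u0: "continuous_on U (partial i (partial j u))" for i j using Ck_on_partial[OF U(1) u1] by simp
  obtain r where r: "r > 0" "ball x r \<subseteq> U" using U open_contains_ball by blast
  define L where "L s t = x + s *\<^sub>R axis 0 1 + t *\<^sub>R axis (1::2) (1::real)" for s t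
  have L2: "L s t = x + t *\<^sub>R axis (1::2) (1::real) + s *\<^sub>R axis 0 1" for s t by (simp add: L_def)
  have L: "L s t \<in> U" if "\<bar>s\<bar> < r / 2" "\<bar>t\<bar> < r / 2" for s t
  proof -
    have "dist x (L s t) = norm (s *\<^sub>R axis 0 1 + t *\<^sub>R axis (1::2) (1::real))"
      by (simp add: L_def dist_norm norm_minus_commute algebra_simps)
    also have "\<dots> \<le> \<bar>s\<bar> + \<bar>t\<bar>" by (rule norm_triangle_le) simp
    also have "\<dots> < r" using that by simp
    finally show ?thesis using r(2) by auto
  qed
  have lim: "((\<lambda>(s,t). partial i (partial j u) (L s t)) \<longlongrightarrow> partial i (partial j u) (L 0 0)) (nhds (0,0))" for i j
  proof -
    have "((\<lambda>z. L (fst z) (snd z)) \<longlongrightarrow> L 0 0) (nhds (0,0))"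
      unfolding L_def by (auto intro!: tendsto_eq_intros filterlim_ident)
    moreover have "isCont (partial i (partial j u)) (L 0 0)"
      using u0 U by (simp add: continuous_on_eq_continuous_at L_def)
    ultimately show ?thesis
      unfolding case_prod_unfold by (intro isCont_tendsto_compose[of "L 0 0" "partial i (partial j u)"])
  qed
  have "partial 1 (partial 0 u) (L 0 0) = partial 0 (partial 1 u) (L 0 0)"
  proof (rule mixed_derivatives_eq[where e="r/2" and f="\<lambda>s t. u (L s t)"
        and fs="\<lambda>s t. partial 0 u (L s t)" and ft="\<lambda>s t. partial 1 u (L s t)"
        and gs="\<lambda>s t. partial 1 (partial 0 u) (L s t)" and gt="\<lambda>s t. partial 0 (partial 1 u) (L s t)"])
    fix s t :: real assume st: "\<bar>s\<bar> < r / 2" "\<bar>t\<bar> < r / 2"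
    note LU = L[OF st]
    show "((\<lambda>s. u (L s t)) has_real_derivative partial 0 u (L s t)) (at s)"
      using Ck_on_DERIV_line[OF u2, of "x + t *\<^sub>R axis 1 1" s 0] LU unfolding L2 by simp
    show "((\<lambda>t. u (L s t)) has_real_derivative partial 1 u (L s t)) (at t)"
      using Ck_on_DERIV_line[OF u2, of "x + s *\<^sub>R axis 0 1" t 1] LU unfolding L_def by simp
    show "((\<lambda>t. partial 0 u (L s t)) has_real_derivative partial 1 (partial 0 u) (L s t)) (at t)"
      using Ck_on_DERIV_line[OF u1, of "x + s *\<^sub>R axis 0 1" t 1] LU unfolding L_def by simp
    show "((\<lambda>s. partial 1 u (L s t)) has_real_derivative partial 0 (partial 1 u) (L s t)) (at s)"
      using Ck_on_DERIV_line[OF u1, of "x + t *\<^sub>R axis 1 1" s 0] LU unfolding L2 by simp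
  qed (use r(1) lim in auto)
  then show ?thesis by (simp add: L_def)
qed

lemma partial_Re_Im:
  fixes u :: "real^2 \<Rightarrow> complex"
  assumes "Ck_on (Suc k) U u" "x \<in> U"
  shows "partial i (\<lambda>x. Re (u x)) x = Re (partial i u x)" "partial i (\<lambda>x. Im (u x)) x = Im (partial i u x)"
  using partial_eq[OF bounded_linear.has_derivative[OF bounded_linear_Re Ck_on_SucE[OF assms]]]
    partial_eq[OF bounded_linear.has_derivative[OF bounded_linear_Im Ck_on_SucE[OF assms]]]
    partial_eq[OF Ck_on_SucE[OF assms]] by simp_all

text \<open>The mean value argument is real, so it is applied to the real and imaginary parts
  separately.\<close>

lemma partial_commute:
  fixes u :: "real^2 \<Rightarrow> complex"
  assumes U: "open U" "x \<in> U" and u: "Ck_on 2 U u"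
  shows "partial 0 (partial 1 u) x = partial 1 (partial 0 u) x"
proof -
  have u2: "Ck_on (Suc 1) U u" using u by (simp add: numeral_2_eq_2)
  have u1: "Ck_on (Suc 0) U (partial i u)" for i using Ck_on_partial[OF U(1) u2] by simp
  have "partial i (partial j (\<lambda>x. Re (u x))) x = Re (partial i (partial j u) x)" for i j
  proof -
    have "partial i (partial j (\<lambda>x. Re (u x))) x = partial i (\<lambda>x. Re (partial j u x)) x"
      by (rule partial_cong[OF U]) (simp add: partial_Re_Im[OF u2])
    then show ?thesis by (simp add: partial_Re_Im[OF u1 U(2)])
  qed
  moreover have "partial i (partial j (\<lambda>x. Im (u x))) x = Im (partial i (partial j u) x)" for i j
  proof -
    have "partial i (partial j (\<lambda>x. Im (u x))) x = partial i (\<lambda>x. Im (partial j u x)) x"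
      by (rule partial_cong[OF U]) (simp add: partial_Re_Im[OF u2])
    then show ?thesis by (simp add: partial_Re_Im[OF u1 U(2)])
  qed
  moreover have "partial 0 (partial 1 (\<lambda>x. Re (u x))) x = partial 1 (partial 0 (\<lambda>x. Re (u x))) x"
    "partial 0 (partial 1 (\<lambda>x. Im (u x))) x = partial 1 (partial 0 (\<lambda>x. Im (u x))) x"
    by (rule partial_commute_real[OF U Ck_on_linear_comp[OF U(1) bounded_linear_Re u]],
        rule partial_commute_real[OF U Ck_on_linear_comp[OF U(1) bounded_linear_Im u]])
  ultimately show ?thesis by (simp add: complex_eq_iff)
qed

text \<open>Partial derivatives in the ambient space of a local extension of the function; they
  allow the d'Alembertian to be written without the chart.\<close>

definition amb :: "3 \<Rightarrow> (real^3 \<Rightarrow> complex) \<Rightarrow> real^3 \<Rightarrow> complex" where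
  "amb i F y = frechet_derivative F (at y) (axis i 1)"

lemma Ck_on_amb: "Ck_on (Suc k) V F \<Longrightarrow> Ck_on k V (amb i F)"
  unfolding amb_def by (simp add: axis_in_Basis_iff)

lemma has_derivative_amb:
  assumes "Ck_on (Suc k) V F" "y \<in> V"
  shows "(F has_derivative (\<lambda>v. \<Sum>j\<in>UNIV. v $ j *\<^sub>R amb j F y)) (at y)"
proof -
  let ?D = "frechet_derivative F (at y)"
  note D = Ck_on_SucE[OF assms]
  interpret bounded_linear ?D using D by (rule has_derivative_bounded_linear)
  have "?D v = (\<Sum>j\<in>UNIV. v $ j *\<^sub>R amb j F y)" for v
  proof -
    have "v = (\<Sum>j\<in>UNIV. v $ j *\<^sub>R axis j 1)"
      by (simp add: vec3_eq_iff sum_three axis_def)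
    then have "?D v = ?D (\<Sum>j\<in>UNIV. v $ j *\<^sub>R axis j 1)" by simp
    then show ?thesis by (simp add: sum scaleR amb_def)
  qed
  then have "?D = (\<lambda>v. \<Sum>j\<in>UNIV. v $ j *\<^sub>R amb j F y)" by blast
  with D show ?thesis by simp
qed

lemma chart_curve_derivative:
  assumes "Ck_on (Suc k) V F" "chart R q \<in> V" "q \<in> strip"
  shows "((\<lambda>s. F (chart R (q + s *\<^sub>R axis i 1))) has_vector_derivative
    (\<Sum>j\<in>UNIV. partial i (chart R) q $ j *\<^sub>R amb j F (chart R q))) (at 0)"
proof -
  have D: "(chart R has_derivative (\<lambda>v. v $ 0 *\<^sub>R partial 0 (chart R) q + v $ 1 *\<^sub>R partial 1 (chart R) q)) (at q)"
    by (rule has_derivative_partials[OF Ck_on_chart assms(3)])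
  have "((\<lambda>s. F (chart R s)) has_derivative
      (\<lambda>v. \<Sum>j\<in>UNIV. (v $ 0 *\<^sub>R partial 0 (chart R) q + v $ 1 *\<^sub>R partial 1 (chart R) q) $ j *\<^sub>R amb j F (chart R q))) (at q)"
    by (rule has_derivative_compose[OF D has_derivative_amb[OF assms(1,2)]])
  from has_vector_derivative_partial[OF this, of i] show ?thesis
    by (cases "i = 0") (auto simp: not_zero_two)
qed

definition chart_tt :: "real \<Rightarrow> real^2 \<Rightarrow> real^3" where
  "chart_tt R p = (\<chi> i. R * (if i = 0 then 2 * sin (p$0) / (cos (p$0))^3
      else if i = 1 then cos (p$1) * (1 + (sin (p$0))\<^sup>2) / (cos (p$0))^3
      else sin (p$1) * (1 + (sin (p$0))\<^sup>2) / (cos (p$0))^3))"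

definition chart_thth :: "real \<Rightarrow> real^2 \<Rightarrow> real^3" where
  "chart_thth R p = (\<chi> i. R * (if i = 0 then 0 else if i = 1 then - cos (p$1) / cos (p$0) else - sin (p$1) / cos (p$0)))"

lemma chart_second_derivatives:
  assumes "p \<in> strip"
  shows "((\<lambda>s. chart_t R (p + s *\<^sub>R axis 0 1) $ i) has_real_derivative chart_tt R p $ i) (at 0)"
    "((\<lambda>s. chart_th R (p + s *\<^sub>R axis 1 1) $ i) has_real_derivative chart_thth R p $ i) (at 0)"
proof -
  have c: "cos (p$0) \<noteq> 0" using strip_cos_pos[OF assms] by simp
  have s: "(sin (p$0))\<^sup>2 = 1 - (cos (p$0))\<^sup>2" by (simp add: sin_squared_eq)
  have 1: "((\<lambda>s. 1 / (cos (p$0 + s))\<^sup>2) has_real_derivative 2 * sin (p$0) / (cos (p$0))^3) (at 0)"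
    using c by (auto intro!: derivative_eq_intros simp: field_simps power2_eq_square power3_eq_cube)
  have 2: "((\<lambda>s. a * sin (p$0 + s) / (cos (p$0 + s))\<^sup>2) has_real_derivative
      a * (1 + (sin (p$0))\<^sup>2) / (cos (p$0))^3) (at 0)" for a
  proof -
    have "((\<lambda>s. a * sin (p$0 + s) / (cos (p$0 + s))\<^sup>2) has_real_derivative
      a * cos (p$0) / (cos (p$0))\<^sup>2 + a * sin (p$0) * (2 * sin (p$0) / (cos (p$0))^3)) (at 0)"
    proof -
      have "((\<lambda>s. a * sin (p$0 + s)) has_real_derivative a * cos (p$0)) (at 0)"
        by (auto intro!: derivative_eq_intros)
      from DERIV_mult[OF this 1] show ?thesis by (simp add: algebra_simps)
    qed
    moreover have "a * cos (p$0) / (cos (p$0))\<^sup>2 + a * sin (p$0) * (2 * sin (p$0) / (cos (p$0))^3)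
        = a * ((cos (p$0))\<^sup>2 + 2 * (sin (p$0))\<^sup>2) / (cos (p$0))^3"
      using c by (simp add: field_simps power2_eq_square power3_eq_cube)
    moreover have "(cos (p$0))\<^sup>2 + 2 * (sin (p$0))\<^sup>2 = 1 + (sin (p$0))\<^sup>2" by (simp add: s)
    ultimately show ?thesis by simp
  qed
  have "\<forall>i. ((\<lambda>s. chart_t R (p + s *\<^sub>R axis 0 1) $ i) has_real_derivative chart_tt R p $ i) (at 0)"
    using DERIV_cmult[OF 1, of R] DERIV_cmult[OF 2[of "cos (p$1)"], of R] DERIV_cmult[OF 2[of "sin (p$1)"], of R]
    by (simp add: forall_three chart_t_def chart_tt_def)
  then show "((\<lambda>s. chart_t R (p + s *\<^sub>R axis 0 1) $ i) has_real_derivative chart_tt R p $ i) (at 0)" ..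
  have "((\<lambda>s. R * (- sin (p$1 + s) / cos (p$0))) has_real_derivative R * (- cos (p$1) / cos (p$0))) (at 0)"
    "((\<lambda>s. R * (cos (p$1 + s) / cos (p$0))) has_real_derivative R * (- sin (p$1) / cos (p$0))) (at 0)"
    using c by (auto intro!: derivative_eq_intros)
  then have "\<forall>i. ((\<lambda>s. chart_th R (p + s *\<^sub>R axis 1 1) $ i) has_real_derivative chart_thth R p $ i) (at 0)"
    by (simp add: forall_three chart_th_def chart_thth_def)
  then show "((\<lambda>s. chart_th R (p + s *\<^sub>R axis 1 1) $ i) has_real_derivative chart_thth R p $ i) (at 0)" ..
qed

text \<open>The ambient coordinates restricted to \<open>dS R\<close> are eigenfunctions of the
  d'Alembertian with eigenvalue \<open>2 / R^2\<close>. This supplies the first-order part of the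
  ambient formula.\<close>

lemma chart_box_vector:
  assumes "p \<in> strip" "R > 0"
  shows "(cos (p$0))\<^sup>2 / R\<^sup>2 * (chart_tt R p $ i - chart_thth R p $ i) = 2 / R\<^sup>2 * chart R p $ i"
proof -
  have c: "cos (p$0) \<noteq> 0" using strip_cos_pos[OF assms(1)] by simp
  have s: "(sin (p$0))\<^sup>2 = 1 - (cos (p$0))\<^sup>2" by (simp add: sin_squared_eq)
  have "\<forall>i. (cos (p$0))\<^sup>2 / R\<^sup>2 * (chart_tt R p $ i - chart_thth R p $ i) = 2 / R\<^sup>2 * chart R p $ i"
    unfolding forall_three using c assms(2)
    by (simp add: chart_tt_def chart_thth_def chart_nth tan_def s)
      (simp add: field_simps power2_eq_square power3_eq_cube)
  then show ?thesis ..
qed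

text \<open>The right-hand side is the inverse induced metric pushed forward to the ambient space:
  the \<open>mink\<close>-orthogonal projection onto the tangent plane with one index raised, as
  \<open>x\<close> has square \<open>- R^2\<close>.\<close>

lemma chart_box_tensor:
  assumes "p \<in> strip" "R > 0"
  shows "(cos (p$0))\<^sup>2 / R\<^sup>2 * (chart_t R p $ i * chart_t R p $ j - chart_th R p $ i * chart_th R p $ j)
    = minkI $ i $ j + chart R p $ i * chart R p $ j / R\<^sup>2"
proof -
  define C S a b where "C = cos (p$0)" and "S = sin (p$0)" and "a = cos (p$1)" and "b = sin (p$1)"
  have c: "C \<noteq> 0" using strip_cos_pos[OF assms(1)] by (simp add: C_def)
  have s: "S * S = 1 - C * C" "b * b = 1 - a * a"
    using sin_cos_squared_add[of "p $ 0"] sin_cos_squared_add[of "p $ 1"]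
    by (simp_all add: power2_eq_square C_def S_def a_def b_def algebra_simps)
  have *: "C\<^sup>2 / R\<^sup>2 * (R * x * (R * y) - R * z * (R * w)) = C\<^sup>2 * (x * y - z * w)" for x y z w
    using assms(2) by (simp add: field_simps power2_eq_square)
  have R0: "R \<noteq> 0" using assms(2) by simp
  have t: "x * S / C\<^sup>2 * (y * S / C\<^sup>2) = x * y * (1 - C * C) / C^4" for x y
    by (simp add: s(1)[symmetric] power2_eq_square power4_eq_xxxx mult_ac)
  \<comment> \<open>Nine scalar identities, polynomial modulo the two relations \<open>s\<close>
    once denominators are cleared.\<close>
  have "\<forall>i j. C\<^sup>2 / R\<^sup>2 * (chart_t R p $ i * chart_t R p $ j - chart_th R p $ i * chart_th R p $ j)
    = minkI $ i $ j + chart R p $ i * chart R p $ j / R\<^sup>2"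
    unfolding forall_three
    apply (simp add: chart_t_def chart_th_def chart_nth tan_def minkI_def C_def[symmetric] S_def[symmetric]
       a_def[symmetric] b_def[symmetric])
    using c R0
    apply (intro conjI)
            apply (simp_all add: field_simps power2_eq_square)
    using s by (algebra | simp add: power4_eq_xxxx)+
  then show ?thesis by (simp add: C_def)
qed

text \<open>Chain rule through a local extension \<open>F\<close>. The result involves
  \<open>p\<close> only through \<open>x\<close>, so all chart representatives of a point give the
  same value, and it is manifestly smooth in \<open>x\<close>.\<close>

lemma box_chart_ambient:
  assumes R: "R > 0" and V: "open V" "x \<in> V" and ps: "p \<in> strip" and x: "chart R p = x" and F: "Ck_on 2 V F"
    and eq: "\<And>y. y \<in> V \<Longrightarrow> y \<in> dS R \<Longrightarrow> F y = h y"
  shows "box_chart R (h \<circ> chart R) p = (2 / R\<^sup>2) *\<^sub>R (\<Sum>i\<in>UNIV. x $ i *\<^sub>R amb i F x)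
    + (\<Sum>i\<in>UNIV. \<Sum>j\<in>UNIV. (minkI $ i $ j + x $ i * x $ j / R\<^sup>2) *\<^sub>R amb j (amb i F) x)"
proof -
  have F2: "Ck_on (Suc 1) V F" using F by (simp add: numeral_2_eq_2)
  have F1: "Ck_on (Suc 0) V (amb i F)" for i using Ck_on_amb[OF F2] by simp
  define U where "U = strip \<inter> chart R -` V"
  have U: "open U" "p \<in> U" "U \<subseteq> strip" "\<And>q. q \<in> U \<Longrightarrow> chart R q \<in> V"
    unfolding U_def Int_commute[of strip]
    using continuous_on_chart open_strip V(1,2) ps x continuous_on_open_vimage by auto
  have hU: "(h \<circ> chart R) q = F (chart R q)" if "q \<in> U" for q
    using eq[of "chart R q"] U(3,4) that chart_in_dS by auto
  have first: "partial i (h \<circ> chart R) q = (\<Sum>j\<in>UNIV. partial i (chart R) q $ j *\<^sub>R amb j F (chart R q))" if q: "q \<in> U" for i q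
  proof -
    have "partial i (h \<circ> chart R) q = partial i (\<lambda>q. F (chart R q)) q"
      by (rule partial_cong[OF U(1) q hU])
    also have "\<dots> = (\<Sum>j\<in>UNIV. partial i (chart R) q $ j *\<^sub>R amb j F (chart R q))"
      unfolding partial_def[of i "\<lambda>q. F (chart R q)"]
      using q U by (intro vector_derivative_at chart_curve_derivative[OF F2]) auto
    finally show ?thesis .
  qed
  \<comment> \<open>\<open>c\<close> stands for an explicit formula of the first derivative of the
    chart, valid near \<open>p\<close>; its derivative \<open>c'\<close> then supplies the second
    derivative of the chart.\<close>
  have second: "partial i (partial i (h \<circ> chart R)) p = (\<Sum>j\<in>UNIV. c' $ j *\<^sub>R amb j F x
      + c p $ j *\<^sub>R (\<Sum>k\<in>UNIV. c p $ k *\<^sub>R amb k (amb j F) x))"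
    if c: "\<And>q. q \<in> U \<Longrightarrow> partial i (chart R) q = c q"
      and c': "\<And>j. ((\<lambda>s. c (p + s *\<^sub>R axis i 1) $ j) has_real_derivative c' $ j) (at 0)" for c c' i
  proof -
    have "partial i (partial i (h \<circ> chart R)) p = partial i (\<lambda>q. \<Sum>j\<in>UNIV. c q $ j *\<^sub>R amb j F (chart R q)) p"
      by (rule partial_cong[OF U(1,2)]) (simp add: first c)
    also have "\<dots> = (\<Sum>j\<in>UNIV. c p $ j *\<^sub>R (\<Sum>k\<in>UNIV. partial i (chart R) p $ k *\<^sub>R amb k (amb j F) x)
        + c' $ j *\<^sub>R amb j F x)"
      unfolding partial_def[of i "\<lambda>q. \<Sum>j\<in>UNIV. c q $ j *\<^sub>R amb j F (chart R q)"]
    proof (rule vector_derivative_at, rule has_vector_derivative_sum)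
      fix j
      have "((\<lambda>s. amb j F (chart R (p + s *\<^sub>R axis i 1))) has_vector_derivative
          (\<Sum>k\<in>UNIV. partial i (chart R) p $ k *\<^sub>R amb k (amb j F) x)) (at 0)"
        using chart_curve_derivative[OF F1 _ ps, of R j i] V(2) by (simp add: x)
      from has_vector_derivative_scaleR[OF c'[of j] this]
      show "((\<lambda>s. c (p + s *\<^sub>R axis i 1) $ j *\<^sub>R amb j F (chart R (p + s *\<^sub>R axis i 1))) has_vector_derivative
          c p $ j *\<^sub>R (\<Sum>k\<in>UNIV. partial i (chart R) p $ k *\<^sub>R amb k (amb j F) x) + c' $ j *\<^sub>R amb j F x) (at 0)"
        by (simp add: x)
    qed
    finally show ?thesis using c[OF U(2)] by (simp add: add.commute)
  qed
  have hU2: "Ck_on (Suc 1) U (h \<circ> chart R)"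
  proof (rule Ck_on_transform[OF _ U(1)])
    show "Ck_on (Suc 1) U (F \<circ> chart R)"
      using U by (intro Ck_on_chart_pullback[OF F2 V(1)]) auto
  qed (simp add: hU[unfolded o_def])
  have "box_chart R (h \<circ> chart R) p = ((cos (p$0))\<^sup>2 / R\<^sup>2) *\<^sub>R (partial 0 (partial 0 (h \<circ> chart R)) p - partial 1 (partial 1 (h \<circ> chart R)) p)"
    by (rule box_chart_eq[OF ps R Ck_on_SucE[OF Ck_on_partial[OF U(1) hU2, unfolded One_nat_def] U(2)]])
  also have "\<dots> = ((cos (p$0))\<^sup>2 / R\<^sup>2) *\<^sub>R ((\<Sum>j\<in>UNIV. chart_tt R p $ j *\<^sub>R amb j F x
      + chart_t R p $ j *\<^sub>R (\<Sum>k\<in>UNIV. chart_t R p $ k *\<^sub>R amb k (amb j F) x)) -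
      (\<Sum>j\<in>UNIV. chart_thth R p $ j *\<^sub>R amb j F x
      + chart_th R p $ j *\<^sub>R (\<Sum>k\<in>UNIV. chart_th R p $ k *\<^sub>R amb k (amb j F) x)))"
    using U(3) by (subst (1 2) second[of _ "chart_t R" "chart_tt R p"] second[of _ "chart_th R" "chart_thth R p"])
      (auto simp: partial_chart chart_second_derivatives[OF ps])
  also have "\<dots> = (\<Sum>j\<in>UNIV. ((cos (p$0))\<^sup>2 / R\<^sup>2 * (chart_tt R p $ j - chart_thth R p $ j)) *\<^sub>R amb j F x)
    + (\<Sum>j\<in>UNIV. \<Sum>k\<in>UNIV. ((cos (p$0))\<^sup>2 / R\<^sup>2 * (chart_t R p $ j * chart_t R p $ k - chart_th R p $ j * chart_th R p $ k)) *\<^sub>R amb k (amb j F) x)"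
    by (simp add: scaleR_sum_right scaleR_diff_left scaleR_diff_right scaleR_add_right right_diff_distrib
       diff_divide_distrib sum_subtractf sum.distrib mult_ac)
  also have "\<dots> = (\<Sum>j\<in>UNIV. (2 / R\<^sup>2 * x $ j) *\<^sub>R amb j F x)
    + (\<Sum>j\<in>UNIV. \<Sum>k\<in>UNIV. (minkI $ j $ k + x $ j * x $ k / R\<^sup>2) *\<^sub>R amb k (amb j F) x)"
    by (simp only: chart_box_vector[OF ps R] chart_box_tensor[OF ps R] x)
  finally show ?thesis by (simp add: scaleR_sum_right)
qed

lemma dalembert_ambient:
  assumes R: "R > 0" and V: "open V" "x \<in> V" "x \<in> dS R" and F: "Ck_on 2 V F"
    and eq: "\<And>y. y \<in> V \<Longrightarrow> y \<in> dS R \<Longrightarrow> F y = h y"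
  shows "dalembert R h x = (2 / R\<^sup>2) *\<^sub>R (\<Sum>i\<in>UNIV. x $ i *\<^sub>R amb i F x)
    + (\<Sum>i\<in>UNIV. \<Sum>j\<in>UNIV. (minkI $ i $ j + x $ i * x $ j / R\<^sup>2) *\<^sub>R amb j (amb i F) x)"
proof -
  obtain p where p: "p \<in> chart_domain" and x: "chart R p = x" using chart_surj[OF R V(3)] .
  have "dalembert R h x = box_chart R (h \<circ> chart R) p"
    using V(3) the_inv_into_chart[OF R p] by (simp add: dalembert_def x)
  then show ?thesis
    using box_chart_ambient[OF R V(1,2) _ x F eq] p chart_domain_subset_strip by auto
qed

text \<open>\<open>dalembert\<close> inverts the chart on \<open>chart_domain\<close>, but the
  ambient formula does not see which preimage is taken. Hence the coordinate expression holds on the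
  whole strip, also across the seam at the angle \<open>pi\<close>.\<close>

lemma dalembert_chart:
  assumes R: "R > 0" and h: "smooth_on_subset (dS R) h" and p: "p \<in> strip"
  shows "dalembert R h (chart R p) = ((cos (p$0))\<^sup>2 / R\<^sup>2) *\<^sub>R
    (partial 0 (partial 0 (h \<circ> chart R)) p - partial 1 (partial 1 (h \<circ> chart R)) p)"
proof -
  obtain V F where V: "open V" "chart R p \<in> V" "\<And>k. Ck_on k V F" "\<And>y. y \<in> V \<Longrightarrow> y \<in> dS R \<Longrightarrow> F y = h y"
    using smooth_on_subsetE[OF h chart_in_dS[OF p]] by metis
  have "dalembert R h (chart R p) = box_chart R (h \<circ> chart R) p"
    using box_chart_ambient[OF R V(1,2) p refl V(3,4)] dalembert_ambient[OF R V(1,2) chart_in_dS[OF p] V(3,4)]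
    by simp
  also have "\<dots> = ((cos (p$0))\<^sup>2 / R\<^sup>2) *\<^sub>R
    (partial 0 (partial 0 (h \<circ> chart R)) p - partial 1 (partial 1 (h \<circ> chart R)) p)"
    by (rule box_chart_eq[OF p R Ck_on_SucE[OF Ck_on_partial[OF open_strip Ck_on_pullback[OF h]] p]])
  finally show ?thesis .
qed

text \<open>The ambient formula, applied to a local extension of \<open>h\<close>, is itself a
  smooth local extension of the result.\<close>

lemma test_fun_dalembert:
  assumes R: "R > 0" and h: "h \<in> test_fun R"
  shows "dalembert R h \<in> test_fun R"
proof -
  let ?D = "\<lambda>F x. (2 / R\<^sup>2) *\<^sub>R (\<Sum>i\<in>UNIV. x $ i *\<^sub>R amb i F x)
    + (\<Sum>i\<in>UNIV. \<Sum>j\<in>UNIV. (minkI $ i $ j + x $ i * x $ j / R\<^sup>2) *\<^sub>R amb j (amb i F) x)"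
  have "smooth_on_subset (dS R) (dalembert R h)"
    unfolding smooth_on_subset_def
  proof
    fix x assume x: "x \<in> dS R"
    obtain V F where V: "open V" "x \<in> V" "\<And>k. Ck_on k V F" "\<And>y. y \<in> V \<Longrightarrow> y \<in> dS R \<Longrightarrow> F y = h y"
      using smooth_on_subsetE[OF test_fun_smooth[OF h] x] by metis
    have a: "Ck_on k V (amb i F)" "Ck_on k V (amb i (amb j F))" for i j k
      using V(3) by (auto intro!: Ck_on_amb simp del: Ck_on.simps)
    have "Ck_on k V (?D F)" for k
      unfolding divide_inverse
      by (intro Ck_on_add Ck_on_scaleR Ck_on_sum Ck_on_const Ck_on_mult Ck_on_nth V(1) a)
    moreover have "?D F y = dalembert R h y" if "y \<in> V \<inter> dS R" for y
      using that by (intro dalembert_ambient[symmetric, OF R V(1) _ _ V(3) V(4)]) auto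
    ultimately show "\<exists>V F. open V \<and> x \<in> V \<and> (\<forall>k. Ck_on k V F) \<and> (\<forall>y\<in>V \<inter> dS R. F y = dalembert R h y)"
      using V(1,2) by (intro exI[of _ V] exI[of _ "?D F"]) auto
  qed
  moreover obtain K where K: "compact K" "K \<subseteq> dS R" "\<And>x. x \<notin> K \<Longrightarrow> h x = 0"
    using test_fun_supportE[OF h] by blast
  moreover have "dalembert R h x = 0" if "x \<notin> K" for x
  proof (cases "x \<in> dS R")
    case True
    have "amb i (\<lambda>_. 0) = (\<lambda>_. 0)" for i
      unfolding amb_def by (metis frechet_derivative_const)
    then have "?D (\<lambda>_. 0) x = 0" by simp
    \<comment> \<open>Off the support the zero function on the open set \<open>- K\<close> is an
      admissible local extension of \<open>h\<close>.\<close>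
    moreover have "dalembert R h x = ?D (\<lambda>_. 0) x"
      using that True K(1,3) by (intro dalembert_ambient[of R "- K"] R Ck_on_const) (auto simp: compact_imp_closed)
    ultimately show ?thesis by simp
  qed (simp add: dalembert_def)
  ultimately show ?thesis unfolding test_fun_def by blast
qed

section \<open>The invariant volume\<close>

lemma prod_Basis_vec: "(\<Prod>b\<in>(Basis::(real^'n) set). v \<bullet> b) = (\<Prod>i\<in>UNIV. v $ i)"
proof -
  have "(Basis::(real^'n) set) = (\<lambda>i. axis i 1) ` UNIV"
    by (auto simp: Basis_vec_def)
  moreover have "inj (\<lambda>i::'n. axis i (1::real))"
    by (auto simp: inj_def axis_eq_axis)
  ultimately have "(\<Prod>b\<in>(Basis::(real^'n) set). v \<bullet> b) = (\<Prod>i\<in>UNIV. v \<bullet> axis i 1)"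
    using prod.reindex[of "\<lambda>i::'n. axis i (1::real)" UNIV "\<lambda>b. v \<bullet> b"] by (simp add: o_def)
  then show ?thesis by (simp add: inner_axis)
qed

lemma borel_measurable_vecI:
  fixes f :: "'a \<Rightarrow> real^'n"
  assumes "\<And>i. (\<lambda>x. f x $ i) \<in> borel_measurable M"
  shows "f \<in> borel_measurable M"
  unfolding borel_measurable_euclidean_space[of f M]
  using assms by (auto simp: Basis_vec_def inner_axis)

lemma vec_nth_measurable [measurable]: "(\<lambda>x::real^'n. x $ i) \<in> borel_measurable borel"
  by (intro borel_measurable_continuous_onI continuous_intros)

lemma pt_measurable [measurable]:
  assumes "f \<in> borel_measurable M" "g \<in> borel_measurable M"
  shows "(\<lambda>x. pt (f x) (g x) :: real^2) \<in> borel_measurable M"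
proof (rule borel_measurable_vecI)
  fix i show "(\<lambda>x. pt (f x) (g x) $ i) \<in> borel_measurable M"
    using assms by (cases "i = 0") (auto simp: not_zero_two)
qed

lemma prod_two: "prod f (UNIV::2 set) = f 0 * f 1"
  unfolding UNIV_2 two_eq_0 by (simp add: mult.commute)

lemma prod_three: "prod f (UNIV::3 set) = f 0 * (f 1 * f 2)"
  unfolding UNIV_3 three_eq_0 by (simp add: mult_ac)

lemma lborel_two: "(lborel :: (real^2) measure) = distr (lborel \<Otimes>\<^sub>M lborel) borel (\<lambda>(a, b). pt a b)"
proof (rule lborel_eqI)
  fix l u :: "real^2" assume lu: "\<And>b. b \<in> Basis \<Longrightarrow> l \<bullet> b \<le> u \<bullet> b"
  have le: "l $ i \<le> u $ i" for i using lu[of "axis i 1"] by (simp add: inner_axis axis_in_Basis_iff)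
  have "(\<lambda>(a, b). pt a b) -` box l u = {l $ 0<..<u $ 0} \<times> {l $ 1<..<u $ 1}"
    by (auto simp: mem_box_cart forall_two)
  then have "emeasure (distr (lborel \<Otimes>\<^sub>M lborel) borel (\<lambda>(a, b). pt a b)) (box l u) =
     emeasure (lborel \<Otimes>\<^sub>M lborel) ({l $ 0<..<u $ 0} \<times> {l $ 1<..<u $ 1})"
    by (subst emeasure_distr) (auto simp: space_pair_measure)
  also have "\<dots> = ennreal (\<Prod>b\<in>Basis. (u - l) \<bullet> b)"
    using le by (subst lborel.emeasure_pair_measure_Times)
      (auto simp: prod_Basis_vec prod_two ennreal_mult[symmetric])
  finally show "emeasure (distr (lborel \<Otimes>\<^sub>M lborel) borel (\<lambda>(a, b). pt a b)) (box l u) = ennreal (\<Prod>b\<in>Basis. (u - l) \<bullet> b)" .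
qed simp

definition vec3 :: "real \<Rightarrow> real^2 \<Rightarrow> real^3" where
  "vec3 t p = (\<chi> i. if i = 0 then t else if i = 1 then p $ 0 else p $ 1)"

lemma vec3_nth [simp]: "vec3 t p $ 0 = t" "vec3 t p $ 1 = p $ 0" "vec3 t p $ 2 = p $ 1"
  by (simp_all add: vec3_def)

lemma vec3_measurable [measurable]:
  assumes [measurable]: "f \<in> borel_measurable M" "g \<in> borel_measurable M"
  shows "(\<lambda>x. vec3 (f x) (g x)) \<in> borel_measurable M"
  by (rule borel_measurable_vecI) (simp add: vec3_def)

lemma lborel_three: "(lborel :: (real^3) measure) = distr (lborel \<Otimes>\<^sub>M lborel) borel (\<lambda>(a, b). vec3 a b)"
proof (rule lborel_eqI)
  fix l u :: "real^3" assume lu: "\<And>b. b \<in> Basis \<Longrightarrow> l \<bullet> b \<le> u \<bullet> b"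
  have le: "l $ i \<le> u $ i" for i using lu[of "axis i 1"] by (simp add: inner_axis axis_in_Basis_iff)
  let ?B = "box (pt (l $ 1) (l $ 2)) (pt (u $ 1) (u $ 2))"
  have B: "emeasure lborel ?B = ennreal ((u $ 1 - l $ 1) * (u $ 2 - l $ 2))"
  proof -
    have "pt (l $ 1) (l $ 2) \<bullet> b \<le> pt (u $ 1) (u $ 2) \<bullet> b" if "b \<in> Basis" for b
      using that le by (auto simp: Basis_vec_def inner_axis pt_def)
    then show ?thesis by (simp add: emeasure_lborel_box prod_Basis_vec prod_two)
  qed
  have "(\<lambda>(a, b). vec3 a b) -` box l u = {l $ 0<..<u $ 0} \<times> ?B"
    by (auto simp: mem_box_cart forall_two forall_three)
  then have "emeasure (distr (lborel \<Otimes>\<^sub>M lborel) borel (\<lambda>(a, b). vec3 a b)) (box l u) =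
     emeasure (lborel \<Otimes>\<^sub>M lborel) ({l $ 0<..<u $ 0} \<times> ?B)"
    by (subst emeasure_distr) (auto simp: space_pair_measure)
  also have "\<dots> = ennreal (\<Prod>b\<in>Basis. (u - l) \<bullet> b)"
    using le by (subst lborel.emeasure_pair_measure_Times)
      (auto simp: prod_Basis_vec prod_three B ennreal_mult[symmetric])
  finally show "emeasure (distr (lborel \<Otimes>\<^sub>M lborel) borel (\<lambda>(a, b). vec3 a b)) (box l u) = ennreal (\<Prod>b\<in>Basis. (u - l) \<bullet> b)" .
qed simp

lemma chart_measurable [measurable]: "chart R \<in> borel_measurable (borel :: (real^2) measure)"
proof (rule borel_measurable_vecI)
  have "\<forall>i. (\<lambda>p::real^2. chart R p $ i) \<in> borel_measurable borel"
    unfolding forall_three chart_nth tan_def by (intro conjI; measurable)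
  then show "(\<lambda>p::real^2. chart R p $ i) \<in> borel_measurable borel" for i ..
qed

lemma chart_domain_measurable [measurable]: "chart_domain \<in> sets borel"
  unfolding chart_domain_def by measurable

definition rho :: "real \<Rightarrow> real^2 \<Rightarrow> real" where
  "rho R p = indicator chart_domain p * (R\<^sup>2 / (cos (p$0))\<^sup>2)"

lemma rho_measurable [measurable]: "rho R \<in> borel_measurable borel"
  unfolding rho_def[abs_def] by measurable

lemma rho_nonneg: "rho R p \<ge> 0" by (simp add: rho_def)

lemma chart_volume_eq: "chart_volume R = density lborel (\<lambda>p. ennreal (rho R p))"
proof -
  have "indicator chart_domain p * vol_density R p = rho R p" for p
    using chart_domain_subset_strip vol_density_eq[of p R] by (auto simp: rho_def indicator_def)
  then show ?thesis unfolding chart_volume_def by simp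
qed

lemma sets_chart_volume [simp, measurable_cong]: "sets (chart_volume R) = sets borel"
  by (simp add: chart_volume_eq)

lemma sets_dS_volume [simp, measurable_cong]: "sets (dS_volume R) = sets borel"
  by (simp add: dS_volume_def)

lemma space_chart_volume [simp]: "space (chart_volume R) = UNIV"
  by (simp add: chart_volume_eq)

lemma space_dS_volume [simp]: "space (dS_volume R) = UNIV"
  by (simp add: dS_volume_def)

lemma sigma_finite_chart_volume: "sigma_finite_measure (chart_volume R)"
  unfolding chart_volume_eq
  by (subst sigma_finite_measure.sigma_finite_iff_density_finite[OF sigma_finite_lborel]) auto

lemma AE_chart_volume: "AE p in chart_volume R. p \<in> chart_domain"
  unfolding chart_volume_eq by (subst AE_density) (auto simp: rho_def indicator_def)

lemma emeasure_dS_volume: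
  assumes [measurable]: "A \<in> sets borel"
  shows "emeasure (dS_volume R) A = (\<integral>\<^sup>+p. ennreal (rho R p) * indicator A (chart R p) \<partial>lborel)"
proof -
  have "emeasure (dS_volume R) A = (\<integral>\<^sup>+x. indicator A x \<partial>dS_volume R)" by simp
  also have "\<dots> = (\<integral>\<^sup>+p. indicator A (chart R p) \<partial>chart_volume R)"
    unfolding dS_volume_def by (rule nn_integral_distr) auto
  also have "\<dots> = (\<integral>\<^sup>+p. ennreal (rho R p) * indicator A (chart R p) \<partial>lborel)"
    unfolding chart_volume_eq by (rule nn_integral_density) auto
  finally show ?thesis .
qed

definition slab :: "real \<Rightarrow> (real^3) set" where
  "slab T = {x. \<bar>x $ 0\<bar> \<le> T}"

lemma slab_measurable [measurable]: "slab T \<in> sets borel"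
  unfolding slab_def by measurable

text \<open>In chart coordinates \<open>R^2 / cos^2 \<tau> = R^2 + (x $ 0)^2\<close>, so a bound on
  the time component keeps the density bounded, although it blows up at the edges of the
  strip.\<close>

lemma rho_slab_le:
  assumes "R > 0"
  shows "rho R p * indicator (slab T) (chart R p) \<le> (R\<^sup>2 + T\<^sup>2) * indicator chart_domain p"
proof (cases "p \<in> chart_domain \<and> chart R p \<in> slab T")
  case True
  then have c: "cos (p$0) \<noteq> 0" using strip_cos_pos chart_domain_subset_strip by force
  have "\<bar>R * tan (p$0)\<bar> \<le> T" using True by (simp add: slab_def chart_nth)
  then have "(R * tan (p$0))\<^sup>2 \<le> T\<^sup>2" by (metis abs_ge_zero power2_abs power_mono)
  moreover have "R\<^sup>2 / (cos (p$0))\<^sup>2 = R\<^sup>2 + (R * tan (p$0))\<^sup>2"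
  proof -
    have "R\<^sup>2 / (cos (p$0))\<^sup>2 = R\<^sup>2 * (1 + (tan (p$0))\<^sup>2)"
      unfolding tan_sec[OF c] by (simp add: divide_inverse power_inverse)
    then show ?thesis by (simp add: power_mult_distrib algebra_simps)
  qed
  ultimately show ?thesis using True by (simp add: rho_def)
qed (auto simp: rho_def indicator_def)

lemma emeasure_chart_domain: "emeasure lborel chart_domain < \<infinity>"
proof -
  have "chart_domain \<subseteq> cbox (pt (-(pi/2)) (-pi)) (pt (pi/2) pi)"
    by (auto simp: chart_domain_def mem_box_cart forall_two)
  then have "emeasure lborel chart_domain \<le> emeasure lborel (cbox (pt (-(pi/2)) (-pi)) (pt (pi/2) pi))"
    by (rule emeasure_mono) simp
  also have "\<dots> < \<infinity>" by (rule emeasure_lborel_cbox_finite)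
  finally show ?thesis .
qed

lemma emeasure_slab:
  assumes "R > 0"
  shows "emeasure (dS_volume R) (slab T) < \<infinity>"
proof -
  have "emeasure (dS_volume R) (slab T) = (\<integral>\<^sup>+p. ennreal (rho R p * indicator (slab T) (chart R p)) \<partial>lborel)"
    by (simp add: emeasure_dS_volume rho_nonneg ennreal_mult' ennreal_indicator)
  also have "\<dots> \<le> (\<integral>\<^sup>+p. ennreal ((R\<^sup>2 + T\<^sup>2) * indicator chart_domain p) \<partial>lborel)"
    by (intro nn_integral_mono ennreal_leI rho_slab_le assms)
  also have "\<dots> = ennreal (R\<^sup>2 + T\<^sup>2) * emeasure lborel chart_domain"
    by (simp add: ennreal_mult' ennreal_indicator nn_integral_cmult)
  also have "\<dots> < \<infinity>" using emeasure_chart_domain by (simp add: ennreal_mult_less_top)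
  finally show ?thesis .
qed

lemma sigma_finite_dS_volume:
  assumes "R > 0"
  shows "sigma_finite_measure (dS_volume R)"
proof
  have "\<exists>n::nat. x \<in> slab (real n)" for x :: "real^3"
    unfolding slab_def using real_arch_simple[of "\<bar>x $ 0\<bar>"] by simp
  then show "\<exists>A. countable A \<and> A \<subseteq> sets (dS_volume R) \<and> \<Union> A = space (dS_volume R) \<and> (\<forall>a\<in>A. emeasure (dS_volume R) a \<noteq> \<infinity>)"
    using emeasure_slab[OF assms] by (intro exI[of _ "range (\<lambda>n::nat. slab (real n))"]) (auto simp: less_top[symmetric])
qed

text \<open>The part of the cone over \<open>A \<subseteq> dS R\<close> between the radii \<open>R\<close> and \<open>2 * R\<close>; its Lebesgue measure is a
  fixed multiple of the invariant volume of \<open>A\<close>.\<close>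

definition cone_shell :: "real \<Rightarrow> (real^3) set \<Rightarrow> (real^3) set" where
  "cone_shell R A = {x. - 4 * R\<^sup>2 \<le> mink x x \<and> mink x x \<le> - R\<^sup>2 \<and> (R / sqrt (- mink x x)) *\<^sub>R x \<in> A}"

definition polar :: "real \<Rightarrow> real^3 \<Rightarrow> real^3" where
  "polar R q = q $ 0 *\<^sub>R chart R (pt (q $ 1) (q $ 2))"

definition polar_domain :: "real \<Rightarrow> (real^3) set \<Rightarrow> (real^3) set" where
  "polar_domain R A = {q. 1 \<le> q $ 0 \<and> q $ 0 \<le> 2 \<and> pt (q $ 1) (q $ 2) \<in> chart_domain \<and> chart R (pt (q $ 1) (q $ 2)) \<in> A}"

definition polar_deriv :: "real \<Rightarrow> real^3 \<Rightarrow> real^3 \<Rightarrow> real^3" where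
  "polar_deriv R q v = v $ 0 *\<^sub>R chart R (pt (q $ 1) (q $ 2)) +
     q $ 0 *\<^sub>R (v $ 1 *\<^sub>R chart_t R (pt (q $ 1) (q $ 2)) + v $ 2 *\<^sub>R chart_th R (pt (q $ 1) (q $ 2)))"

lemma mink_measurable [measurable]: "(\<lambda>x::real^3. mink x x) \<in> borel_measurable borel"
  unfolding mink_def by measurable

lemma cone_shell_measurable [measurable]:
  assumes [measurable]: "A \<in> sets borel"
  shows "cone_shell R A \<in> sets borel"
  unfolding cone_shell_def by measurable

lemma polar_domain_measurable [measurable]:
  assumes [measurable]: "A \<in> sets borel"
  shows "polar_domain R A \<in> sets borel"
  unfolding polar_domain_def by measurable

lemma has_derivative_polar:
  assumes "pt (q $ 1) (q $ 2) \<in> strip"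
  shows "(polar R has_derivative polar_deriv R q) (at q)"
proof -
  let ?p = "pt (q $ 1) (q $ 2)"
  have "(chart R has_derivative (\<lambda>v. v $ 0 *\<^sub>R chart_t R ?p + v $ 1 *\<^sub>R chart_th R ?p)) (at ?p)"
    using has_derivative_partials[OF Ck_on_chart assms] by (simp add: partial_chart[OF assms])
  moreover have "((\<lambda>q::real^3. pt (q $ 1) (q $ 2)) has_derivative (\<lambda>q. pt (q $ 1) (q $ 2))) (at q)"
  proof (rule bounded_linear_imp_has_derivative, rule linear_conv_bounded_linear[THEN iffD1])
    show "linear (\<lambda>q::real^3. pt (q $ 1) (q $ 2))"
      by (rule linearI) (simp_all add: vec2_eq_iff)
  qed
  ultimately have "((\<lambda>q. chart R (pt (q $ 1) (q $ 2))) has_derivative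
      (\<lambda>v. v $ 1 *\<^sub>R chart_t R ?p + v $ 2 *\<^sub>R chart_th R ?p)) (at q)"
    using has_derivative_compose[of "\<lambda>q::real^3. pt (q $ 1) (q $ 2)" _ q UNIV "chart R"] by fastforce
  then show ?thesis
    unfolding polar_def[abs_def] polar_deriv_def[abs_def]
    by (auto intro!: derivative_eq_intros bounded_linear_imp_has_derivative[OF bounded_linear_vec_nth])
qed

lemma det_three: "det (A::'a::comm_ring_1^3^3) =
    A$0$0 * A$1$1 * A$2$2 + A$0$1 * A$1$2 * A$2$0 + A$0$2 * A$1$0 * A$2$1
  - A$0$0 * A$1$2 * A$2$1 - A$0$1 * A$1$0 * A$2$2 - A$0$2 * A$1$1 * A$2$0"
  using det_3[of A] unfolding three_eq_0 by (simp add: algebra_simps)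

text \<open>The Jacobian splits into \<open>R t^2\<close>, with \<open>t\<close> the radial
  coordinate, and the density of the invariant volume. This factorisation makes the measure of a
  shell proportional to the volume of its base.\<close>

lemma det_polar:
  assumes "R > 0" "pt (q $ 1) (q $ 2) \<in> strip"
  shows "\<bar>det (matrix (polar_deriv R q))\<bar> = R * (q $ 0)\<^sup>2 * (R\<^sup>2 / (cos (q $ 1))\<^sup>2)"
proof -
  define C S a b t where "C = cos (q $ 1)" and "S = sin (q $ 1)" and "a = cos (q $ 2)" and "b = sin (q $ 2)" and "t = q $ 0"
  have c: "C \<noteq> 0" using strip_cos_pos[OF assms(2)] by (simp add: C_def)
  have s: "S * S = 1 - C * C" "b * b = 1 - a * a"
    using sin_cos_squared_add[of "q $ 1"] sin_cos_squared_add[of "q $ 2"]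
    by (simp_all add: power2_eq_square C_def S_def a_def b_def algebra_simps)
  have "det (matrix (polar_deriv R q)) = R^3 * t\<^sup>2 * (S * S * (a * a + b * b) - (a * a + b * b)) / C^4"
    unfolding det_three
    apply (simp add: matrix_def polar_deriv_def axis_def chart_nth chart_t_def chart_th_def tan_def
        C_def[symmetric] S_def[symmetric] a_def[symmetric] b_def[symmetric] t_def[symmetric])
    using c by (simp add: field_simps power2_eq_square power3_eq_cube power4_eq_xxxx)
  also have "\<dots> = - (R * t\<^sup>2 * (R\<^sup>2 / C\<^sup>2))"
    using c by (simp add: s field_simps power2_eq_square power3_eq_cube power4_eq_xxxx)
  finally show ?thesis using assms(1) by (simp add: t_def C_def abs_mult)
qed

lemma polar_mink:
  assumes "pt (q $ 1) (q $ 2) \<in> strip"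
  shows "mink (polar R q) (polar R q) = - (q $ 0 * R)\<^sup>2"
  using chart_in_dS[OF assms, of R] by (simp add: polar_def mink_scaleR dS_def power2_eq_square)

lemma polar_inj:
  assumes "R > 0"
  shows "inj_on (polar R) (polar_domain R A)"
proof (rule inj_onI)
  fix q q' assume q: "q \<in> polar_domain R A" and q': "q' \<in> polar_domain R A" and eq: "polar R q = polar R q'"
  have p: "pt (q $ 1) (q $ 2) \<in> chart_domain" "pt (q' $ 1) (q' $ 2) \<in> chart_domain" "q $ 0 > 0" "q' $ 0 > 0"
    using q q' by (auto simp: polar_domain_def)
  have "(q $ 0 * R)\<^sup>2 = (q' $ 0 * R)\<^sup>2"
    using polar_mink[of q R] polar_mink[of q' R] eq p chart_domain_subset_strip by force
  then have 0: "q $ 0 = q' $ 0" using p assms by simp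
  then have "chart R (pt (q $ 1) (q $ 2)) = chart R (pt (q' $ 1) (q' $ 2))"
    using eq p by (simp add: polar_def)
  then have "pt (q $ 1) (q $ 2) = pt (q' $ 1) (q' $ 2)"
    using chart_inj[OF assms] p by (simp add: inj_on_def)
  then show "q = q'" using 0 by (simp add: vec2_eq_iff vec3_eq_iff)
qed

lemma polar_image:
  assumes R: "R > 0"
  shows "polar R ` polar_domain R A = cone_shell R A"
proof (intro set_eqI iffI)
  fix x assume "x \<in> polar R ` polar_domain R A"
  then obtain q where q: "q \<in> polar_domain R A" and x: "x = polar R q" by blast
  have p: "pt (q $ 1) (q $ 2) \<in> strip" "1 \<le> q $ 0" "q $ 0 \<le> 2" "chart R (pt (q $ 1) (q $ 2)) \<in> A"
    using q chart_domain_subset_strip by (auto simp: polar_domain_def)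
  have m: "mink x x = - (q $ 0 * R)\<^sup>2" using polar_mink[OF p(1)] x by simp
  have "(q $ 0)\<^sup>2 \<ge> 1" "(q $ 0)\<^sup>2 \<le> 2\<^sup>2"
    using p power_mono[of 1 "q $ 0" 2] power_mono[of "q $ 0" 2 2] by simp_all
  then have "R\<^sup>2 * 1 \<le> R\<^sup>2 * (q $ 0)\<^sup>2" "R\<^sup>2 * (q $ 0)\<^sup>2 \<le> R\<^sup>2 * 2\<^sup>2" by (simp_all only: mult_left_mono zero_le_power2)
  moreover have "sqrt (- mink x x) = q $ 0 * R" using m p R by simp
  then have "(R / sqrt (- mink x x)) *\<^sub>R x = chart R (pt (q $ 1) (q $ 2))" using p R by (simp add: x polar_def)
  ultimately show "x \<in> cone_shell R A"
    using p(4) by (simp add: cone_shell_def m power_mult_distrib mult.commute)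
next
  fix x assume x: "x \<in> cone_shell R A"
  define r where "r = sqrt (- mink x x)"
  have "R\<^sup>2 \<le> - mink x x" "- mink x x \<le> (2 * R)\<^sup>2" using x by (auto simp: cone_shell_def)
  then have r: "R \<le> r" "r \<le> 2 * R"
    unfolding r_def using R by (auto intro: real_le_rsqrt real_le_lsqrt)
  have r0: "r > 0" using r R by simp
  then have rr: "r * r = - mink x x" unfolding r_def by (simp add: real_sqrt_gt_0_iff)
  have "mink ((R / r) *\<^sub>R x) ((R / r) *\<^sub>R x) = - R\<^sup>2"
  proof -
    have "mink ((R / r) *\<^sub>R x) ((R / r) *\<^sub>R x) = (R / r) * (R / r) * - (r * r)"
      unfolding mink_scaleR rr by simp
    also have "\<dots> = - R\<^sup>2" using r0 by (simp add: power2_eq_square)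
    finally show ?thesis .
  qed
  then obtain p where p: "p \<in> chart_domain" "chart R p = (R / r) *\<^sub>R x"
    using chart_surj[OF R] by (auto simp: dS_def)
  have "vec3 (r / R) p \<in> polar_domain R A" "x = polar R (vec3 (r / R) p)"
    using p r r0 R x by (auto simp: polar_domain_def polar_def r_def cone_shell_def field_simps)
  then show "x \<in> polar R ` polar_domain R A" by blast
qed

text \<open>Boundedness makes the Lebesgue measure of the shell finite, so that the real-valued
  \<open>measure\<close> carries the same information as \<open>emeasure\<close>.\<close>

lemma cone_shell_bounded:
  assumes R: "R > 0" and T: "A \<subseteq> slab T"
  shows "bounded (cone_shell R A)"
proof -
  have "norm x \<le> \<bar>2 * T\<bar> + (\<bar>2 * T\<bar> + 2 * R) + (\<bar>2 * T\<bar> + 2 * R)" if x: "x \<in> cone_shell R A" for x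
  proof -
    obtain q where q: "q \<in> polar_domain R A" and xq: "x = polar R q"
      using x polar_image[OF R] by blast
    have p: "pt (q $ 1) (q $ 2) \<in> strip" "1 \<le> q $ 0" "q $ 0 \<le> 2" "\<bar>chart R (pt (q $ 1) (q $ 2)) $ 0\<bar> \<le> T"
      using q chart_domain_subset_strip T by (auto simp: polar_domain_def slab_def)
    have "\<bar>x $ 0\<bar> = q $ 0 * \<bar>chart R (pt (q $ 1) (q $ 2)) $ 0\<bar>" using p by (simp add: xq polar_def abs_mult)
    also have "\<dots> \<le> 2 * T" using p by (intro mult_mono) auto
    finally have x0: "\<bar>x $ 0\<bar> \<le> \<bar>2 * T\<bar>" by simp
    then have "(x$0)\<^sup>2 \<le> (2 * T)\<^sup>2" by (simp add: abs_le_square_iff)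
    moreover have "(x$1)\<^sup>2 + (x$2)\<^sup>2 \<le> (2 * R)\<^sup>2 + (x$0)\<^sup>2"
      using x by (simp add: cone_shell_def mink_def power2_eq_square)
    ultimately have "(x$1)\<^sup>2 + (x$2)\<^sup>2 \<le> (2 * R)\<^sup>2 + (2 * T)\<^sup>2" by simp
    also have "\<dots> \<le> (\<bar>2 * T\<bar> + 2 * R)\<^sup>2" using R by (simp add: power2_sum)
    finally have "(x$1)\<^sup>2 \<le> (\<bar>2 * T\<bar> + 2 * R)\<^sup>2" "(x$2)\<^sup>2 \<le> (\<bar>2 * T\<bar> + 2 * R)\<^sup>2"
      using zero_le_power2[of "x$1"] zero_le_power2[of "x$2"] by linarith+
    then have "\<bar>x$1\<bar> \<le> \<bar>2 * T\<bar> + 2 * R" "\<bar>x$2\<bar> \<le> \<bar>2 * T\<bar> + 2 * R"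
      using R abs_le_square_iff[of _ "\<bar>2 * T\<bar> + 2 * R"] by auto
    then show ?thesis
      using norm_le_l1_cart[of x] x0 unfolding sum_three by linarith
  qed
  then show ?thesis unfolding bounded_iff by blast
qed

text \<open>The radial integral. Its value is \<open>7 * R / 3\<close>; being positive and finite,
  it can be cancelled.\<close>

definition shell_const :: "real \<Rightarrow> ennreal" where
  "shell_const R = (\<integral>\<^sup>+t. ennreal (R * t\<^sup>2) * indicator {1..2} t \<partial>lborel)"

lemma shell_const:
  assumes "R > 0"
  shows "shell_const R \<noteq> 0" "shell_const R \<noteq> \<infinity>"
proof -
  have "shell_const R = ennreal (R * 2^3/3 - R * 1^3/3)"
    unfolding shell_const_def using assms
    by (intro nn_integral_FTC_Icc[where F="\<lambda>t. R * t^3/3"]) (auto intro!: derivative_eq_intros simp: power2_eq_square)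
  then show "shell_const R \<noteq> 0" "shell_const R \<noteq> \<infinity>" using assms by auto
qed

lemma cone_shell_measure:
  assumes R: "R > 0" and A [measurable]: "A \<in> sets borel" and T: "A \<subseteq> slab T"
  shows "ennreal (measure lebesgue (cone_shell R A)) = shell_const R * emeasure (dS_volume R) A"
proof -
  let ?S = "polar_domain R A"
  have S: "?S \<in> sets borel" by measurable
  have strip: "pt (q $ 1) (q $ 2) \<in> strip" if "q \<in> ?S" for q
    using that chart_domain_subset_strip by (auto simp: polar_domain_def)
  have "cone_shell R A \<in> lmeasurable"
    using cone_shell_bounded[OF R T] cone_shell_measurable[OF A] by (intro bounded_set_imp_lmeasurable) auto
  then have "((\<lambda>q. \<bar>det (matrix (polar_deriv R q))\<bar>) has_integral measure lebesgue (cone_shell R A)) ?S"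
    using has_measure_differentiable_image[of ?S "polar R" "polar_deriv R" "measure lebesgue (cone_shell R A)"]
      S polar_inj[OF R] has_derivative_polar[OF strip] by (auto simp: polar_image[OF R] has_derivative_at_withinI)
  then have "((\<lambda>q. R * (q $ 0)\<^sup>2 * (R\<^sup>2 / (cos (q $ 1))\<^sup>2)) has_integral measure lebesgue (cone_shell R A)) ?S"
    by (rule has_integral_eq[rotated]) (simp add: det_polar[OF R strip])
  then have "ennreal (measure lebesgue (cone_shell R A)) =
      (\<integral>\<^sup>+q. ennreal (R * (q $ 0)\<^sup>2 * (R\<^sup>2 / (cos (q $ 1))\<^sup>2)) * indicator ?S q \<partial>lborel)"
    using R by (intro nn_integral_has_integral_lebesgue'[symmetric]) auto
  also have "\<dots> = (\<integral>\<^sup>+z. (case z of (t, p) \<Rightarrow> ennreal (R * t\<^sup>2 * (R\<^sup>2 / (cos (p $ 0))\<^sup>2)) * indicator ?S (vec3 t p)) \<partial>(lborel \<Otimes>\<^sub>M lborel))"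
    unfolding lborel_three by (subst nn_integral_distr) (auto simp: case_prod_unfold)
  also have "\<dots> = (\<integral>\<^sup>+t. \<integral>\<^sup>+p. ennreal (R * t\<^sup>2 * (R\<^sup>2 / (cos (p $ 0))\<^sup>2)) * indicator ?S (vec3 t p) \<partial>lborel \<partial>lborel)"
    by (subst lborel.nn_integral_fst[symmetric]) auto
  also have "\<dots> = (\<integral>\<^sup>+t. (ennreal (R * t\<^sup>2) * indicator {1..2} t) * (\<integral>\<^sup>+p. (ennreal (rho R p) * indicator A (chart R p)) \<partial>lborel) \<partial>lborel)"
  proof (intro nn_integral_cong)
    fix t :: real
    have "ennreal (R * t\<^sup>2 * (R\<^sup>2 / (cos (p $ 0))\<^sup>2)) * indicator ?S (vec3 t p) =
       (ennreal (R * t\<^sup>2) * indicator {1..2} t) * (ennreal (rho R p) * indicator A (chart R p))" for p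
      using R by (auto simp: polar_domain_def rho_def indicator_def ennreal_mult'[symmetric])
    then show "(\<integral>\<^sup>+p. ennreal (R * t\<^sup>2 * (R\<^sup>2 / (cos (p $ 0))\<^sup>2)) * indicator ?S (vec3 t p) \<partial>lborel) =
      (ennreal (R * t\<^sup>2) * indicator {1..2} t) * (\<integral>\<^sup>+p. (ennreal (rho R p) * indicator A (chart R p)) \<partial>lborel)"
      by (simp add: nn_integral_cmult)
  qed
  also have "\<dots> = shell_const R * emeasure (dS_volume R) A"
    unfolding shell_const_def emeasure_dS_volume[OF A] by (rule nn_integral_multc) auto
  finally show ?thesis .
qed

lemma cone_shell_vimage:
  assumes "g \<in> SO0_1_2"
  shows "cone_shell R ((\<lambda>x. g *v x) -` A) = (\<lambda>x. g *v x) -` cone_shell R A"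
  by (auto simp: cone_shell_def SO_mink[OF assms] matrix_vector_mult_scaleR)

lemma matrix_vector_mult_measurable [measurable]: "(\<lambda>x::real^'n. g *v x) \<in> borel_measurable borel"
  by (intro borel_measurable_continuous_onI matrix_vector_mult_linear_continuous_on)

text \<open>A linear map of determinant \<open>1\<close> preserves Lebesgue measure, and since
  \<open>mink\<close> is invariant it carries shells to shells. Cancelling
  \<open>shell_const R\<close> transfers this to the volume.\<close>

lemma emeasure_dS_volume_vimage_slab:
  assumes R: "R > 0" and g: "g \<in> SO0_1_2" and A [measurable]: "A \<in> sets borel"
    and T: "A \<subseteq> slab T" "(\<lambda>x. g *v x) -` A \<subseteq> slab T"
  shows "emeasure (dS_volume R) ((\<lambda>x. g *v x) -` A) = emeasure (dS_volume R) A"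
proof -
  let ?A' = "(\<lambda>x. g *v x) -` A"
  have A': "?A' \<in> sets borel" using measurable_sets_borel[OF matrix_vector_mult_measurable[of g] A] by simp
  have "?A' \<in> sets borel" "cone_shell R ?A' \<in> lmeasurable"
    using cone_shell_bounded[OF R T(2)] cone_shell_measurable[OF A'] A' by (auto intro!: bounded_set_imp_lmeasurable)
  moreover have "(\<lambda>x. g *v x) ` cone_shell R ?A' = cone_shell R A"
    unfolding cone_shell_vimage[OF g]
    by (rule surj_image_vimage_eq) (metis SO_inv_mult(2)[OF g] surjI)
  moreover have "linear (\<lambda>x. g *v x)" by simp
  ultimately have "measure lebesgue (cone_shell R A) = \<bar>det g\<bar> * measure lebesgue (cone_shell R ?A')"
    using measure_linear_image[of "\<lambda>x. g *v x" "cone_shell R ?A'"] by simp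
  then have "shell_const R * emeasure (dS_volume R) ?A' = shell_const R * emeasure (dS_volume R) A"
    using g cone_shell_measure[OF R A T(1)] cone_shell_measure[OF R A' T(2)] by (simp add: SO0_1_2_def)
  then show ?thesis
    using shell_const[OF R] by (simp add: ennreal_mult_cancel_left)
qed

lemma dS_volume_invariant:
  assumes R: "R > 0" and g: "g \<in> SO0_1_2"
  shows "distr (dS_volume R) borel (\<lambda>x. g *v x) = dS_volume R"
proof (rule measure_eqI)
  fix A assume "A \<in> sets (distr (dS_volume R) borel (\<lambda>x. g *v x))"
  then have A [measurable]: "A \<in> sets borel" by simp
  let ?g = "\<lambda>x. g *v x" and ?\<sigma> = "dS_volume R"
  \<comment> \<open>Exhaustion of \<open>A\<close> by sets on which the time component is bounded
    both before and after applying the inverse of \<open>g\<close>; the bounded case applies to each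
    \<open>B n\<close>.\<close>
  define B where "B n = A \<inter> slab (real n) \<inter> (\<lambda>x. matrix_inv g *v x) -` slab (real n)" for n :: nat
  have Bm: "B n \<in> sets borel" for n
    unfolding B_def using measurable_sets_borel[OF matrix_vector_mult_measurable slab_measurable] by measurable
  have vB: "?g -` B n \<in> sets borel" for n using measurable_sets_borel[OF matrix_vector_mult_measurable[of g] Bm] by simp
  have inc: "incseq B" by (auto simp: B_def incseq_def slab_def)
  have UB: "(\<Union>n. B n) = A"
  proof -
    have "\<exists>n. x \<in> B n" if "x \<in> A" for x
    proof -
      obtain n :: nat where "\<bar>x $ 0\<bar> + \<bar>(matrix_inv g *v x) $ 0\<bar> \<le> real n" using real_arch_simple by blast
      then show ?thesis using that by (intro exI[of _ n]) (auto simp: B_def slab_def)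
    qed
    then show ?thesis by (auto simp: B_def)
  qed
  have "emeasure (distr ?\<sigma> borel ?g) A = emeasure ?\<sigma> (?g -` A)"
    by (subst emeasure_distr) auto
  also have "?g -` A = (\<Union>n. ?g -` B n)" unfolding UB[symmetric] by blast
  also have "emeasure ?\<sigma> (\<Union>n. ?g -` B n) = (SUP n. emeasure ?\<sigma> (?g -` B n))"
    using vB inc by (intro SUP_emeasure_incseq[symmetric]) (auto simp: incseq_def subset_iff)
  also have "\<dots> = (SUP n. emeasure ?\<sigma> (B n))"
  proof -
    have "B n \<subseteq> slab (real n)" "?g -` B n \<subseteq> slab (real n)" for n
      by (auto simp: B_def SO_inv_mult[OF g])
    then have "emeasure ?\<sigma> (?g -` B n) = emeasure ?\<sigma> (B n)" for n
      using emeasure_dS_volume_vimage_slab[OF R g Bm, of n "real n"] by blast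
    then show ?thesis by simp
  qed
  also have "\<dots> = emeasure ?\<sigma> (\<Union>n. B n)"
    using Bm inc by (intro SUP_emeasure_incseq) auto
  finally show "emeasure (distr ?\<sigma> borel ?g) A = emeasure ?\<sigma> A" by (simp add: UB)
qed simp

section \<open>Tubes and boundary values\<close>

lemma Vplus_iff: "y \<in> Vplus \<longleftrightarrow> (y $ 1)\<^sup>2 + (y $ 2)\<^sup>2 < (y $ 0)\<^sup>2 \<and> y $ 0 > 0"
  by (auto simp: Vplus_def mink_def power2_eq_square)

text \<open>In the forward cone the product of the time components dominates the spatial inner
  product, by Cauchy--Schwarz in the two spatial components.\<close>

lemma mink_Vplus_pos:
  assumes "a \<in> Vplus" "b \<in> Vplus"
  shows "mink a b > 0"
proof -
  have "(a$1 * b$1 + a$2 * b$2)\<^sup>2 \<le> ((a$1)\<^sup>2 + (a$2)\<^sup>2) * ((b$1)\<^sup>2 + (b$2)\<^sup>2)"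
  proof -
    have "((a$1)\<^sup>2 + (a$2)\<^sup>2) * ((b$1)\<^sup>2 + (b$2)\<^sup>2) - (a$1 * b$1 + a$2 * b$2)\<^sup>2 = (a$1 * b$2 - a$2 * b$1)\<^sup>2"
      by (simp add: power2_eq_square algebra_simps)
    then show ?thesis by (metis diff_ge_0_iff_ge zero_le_power2)
  qed
  also have "\<dots> < (a$0)\<^sup>2 * (b$0)\<^sup>2"
    using assms by (intro mult_strict_mono') (auto simp: Vplus_iff)
  finally have "\<bar>a$1 * b$1 + a$2 * b$2\<bar> < a$0 * b$0"
    using assms power2_less_imp_less[of "\<bar>a$1 * b$1 + a$2 * b$2\<bar>" "a$0 * b$0"]
    by (simp add: power_mult_distrib Vplus_iff)
  then show ?thesis by (simp add: mink_def)
qed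

lemma Vplus_add: "a \<in> Vplus \<Longrightarrow> b \<in> Vplus \<Longrightarrow> a + b \<in> Vplus"
  using mink_Vplus_pos[of a b] by (auto simp: Vplus_def mink_def algebra_simps)

lemma Vminus_iff: "y \<in> Vminus \<longleftrightarrow> - y \<in> Vplus"
  unfolding Vminus_def by (metis (no_types, lifting) image_iff minus_minus)

lemma sgn_mink_Vplus:
  assumes y: "y \<in> Vplus" and x: "mink x x > 0"
  shows "sgn (mink x y) = sgn (x $ 0)"
proof -
  have "(x$0)\<^sup>2 > 0"
    using x zero_le_power2[of "x$1"] zero_le_power2[of "x$2"] unfolding mink_def power2_eq_square by linarith
  then consider "x $ 0 > 0" | "x $ 0 < 0" by fastforce
  then show ?thesis
  proof cases
    case 1
    then have "x \<in> Vplus" using x by (simp add: Vplus_def)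
    then show ?thesis using mink_Vplus_pos[of x y] y 1 by simp
  next
    case 2
    then have "- x \<in> Vplus" using x by (simp add: Vplus_def mink_def)
    then have "mink (- x) y > 0" using mink_Vplus_pos y by blast
    then show ?thesis using 2 by (simp add: mink_def)
  qed
qed

definition vRe :: "complex^3 \<Rightarrow> real^3" where "vRe z = (\<chi> i. Re (z $ i))"
definition vIm :: "complex^3 \<Rightarrow> real^3" where "vIm z = (\<chi> i. Im (z $ i))"

lemma Re_mink: "Re (mink z z) = mink (vRe z) (vRe z) - mink (vIm z) (vIm z)"
  and Im_mink: "Im (mink z z) = 2 * mink (vRe z) (vIm z)"
  by (simp_all add: mink_def vRe_def vIm_def algebra_simps)

definition W0_arg :: "real \<Rightarrow> complex^3 \<Rightarrow> complex^3 \<Rightarrow> complex" where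
  "W0_arg R z z' = - (mink (z - z') (z - z') / (of_real R)\<^sup>2)"

lemma W0_eq_Ln: "W0 R z z' = - (1 / (4 * of_real pi)) * Ln (W0_arg R z z')"
  by (simp add: W0_def W0_arg_def)

lemma Re_W0_arg: "Re (W0_arg R z z') = (mink (vIm (z - z')) (vIm (z - z')) - mink (vRe (z - z')) (vRe (z - z'))) / R\<^sup>2"
  and Im_W0_arg: "Im (W0_arg R z z') = - (2 * mink (vRe (z - z')) (vIm (z - z')) / R\<^sup>2)"
  unfolding W0_arg_def of_real_power[symmetric]
  by (simp_all only: uminus_complex.simps Re_divide_of_real Im_divide_of_real Re_mink Im_mink)
    (simp_all add: minus_divide_left)

lemma tubes_diff:
  assumes "z \<in> tube_minus R" "z' \<in> tube_plus R"
  shows "- vIm (z - z') \<in> Vplus"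
proof -
  have "- vIm z \<in> Vplus" "vIm z' \<in> Vplus"
    using assms by (auto simp: tube_minus_def tube_plus_def Vminus_iff vIm_def)
  then have "vIm z' + - vIm z \<in> Vplus" using Vplus_add by blast
  moreover have "vIm z' + - vIm z = - vIm (z - z')" by (simp add: vec_eq_iff vIm_def)
  ultimately show ?thesis by simp
qed

text \<open>The imaginary part of a square is twice the product of real and imaginary parts, and the
  imaginary part of \<open>z - z'\<close> lies in the backward cone. So the time order decides from
  which side the branch cut is approached.\<close>

lemma sgn_Im_W0_arg:
  assumes "R > 0" "z \<in> tube_minus R" "z' \<in> tube_plus R" "mink (vRe (z - z')) (vRe (z - z')) > 0"
  shows "sgn (Im (W0_arg R z z')) = sgn (vRe (z - z') $ 0)"
proof -
  have "Im (W0_arg R z z') = 2 * mink (vRe (z - z')) (- vIm (z - z')) / R\<^sup>2"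
    unfolding Im_W0_arg minus_divide_left by (simp add: mink_def)
  then have "sgn (Im (W0_arg R z z')) = sgn (mink (vRe (z - z')) (- vIm (z - z')))"
    using assms(1) by (simp add: sgn_mult)
  then show ?thesis using sgn_mink_Vplus[OF tubes_diff[OF assms(2,3)] assms(4)] by simp
qed

text \<open>If the argument is real, the real part of \<open>z - z'\<close> cannot be timelike, and
  then both terms of the real part of the argument have the favourable sign. The principal logarithm
  is thus continuous on the product of the tubes.\<close>

lemma W0_arg_slit:
  assumes R: "R > 0" and z: "z \<in> tube_minus R" "z' \<in> tube_plus R"
  shows "W0_arg R z z' \<notin> \<real>\<^sub>\<le>\<^sub>0"
proof
  assume "W0_arg R z z' \<in> \<real>\<^sub>\<le>\<^sub>0"
  then have re: "Re (W0_arg R z z') \<le> 0" and im: "Im (W0_arg R z z') = 0"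
    by (auto simp: complex_nonpos_Reals_iff)
  have V: "- vIm (z - z') \<in> Vplus" by (rule tubes_diff[OF z])
  then have "mink (vIm (z - z')) (vIm (z - z')) > 0" by (simp add: Vplus_def mink_def)
  moreover have "mink (vRe (z - z')) (vRe (z - z')) \<le> 0"
  proof (rule ccontr)
    assume "\<not> ?thesis"
    then have pos: "mink (vRe (z - z')) (vRe (z - z')) > 0" by simp
    then have "vRe (z - z') $ 0 = 0" using sgn_Im_W0_arg[OF R z pos] im by (simp add: sgn_0_0)
    then show False using pos by (simp add: mink_def) (smt (verit) zero_le_square)
  qed
  ultimately have "Re (W0_arg R z z') > 0" using R by (simp add: Re_W0_arg)
  then show False using re by simp
qed

section \<open>The tubes in chart coordinates\<close>

lemma displace_nth [simp]: "displace p y $ i = Complex (p $ i) (y $ i)"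
  by (simp add: displace_def)

lemma chart_cnj: "chart R (displace p (- y)) $ i = cnj (chart R (displace p y) $ i)"
proof -
  have "Complex a (- b) = cnj (Complex a b)" for a b by (simp add: complex_eq_iff)
  then show ?thesis by (simp add: chart_def tan_def cnj_cos cnj_sin)
qed

lemma chart_diff_mink:
  fixes p q :: "'a::{real_normed_field,banach} ^ 2"
  assumes "cos (p $ 0) \<noteq> 0" "cos (q $ 0) \<noteq> 0"
  shows "mink (chart R p - chart R q) (chart R p - chart R q) = - 2 * (of_real R)\<^sup>2 *
    (cos (p $ 0 - q $ 0) - cos (p $ 1 - q $ 1)) / (cos (p $ 0) * cos (q $ 0))"
proof -
  have "mink (chart R p - chart R q) (chart R p - chart R q) =
    - 2 * (of_real R)\<^sup>2 - 2 * ((of_real R)\<^sup>2 * (sin (p $ 0) * sin (q $ 0) - cos (p $ 1 - q $ 1)) / (cos (p $ 0) * cos (q $ 0)))"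
    by (simp add: mink_diff_self chart_self[OF assms(1)] chart_self[OF assms(2)] mink_chart[OF assms])
  also have "\<dots> = - 2 * (of_real R)\<^sup>2 * (cos (p $ 0) * cos (q $ 0) + sin (p $ 0) * sin (q $ 0) - cos (p $ 1 - q $ 1)) / (cos (p $ 0) * cos (q $ 0))"
    using assms by (simp add: field_simps)
  finally show ?thesis by (simp add: cos_diff[of "p $ 0"])
qed

lemma norm_cos_sq: "(cmod (cos (Complex a b)))\<^sup>2 = (cos a)\<^sup>2 + (sinh b)\<^sup>2"
  by (simp add: norm_cos_squared sinh_field_def power_divide exp_minus)

lemma norm_sin_sq: "(cmod (sin (Complex a b)))\<^sup>2 = (sin a)\<^sup>2 + (sinh b)\<^sup>2"
proof -
  have "of_real pi / 2 - Complex a b = Complex (pi / 2 - a) (- b)" by (simp add: complex_eq_iff)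
  then have "sin (Complex a b) = cos (Complex (pi / 2 - a) (- b))" by (simp add: sin_cos_eq)
  then show ?thesis by (simp add: norm_cos_sq cos_diff)
qed

text \<open>The imaginary part is \<open>(z - cnj z) / (2 * \<i>)\<close>, and the conjugate is the
  chart at the opposite displacement. The interval formula \<open>chart_diff_mink\<close> between
  these two points therefore yields its square; \<open>N\<close> is the squared modulus of the
  complex cosine.\<close>

lemma chart_mink_Im:
  fixes R :: real and p y :: "real^2"
  defines "z \<equiv> chart R (displace p y)" and "N \<equiv> (cos (p $ 0))\<^sup>2 + (sinh (y $ 0))\<^sup>2"
  assumes N: "N \<noteq> 0"
  shows "mink (vIm z) (vIm z) = R\<^sup>2 * (cosh (2 * y $ 0) - cosh (2 * y $ 1)) / (2 * N)"
    "vIm z $ 0 = R * sinh (2 * y $ 0) / (2 * N)"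
proof -
  let ?c = "cos (Complex (p $ 0) (y $ 0))" and ?z' = "chart R (displace p (- y))"
  have cN: "?c * cnj ?c = of_real N" by (simp add: complex_norm_square[symmetric] norm_cos_sq N_def del: of_real_add)
  have c': "cos (Complex (p $ 0) (- y $ 0)) = cnj ?c"
    unfolding cnj_cos by (rule arg_cong[where f=cos]) (simp add: complex_eq_iff)
  have c0: "?c \<noteq> 0" using cN N by auto
  have co: "cos (Complex a b - Complex a (- b)) = of_real (cosh (2 * b))" for a b
  proof -
    have "Complex a b - Complex a (- b) = Complex 0 (2 * b)" by (simp add: complex_eq_iff)
    then show ?thesis by (simp add: complex_eq_iff Re_cos Im_cos cosh_field_def exp_minus field_simps power2_eq_square)
  qed
  have "mink (z - ?z') (z - ?z') = - 2 * (of_real R)\<^sup>2 * (of_real (cosh (2 * y $ 0)) - of_real (cosh (2 * y $ 1))) / of_real N"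
    using c0 by (simp add: z_def chart_diff_mink c' cN co)
  moreover have "mink (z - ?z') (z - ?z') = of_real (- 4 * mink (vIm z) (vIm z))"
  proof -
    have "(z - ?z') $ i = 2 * \<i> * of_real (vIm z $ i)" for i
      by (simp add: z_def chart_cnj vIm_def complex_eq_iff)
    then show ?thesis by (simp add: mink_def algebra_simps)
  qed
  ultimately have "complex_of_real (- 4 * mink (vIm z) (vIm z)) = of_real (- 2 * R\<^sup>2 * (cosh (2 * y $ 0) - cosh (2 * y $ 1)) / N)"
    by simp
  then have "- 4 * mink (vIm z) (vIm z) = - 2 * R\<^sup>2 * (cosh (2 * y $ 0) - cosh (2 * y $ 1)) / N"
    by (simp only: of_real_eq_iff)
  then show "mink (vIm z) (vIm z) = R\<^sup>2 * (cosh (2 * y $ 0) - cosh (2 * y $ 1)) / (2 * N)"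
    using N by (simp add: field_simps)
  have "tan (Complex (p $ 0) (y $ 0)) = sin (Complex (p $ 0) (y $ 0)) * cnj ?c / of_real N"
    using c0 by (simp add: tan_def cN[symmetric])
  then have "Im (tan (Complex (p $ 0) (y $ 0))) = Im (sin (Complex (p $ 0) (y $ 0)) * cnj ?c) / N"
    by simp
  also have "Im (sin (Complex (p $ 0) (y $ 0)) * cnj ?c) =
      sinh (y $ 0) * cosh (y $ 0) * (cos (p $ 0) * cos (p $ 0)) + sinh (y $ 0) * cosh (y $ 0) * (sin (p $ 0) * sin (p $ 0))"
    by (simp add: Re_sin Im_sin Re_cos Im_cos sinh_field_def cosh_field_def field_simps power2_eq_square)
  finally have "Im (tan (Complex (p $ 0) (y $ 0))) = sinh (2 * y $ 0) / (2 * N)"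
    by (simp add: sinh_double distrib_left[symmetric] del: distrib_left)
  then show "vIm z $ 0 = R * sinh (2 * y $ 0) / (2 * N)"
    by (simp add: vIm_def z_def chart_nth)
qed

lemma chart_in_tube_plus:
  assumes R: "R > 0" and y: "y $ 0 > \<bar>y $ 1\<bar>"
  shows "chart R (displace p y) \<in> tube_plus R"
proof -
  have "y $ 0 > 0" using y by linarith
  then have N: "(cos (p $ 0))\<^sup>2 + (sinh (y $ 0))\<^sup>2 > 0" by (simp add: add_nonneg_pos)
  have "cos (displace p y $ 0) \<noteq> 0"
    using N norm_cos_sq[of "p $ 0" "y $ 0"] by auto
  then have "chart R (displace p y) \<in> dS_complex R" by (simp add: dS_complex_def chart_self)
  moreover have "cosh (2 * y $ 0) > cosh (2 * y $ 1)"
    using y cosh_real_strict_mono[of "\<bar>2 * y $ 1\<bar>" "2 * y $ 0"] by simp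
  then have "vIm (chart R (displace p y)) \<in> Vplus"
    using chart_mink_Im[of p y R] N R \<open>y $ 0 > 0\<close> by (simp add: Vplus_def)
  ultimately show ?thesis by (simp add: tube_plus_def vIm_def)
qed

lemma chart_in_tube_minus:
  assumes R: "R > 0" and y: "y $ 0 > \<bar>y $ 1\<bar>"
  shows "chart R (displace p (- y)) \<in> tube_minus R"
proof -
  let ?z = "chart R (displace p y)" and ?z' = "chart R (displace p (- y))"
  have z: "?z \<in> tube_plus R" by (rule chart_in_tube_plus[OF assms])
  have "mink ?z' ?z' = cnj (mink ?z ?z)" by (simp add: mink_def chart_cnj)
  then have "?z' \<in> dS_complex R" using z by (simp add: tube_plus_def dS_complex_def)
  moreover have "(\<chi> i. Im (?z' $ i)) = - (\<chi> i. Im (?z $ i))" by (simp add: vec_eq_iff chart_cnj)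
  ultimately show ?thesis using z by (simp add: tube_minus_def tube_plus_def Vminus_iff)
qed

text \<open>The sign of the squared imaginary part does not depend on the base point, so the single
  base point \<open>0\<close> already forces both inequalities.\<close>

lemma tube_displacements_eq:
  assumes R: "R > 0"
  shows "tube_displacements R = {(y, y'). y $ 0 > \<bar>y $ 1\<bar> \<and> y' $ 0 > \<bar>y' $ 1\<bar>}"
proof -
  have *: "y $ 0 > \<bar>y $ 1\<bar>" if "vIm (chart R (displace 0 y)) \<in> Vplus" for y
  proof -
    define N where "N = (cos ((0::real^2) $ 0))\<^sup>2 + (sinh (y $ 0))\<^sup>2"
    have N: "N > 0" unfolding N_def by (simp add: add_pos_nonneg)
    have "R * sinh (2 * y $ 0) / (2 * N) > 0" "R\<^sup>2 * (cosh (2 * y $ 0) - cosh (2 * y $ 1)) / (2 * N) > 0"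
      using that unfolding Vplus_def chart_mink_Im[of 0 y R, folded N_def, OF less_imp_neq[OF N, symmetric]]
      by (simp_all only: mem_Collect_eq chart_mink_Im[of 0 y R, folded N_def, OF less_imp_neq[OF N, symmetric]])
    then have "sinh (2 * y $ 0) > 0" "cosh (2 * y $ 0) > cosh (2 * y $ 1)"
      using N R by (simp_all add: zero_less_divide_iff zero_less_mult_iff)
    then have "y $ 0 > 0" and "cosh \<bar>2 * y $ 1\<bar> < cosh \<bar>2 * y $ 0\<bar>"
      by (simp, simp only: cosh_real_abs)
    moreover from this(2) have "\<bar>2 * y $ 1\<bar> < \<bar>2 * y $ 0\<bar>"
      by (subst (asm) cosh_real_nonneg_less_iff) (rule abs_ge_zero)+
    ultimately show ?thesis by simp
  qed
  have 0: "0 \<in> chart_domain" by (simp add: chart_domain_def)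
  have "y $ 0 > \<bar>y $ 1\<bar> \<and> y' $ 0 > \<bar>y' $ 1\<bar>" if "(y, y') \<in> tube_displacements R" for y y'
  proof -
    have "chart R (displace 0 (- y)) \<in> tube_minus R" "chart R (displace 0 y') \<in> tube_plus R"
      using that 0 by (auto simp: tube_displacements_def)
    moreover have "(\<chi> i. Im (chart R (displace 0 (- y)) $ i)) = - vIm (chart R (displace 0 y))"
      by (simp add: vec_eq_iff chart_cnj vIm_def)
    ultimately show ?thesis
      using *[of y] *[of y'] by (simp add: tube_minus_def tube_plus_def Vminus_iff vIm_def)
  qed
  moreover have "(y, y') \<in> tube_displacements R" if "y $ 0 > \<bar>y $ 1\<bar> \<and> y' $ 0 > \<bar>y' $ 1\<bar>" for y y'
    unfolding tube_displacements_def
    using that chart_in_tube_plus[OF R, of y'] chart_in_tube_minus[OF R, of y] by blast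
  ultimately show ?thesis by blast
qed

text \<open>The boundary value of \<open>W0\<close>. For timelike pairs the argument tends to the
  negative axis, where the logarithm contributes \<open>\<i> * pi\<close> with the sign of the time
  order. On the light cone \<open>ln 0 = 0\<close> gives the default value \<open>0\<close>; this
  concerns a null set only.\<close>

definition kern :: "real \<Rightarrow> real^3 \<Rightarrow> real^3 \<Rightarrow> complex" where
  "kern R x x' = - (1 / (4 * of_real pi)) * (of_real (ln (\<bar>mink (x - x') (x - x')\<bar> / R\<^sup>2)) +
     (if mink (x - x') (x - x') > 0 then \<i> * of_real (pi * sgn (x $ 0 - x' $ 0)) else 0))"

lemma chart_tendsto_real:
  assumes q: "\<And>k. ((\<lambda>z. q z $ k) \<longlongrightarrow> of_real (p $ k)) F" and p: "p \<in> strip"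
  shows "((\<lambda>z. chart R (q z) $ i) \<longlongrightarrow> complex_of_real (chart R p $ i)) F"
proof -
  have c: "cos (complex_of_real (p $ 0)) \<noteq> 0" using strip_cos_pos[OF p] by (simp add: cos_of_real)
  have sc: "((\<lambda>z. sin (q z $ k)) \<longlongrightarrow> sin (of_real (p $ k))) F" "((\<lambda>z. cos (q z $ k)) \<longlongrightarrow> cos (of_real (p $ k))) F" for k
    by (rule isCont_tendsto_compose[OF isCont_sin q], rule isCont_tendsto_compose[OF isCont_cos q])
  have "((\<lambda>z. chart R (q z) $ 0) \<longlongrightarrow> of_real R * (sin (of_real (p $ 0)) / cos (of_real (p $ 0)))) F"
    "((\<lambda>z. chart R (q z) $ 1) \<longlongrightarrow> of_real R * (cos (of_real (p $ 1)) / cos (of_real (p $ 0)))) F"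
    "((\<lambda>z. chart R (q z) $ 2) \<longlongrightarrow> of_real R * (sin (of_real (p $ 1)) / cos (of_real (p $ 0)))) F"
    unfolding chart_nth tan_def by (intro tendsto_intros sc c)+
  then have "\<forall>i. ((\<lambda>z. chart R (q z) $ i) \<longlongrightarrow> complex_of_real (chart R p $ i)) F"
    by (simp add: forall_three chart_nth tan_def cos_of_real sin_of_real)
  then show ?thesis ..
qed

lemma W0_arg_tendsto:
  fixes x x' :: "real^3"
  assumes z: "\<And>i. ((\<lambda>w. z w $ i) \<longlongrightarrow> complex_of_real (x $ i)) F"
    and z': "\<And>i. ((\<lambda>w. z' w $ i) \<longlongrightarrow> complex_of_real (x' $ i)) F"
  shows "((\<lambda>w. W0_arg R (z w) (z' w)) \<longlongrightarrow> of_real (- (mink (x - x') (x - x') / R\<^sup>2))) F"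
proof -
  have "((\<lambda>w. - (mink (z w - z' w) (z w - z' w) * inverse ((of_real R)\<^sup>2))) \<longlongrightarrow>
      - (((of_real (x $ 0) - of_real (x' $ 0)) * (of_real (x $ 0) - of_real (x' $ 0))
        - (of_real (x $ 1) - of_real (x' $ 1)) * (of_real (x $ 1) - of_real (x' $ 1))
        - (of_real (x $ 2) - of_real (x' $ 2)) * (of_real (x $ 2) - of_real (x' $ 2))) * inverse ((of_real R)\<^sup>2))) F"
    unfolding mink_def vector_minus_component by (intro tendsto_intros z z')
  then show ?thesis
    by (simp add: W0_arg_def mink_def divide_inverse)
qed

lemma W0_tendsto:
  fixes x x' :: "real^3"
  assumes R: "R > 0" and m: "mink (x - x') (x - x') \<noteq> 0"
    and z: "\<And>i. ((\<lambda>w. z w $ i) \<longlongrightarrow> complex_of_real (x $ i)) F"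
    and z': "\<And>i. ((\<lambda>w. z' w $ i) \<longlongrightarrow> complex_of_real (x' $ i)) F"
    and tubes: "\<forall>\<^sub>F w in F. z w \<in> tube_minus R \<and> z' w \<in> tube_plus R"
  shows "((\<lambda>w. W0 R (z w) (z' w)) \<longlongrightarrow> kern R x x') F"
proof -
  define m where "m = mink (x - x') (x - x') / R\<^sup>2"
  have m0: "m \<noteq> 0" using m R by (simp add: m_def)
  have lim: "((\<lambda>w. W0_arg R (z w) (z' w)) \<longlongrightarrow> of_real (- m)) F"
    unfolding m_def by (rule W0_arg_tendsto[OF z z'])
  have "((\<lambda>w. Ln (W0_arg R (z w) (z' w))) \<longlongrightarrow> of_real (ln \<bar>m\<bar>) +
      (if m > 0 then \<i> * of_real (pi * sgn (x $ 0 - x' $ 0)) else 0)) F"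
  proof (cases "m > 0")
    case False
    then have "m < 0" using m0 by simp
    then have "((\<lambda>w. Ln (W0_arg R (z w) (z' w))) \<longlongrightarrow> Ln (of_real (- m))) F"
      by (intro tendsto_Ln lim) (auto simp: complex_nonpos_Reals_iff)
    then show ?thesis using \<open>m < 0\<close> by (simp add: Ln_of_real[symmetric] del: of_real_minus)
  next
    case True
    have vlim: "((\<lambda>w. vRe (z w - z' w) $ i) \<longlongrightarrow> (x - x') $ i) F" for i
      using tendsto_Re[OF tendsto_diff[OF z[of i] z'[of i]]] by (simp add: vRe_def)
    have "((\<lambda>w. mink (vRe (z w - z' w)) (vRe (z w - z' w))) \<longlongrightarrow> mink (x - x') (x - x')) F"
      unfolding mink_def by (intro tendsto_intros vlim)
    moreover have pos: "mink (x - x') (x - x') > 0" using True R by (simp add: m_def zero_less_divide_iff)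
    ultimately have ev: "\<forall>\<^sub>F w in F. mink (vRe (z w - z' w)) (vRe (z w - z' w)) > 0"
      by (simp add: order_tendstoD(1))
    have evs: "\<forall>\<^sub>F w in F. sgn (Im (W0_arg R (z w) (z' w))) = sgn (vRe (z w - z' w) $ 0)"
      using ev tubes by eventually_elim (use sgn_Im_W0_arg[OF R] in blast)
    have "((x - x') $ 0)\<^sup>2 > 0"
      using pos zero_le_power2[of "(x - x')$1"] zero_le_power2[of "(x - x')$2"] unfolding mink_def power2_eq_square by linarith
    then have "x $ 0 - x' $ 0 \<noteq> 0" by auto
    then consider "x $ 0 - x' $ 0 > 0" | "x $ 0 - x' $ 0 < 0" by linarith
    then show ?thesis
    proof cases
      case 1
      have "\<forall>\<^sub>F w in F. vRe (z w - z' w) $ 0 > 0"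
        using order_tendstoD(1)[OF vlim[of 0], of 0] 1 by simp
      \<comment> \<open>\<open>Ln\<close> jumps at the limit \<open>- m\<close>. Multiplication by
        \<open>- \<i>\<close> carries the upper side of the cut to a neighbourhood of
        \<open>\<i> * m\<close>, where \<open>Ln\<close> is continuous; the quarter turn is added
        back.\<close>
      then have "\<forall>\<^sub>F w in F. Ln (- \<i> * W0_arg R (z w) (z' w)) + \<i> * of_real pi / 2 = Ln (W0_arg R (z w) (z' w))"
        using evs
      proof eventually_elim
        case (elim w)
        then have im: "Im (W0_arg R (z w) (z' w)) > 0" by (simp add: sgn_1_pos)
        then have "W0_arg R (z w) (z' w) \<noteq> 0" by (metis less_irrefl zero_complex.sel(2))
        then show ?case
          using Ln_times_ii[of "- \<i> * W0_arg R (z w) (z' w)"] im by simp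
      qed
      moreover have "((\<lambda>w. Ln (- \<i> * W0_arg R (z w) (z' w)) + \<i> * of_real pi / 2) \<longlongrightarrow>
        Ln (- \<i> * of_real (- m)) + \<i> * of_real pi / 2) F"
        using True by (intro tendsto_intros tendsto_Ln lim) (auto simp: complex_nonpos_Reals_iff)
      ultimately have "((\<lambda>w. Ln (W0_arg R (z w) (z' w))) \<longlongrightarrow> Ln (- \<i> * of_real (- m)) + \<i> * of_real pi / 2) F"
        by (rule Lim_transform_eventually[rotated])
      moreover have "Ln (- \<i> * of_real (- m)) = of_real (ln m) + \<i> * of_real pi / 2"
        using Ln_times_ii[of "of_real m"] True by (simp add: Ln_of_real)
      moreover have "of_real (ln m) + \<i> * of_real pi / 2 + \<i> * of_real pi / 2 = of_real (ln \<bar>m\<bar>) +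
          (if m > 0 then \<i> * of_real (pi * sgn (x $ 0 - x' $ 0)) else 0)"
        using True 1 by (simp add: field_simps)
      ultimately show ?thesis by (simp only:)
    next
      case 2
      have "\<forall>\<^sub>F w in F. vRe (z w - z' w) $ 0 < 0"
        using order_tendstoD(2)[OF vlim[of 0], of 0] 2 by simp
      \<comment> \<open>Mirror image: the lower side of the cut is carried to a neighbourhood of
        \<open>- \<i> * m\<close>.\<close>
      then have "\<forall>\<^sub>F w in F. Ln (\<i> * W0_arg R (z w) (z' w)) - \<i> * of_real pi / 2 = Ln (W0_arg R (z w) (z' w))"
        using evs
      proof eventually_elim
        case (elim w)
        then have im: "Im (W0_arg R (z w) (z' w)) < 0" by (simp add: sgn_1_neg)
        then have "W0_arg R (z w) (z' w) \<noteq> 0" by (metis less_irrefl zero_complex.sel(2))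
        then show ?case
          using Ln_times_ii[of "W0_arg R (z w) (z' w)"] im by simp
      qed
      moreover have "((\<lambda>w. Ln (\<i> * W0_arg R (z w) (z' w)) - \<i> * of_real pi / 2) \<longlongrightarrow>
        Ln (\<i> * of_real (- m)) - \<i> * of_real pi / 2) F"
        using True by (intro tendsto_intros tendsto_Ln lim) (auto simp: complex_nonpos_Reals_iff)
      ultimately have "((\<lambda>w. Ln (W0_arg R (z w) (z' w))) \<longlongrightarrow> Ln (\<i> * of_real (- m)) - \<i> * of_real pi / 2) F"
        by (rule Lim_transform_eventually[rotated])
      moreover have "Ln (\<i> * of_real (- m)) = of_real (ln m) - \<i> * of_real pi / 2"
      proof -
        have "Ln (\<i> * (- \<i> * of_real m)) = Ln (- \<i> * of_real m) + \<i> * of_real pi / 2"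
          using Ln_times_ii[of "- \<i> * of_real m"] True by simp
        moreover have "- \<i> * complex_of_real m = \<i> * of_real (- m)" by simp
        ultimately show ?thesis using True by (simp add: Ln_of_real algebra_simps)
      qed
      moreover have "of_real (ln m) - \<i> * of_real pi / 2 - \<i> * of_real pi / 2 = of_real (ln \<bar>m\<bar>) +
          (if m > 0 then \<i> * of_real (pi * sgn (x $ 0 - x' $ 0)) else 0)"
        using True 2 by (simp add: field_simps)
      ultimately show ?thesis by (simp only:)
    qed
  qed
  then have "((\<lambda>w. W0 R (z w) (z' w)) \<longlongrightarrow> - (1 / (4 * of_real pi)) * (of_real (ln \<bar>m\<bar>) +
      (if m > 0 then \<i> * of_real (pi * sgn (x $ 0 - x' $ 0)) else 0))) F"
    unfolding W0_eq_Ln by (rule tendsto_mult_left)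
  moreover have "m > 0 \<longleftrightarrow> mink (x - x') (x - x') > 0" using R by (simp add: m_def zero_less_divide_iff)
  ultimately show ?thesis by (simp add: kern_def m_def)
qed

text \<open>The logarithmic singularity in one null coordinate; the zeros of the sine are the points
  of the light cone.\<close>

definition ell :: "real \<Rightarrow> real" where "ell s = \<bar>ln \<bar>sin (s / 2)\<bar>\<bar>"

definition null_u :: "real^2 \<Rightarrow> real^2 \<Rightarrow> real" where "null_u p p' = (p $ 1 - p' $ 1) + (p $ 0 - p' $ 0)"
definition null_v :: "real^2 \<Rightarrow> real^2 \<Rightarrow> real" where "null_v p p' = (p $ 1 - p' $ 1) - (p $ 0 - p' $ 0)"

text \<open>The difference of the cosines of the time and angle differences is a product of two
  sines, so the interval factors into its two null coordinates.\<close>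

lemma mink_chart_null:
  assumes "p \<in> strip" "p' \<in> strip"
  shows "mink (chart R p - chart R p') (chart R p - chart R p') =
    - 4 * R\<^sup>2 * sin (null_u p p' / 2) * sin (null_v p p' / 2) / (cos (p $ 0) * cos (p' $ 0))"
proof -
  have "cos (p $ 0 - p' $ 0) - cos (p $ 1 - p' $ 1) = 2 * sin (null_u p p' / 2) * sin (null_v p p' / 2)"
    unfolding cos_diff_cos null_u_def null_v_def by (simp add: algebra_simps)
  then show ?thesis
    using chart_diff_mink[of p p' R] strip_cos_pos[OF assms(1)] strip_cos_pos[OF assms(2)] by simp
qed

lemma abs_ln_le:
  fixes X s c :: real
  assumes "0 < s" "s \<le> X" "X \<le> c" "s \<le> 1" "1 \<le> c"
  shows "\<bar>ln X\<bar> \<le> \<bar>ln s\<bar> + ln c"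
proof -
  have "ln s \<le> ln X" "ln X \<le> ln c" "ln s \<le> 0" "ln c \<ge> 0" using assms by auto
  then show ?thesis by linarith
qed

lemma cosh_le_cosh2: "\<bar>b\<bar> \<le> 2 \<Longrightarrow> cosh b \<le> cosh (2::real)"
  using cosh_real_nonneg_le_iff[of "\<bar>b\<bar>" 2] by simp

text \<open>The squared modulus of \<open>sin (a + \<i> b)\<close> is
  \<open>sin^2 a + sinh^2 b\<close>. An imaginary displacement only increases it, so the undisplaced
  logarithm dominates uniformly, up to the growth \<open>cosh b\<close>.\<close>

lemma ln_norm_sin_le:
  assumes "sin a \<noteq> 0" "\<bar>b\<bar> \<le> 2"
  shows "\<bar>ln (cmod (sin (Complex a b)))\<bar> \<le> \<bar>ln \<bar>sin a\<bar>\<bar> + ln (cosh 2)" "sin (Complex a b) \<noteq> 0"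
proof -
  have 1: "\<bar>sin a\<bar> \<le> cmod (sin (Complex a b))"
    by (rule power2_le_imp_le) (simp_all add: norm_sin_sq)
  have "(cmod (sin (Complex a b)))\<^sup>2 \<le> (cosh b)\<^sup>2"
    by (simp add: norm_sin_sq cosh_square_eq) (simp add: abs_square_le_1)
  then have "cmod (sin (Complex a b)) \<le> cosh b" by (rule power2_le_imp_le) simp
  then have 2: "cmod (sin (Complex a b)) \<le> cosh 2" using cosh_le_cosh2[OF assms(2)] by simp
  show "\<bar>ln (cmod (sin (Complex a b)))\<bar> \<le> \<bar>ln \<bar>sin a\<bar>\<bar> + ln (cosh 2)"
    by (rule abs_ln_le[OF _ 1 2]) (use assms in \<open>auto simp: cosh_real_ge_1\<close>)
  show "sin (Complex a b) \<noteq> 0" using 1 assms(1) by auto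
qed

lemma ln_norm_cos_le:
  assumes "cos a \<noteq> 0" "\<bar>b\<bar> \<le> 2"
  shows "\<bar>ln (cmod (cos (Complex a b)))\<bar> \<le> \<bar>ln \<bar>cos a\<bar>\<bar> + ln (cosh 2)" "cos (Complex a b) \<noteq> 0"
proof -
  have "cos (Complex a b) = sin (Complex (pi / 2 - a) (- b))"
  proof -
    have "of_real pi / 2 - Complex a b = Complex (pi / 2 - a) (- b)" by (simp add: complex_eq_iff)
    then show ?thesis by (simp add: cos_sin_eq)
  qed
  then show "\<bar>ln (cmod (cos (Complex a b)))\<bar> \<le> \<bar>ln \<bar>cos a\<bar>\<bar> + ln (cosh 2)" "cos (Complex a b) \<noteq> 0"
    using ln_norm_sin_le[of "pi / 2 - a" "- b"] assms by (simp_all add: sin_diff)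
qed

text \<open>\<open>pi\<close> bounds the imaginary part of \<open>Ln\<close>, \<open>ln 4\<close>
  belongs to the factor \<open>4\<close> of the argument, and each of two sines and two cosines
  costs one \<open>ln (cosh 2)\<close>.\<close>

definition W0_const :: real where "W0_const = pi + ln 4 + 4 * ln (cosh 2)"

text \<open>A majorant free of the displacements, as dominated convergence requires: the argument is
  a quotient of two sines by two cosines, each estimated separately.\<close>

lemma norm_W0_le:
  fixes p p' y y' :: "real^2"
  assumes R: "R > 0" and p: "p \<in> strip" "p' \<in> strip"
    and y: "\<bar>y $ 1\<bar> < y $ 0" "y $ 0 \<le> 1" "\<bar>y' $ 1\<bar> < y' $ 0" "y' $ 0 \<le> 1"
    and uv: "sin (null_u p p' / 2) \<noteq> 0" "sin (null_v p p' / 2) \<noteq> 0"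
  shows "cmod (W0 R (chart R (displace p (- y))) (chart R (displace p' y'))) \<le>
    W0_const + ell (null_u p p') + ell (null_v p p') + \<bar>ln (cos (p $ 0))\<bar> + \<bar>ln (cos (p' $ 0))\<bar>"
proof -
  \<comment> \<open>Imaginary parts of the halved null coordinates of the displaced pair;
    displacements of size at most \<open>1\<close> keep them within \<open>2\<close>.\<close>
  define s t where "s = - (y $ 1 + y' $ 1 + y $ 0 + y' $ 0) / 2" and "t = - (y $ 1 + y' $ 1 - (y $ 0 + y' $ 0)) / 2"
  have st: "\<bar>s\<bar> \<le> 2" "\<bar>t\<bar> \<le> 2" using y by (auto simp: s_def t_def)
  define S T where "S = sin (Complex (null_u p p' / 2) s)" and "T = sin (Complex (null_v p p' / 2) t)"
  define C C' where "C = cos (Complex (p $ 0) (- y $ 0))" and "C' = cos (Complex (p' $ 0) (y' $ 0))"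
  have S: "\<bar>ln (cmod S)\<bar> \<le> ell (null_u p p') + ln (cosh 2)" "S \<noteq> 0"
    using ln_norm_sin_le[OF uv(1) st(1)] by (auto simp: S_def ell_def)
  have T: "\<bar>ln (cmod T)\<bar> \<le> ell (null_v p p') + ln (cosh 2)" "T \<noteq> 0"
    using ln_norm_sin_le[OF uv(2) st(2)] by (auto simp: T_def ell_def)
  have cp: "cos (p $ 0) > 0" "cos (p' $ 0) > 0" using strip_cos_pos p by auto
  have C: "\<bar>ln (cmod C)\<bar> \<le> \<bar>ln (cos (p $ 0))\<bar> + ln (cosh 2)" "C \<noteq> 0"
    using ln_norm_cos_le[of "p $ 0" "- y $ 0"] cp y by (auto simp: C_def)
  have C': "\<bar>ln (cmod C')\<bar> \<le> \<bar>ln (cos (p' $ 0))\<bar> + ln (cosh 2)" "C' \<noteq> 0"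
    using ln_norm_cos_le[of "p' $ 0" "y' $ 0"] cp y by (auto simp: C'_def)
  define w where "w = W0_arg R (chart R (displace p (- y))) (chart R (displace p' y'))"
  have "w = 2 * (cos (Complex (p $ 0) (- y $ 0) - Complex (p' $ 0) (y' $ 0)) - cos (Complex (p $ 1) (- y $ 1) - Complex (p' $ 1) (y' $ 1))) / (C * C')"
    using R C(2) C'(2) by (simp add: w_def W0_arg_def chart_diff_mink C_def C'_def)
  also have "cos (Complex (p $ 0) (- y $ 0) - Complex (p' $ 0) (y' $ 0)) - cos (Complex (p $ 1) (- y $ 1) - Complex (p' $ 1) (y' $ 1)) = 2 * S * T"
  proof -
    have "((Complex (p $ 0) (- y $ 0) - Complex (p' $ 0) (y' $ 0)) + (Complex (p $ 1) (- y $ 1) - Complex (p' $ 1) (y' $ 1))) / 2 = Complex (null_u p p' / 2) s"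
      "((Complex (p $ 1) (- y $ 1) - Complex (p' $ 1) (y' $ 1)) - (Complex (p $ 0) (- y $ 0) - Complex (p' $ 0) (y' $ 0))) / 2 = Complex (null_v p p' / 2) t"
      by (simp_all add: complex_eq_iff null_u_def null_v_def s_def t_def field_simps)
    then show ?thesis unfolding cos_diff_cos S_def T_def by simp
  qed
  finally have w: "w = 4 * S * T / (C * C')" by simp
  have w0: "w \<noteq> 0" using w S T C C' by simp
  have "ln (cmod w) = ln 4 + ln (cmod S) + ln (cmod T) - ln (cmod C) - ln (cmod C')"
    unfolding w using S(2) T(2) C(2) C'(2) by (simp add: norm_mult norm_divide ln_mult ln_div)
  then have "\<bar>ln (cmod w)\<bar> \<le> ln 4 + \<bar>ln (cmod S)\<bar> + \<bar>ln (cmod T)\<bar> + \<bar>ln (cmod C)\<bar> + \<bar>ln (cmod C')\<bar>"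
    using ln_ge_zero[of "4::real"] by linarith
  moreover have "cmod (Ln w) \<le> \<bar>ln (cmod w)\<bar> + pi"
  proof -
    have "\<bar>Im (Ln w)\<bar> \<le> pi" using mpi_less_Im_Ln[OF w0] Im_Ln_le_pi[OF w0] by simp
    then show ?thesis using cmod_le[of "Ln w"] w0 by simp
  qed
  moreover have "cmod (W0 R (chart R (displace p (- y))) (chart R (displace p' y'))) \<le> cmod (Ln w)"
  proof -
    have "1 / (4 * pi) \<le> 1" using pi_gt3 by (simp add: field_simps)
    then have "1 / (4 * pi) * cmod (Ln w) \<le> 1 * cmod (Ln w)" by (intro mult_right_mono) auto
    then show ?thesis by (simp add: W0_eq_Ln w_def[symmetric] norm_mult norm_divide)
  qed
  ultimately show ?thesis using S T C C' unfolding W0_const_def by linarith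
qed

section \<open>Integrability of the two-point kernel\<close>

text \<open>Up to \<open>pi / 3\<close> the mean value theorem applies with cosine at least
  \<open>1 / 2\<close>; beyond, the sine is at least \<open>1 / 2\<close> while \<open>x / 4\<close>
  stays below it. A crude constant is enough for integrability.\<close>

lemma sin_ge_quarter:
  fixes x :: real
  assumes "0 \<le> x" "x \<le> pi / 2"
  shows "x / 4 \<le> sin x"
proof (cases "x \<le> pi / 3")
  case True
  show ?thesis
  proof (cases "x = 0")
    case False
    then have "x > 0" using assms by simp
    then obtain z where z: "0 < z" "z < x" "sin x - sin 0 = (x - 0) * cos z"
      using MVT2[of 0 x sin cos] by (auto intro: DERIV_sin)
    have "cos z \<ge> cos (pi / 3)" using z True \<open>x > 0\<close> pi_gt_zero by (intro cos_monotone_0_pi_le) auto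
    then have "x * cos z \<ge> x * (1 / 2)" using \<open>x > 0\<close> by (intro mult_left_mono) (auto simp: cos_60)
    then show ?thesis using z \<open>x > 0\<close> by simp
  qed simp
next
  case False
  have "sin x \<ge> sin (pi / 6)" using False assms pi_gt_zero by (intro sin_monotone_2pi_le) auto
  then show ?thesis using assms pi_less_4 by (simp add: sin_30)
qed

lemma ell_measurable [measurable]: "ell \<in> borel_measurable borel"
  unfolding ell_def[abs_def] by measurable

lemma ell_nonneg: "ell s \<ge> 0" by (simp add: ell_def)

text \<open>Writing \<open>- ln (s / 8)\<close> as twice the logarithm of the root of
  \<open>8 / s\<close> and using \<open>ln x \<le> x\<close> trades the logarithm for an integrable
  power. The constant comes from \<open>2 * sqrt 8 \<le> 6\<close>.\<close>

lemma ell_le_powr: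
  assumes "0 \<le> s" "s \<le> pi"
  shows "ell s \<le> 6 * s powr (-1/2)"
proof (cases "s = 0")
  case True
  then show ?thesis by (simp add: ell_def)
next
  case False
  then have s: "s > 0" using assms by simp
  have lo: "s / 8 \<le> sin (s / 2)" using sin_ge_quarter[of "s / 2"] assms by simp
  then have "ell s = - ln (sin (s / 2))" using s by (simp add: ell_def)
  also have "\<dots> \<le> - ln (s / 8)" using lo s by (simp add: ln_mono)
  also have "\<dots> = 2 * ln ((8 / s) powr (1/2))" using s by (simp add: ln_powr ln_div)
  also have "\<dots> \<le> 2 * (8 / s) powr (1/2)" using ln_bound[of "(8 / s) powr (1/2)"] s by simp
  also have "(8 / s) powr (1/2) = 8 powr (1/2) * s powr (-1/2)"
    using s by (simp add: powr_divide powr_minus_divide)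
  also have "2 * (8 powr (1/2) * s powr (-1/2)) \<le> 2 * (3 * s powr (-1/2))"
  proof -
    have "8 powr (1/2) \<le> (3::real)" by (simp add: powr_half_sqrt real_le_lsqrt)
    then show ?thesis by (intro mult_left_mono mult_right_mono) auto
  qed
  finally show ?thesis by simp
qed

lemma nn_integral_ell_pi: "(\<integral>\<^sup>+s. ennreal (ell s) * indicator {-pi..pi} s \<partial>lborel) < \<infinity>"
proof -
  let ?h = "\<lambda>s. ennreal (ell s) * indicator {0..pi} s"
  have half: "(\<integral>\<^sup>+s. ?h s \<partial>lborel) < \<infinity>"
  proof -
    have "((\<lambda>s. 6 * s powr (-1/2)) has_integral 6 * (pi powr (-1/2 + 1) / (-1/2 + 1))) {0..pi}"
      by (intro has_integral_mult_right has_integral_powr_from_0) auto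
    then have "(\<integral>\<^sup>+s. ennreal (6 * s powr (-1/2)) * indicator {0..pi} s \<partial>lborel) = ennreal (6 * (pi powr (-1/2 + 1) / (-1/2 + 1)))"
      by (rule nn_integral_has_integral_lebesgue'[rotated]) simp
    moreover have "(\<integral>\<^sup>+s. ?h s \<partial>lborel) \<le> (\<integral>\<^sup>+s. ennreal (6 * s powr (-1/2)) * indicator {0..pi} s \<partial>lborel)"
      by (intro nn_integral_mono) (auto simp: indicator_def intro!: ennreal_leI ell_le_powr[simplified])
    ultimately show ?thesis by (simp add: le_less_trans[OF _ ennreal_less_top])
  qed
  have "(\<integral>\<^sup>+s. ennreal (ell s) * indicator {-pi..pi} s \<partial>lborel) \<le> (\<integral>\<^sup>+s. ?h s + ?h (- s) \<partial>lborel)"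
    by (intro nn_integral_mono) (auto simp: indicator_def ell_def)
  also have "\<dots> = (\<integral>\<^sup>+s. ?h s \<partial>lborel) + (\<integral>\<^sup>+s. ?h (- s) \<partial>lborel)"
    by (rule nn_integral_add) measurable
  also have "(\<integral>\<^sup>+s. ?h (- s) \<partial>lborel) = (\<integral>\<^sup>+s. ?h s \<partial>lborel)"
    using nn_integral_real_affine[of ?h "-1" 0] by simp
  finally show ?thesis using half by (simp add: ennreal_add_less_top le_less_trans)
qed

text \<open>For two points of \<open>chart_domain\<close> the angles differ by less than
  \<open>2 * pi\<close> and the times by less than \<open>pi\<close>, so the null coordinates stay
  in this interval.\<close>

definition ell_total :: ennreal where
  "ell_total = (\<integral>\<^sup>+s. ennreal (ell s) * indicator {- (3 * pi)..3 * pi} s \<partial>lborel)"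

lemma ell_periodic: "ell (s + 2 * pi) = ell s" "ell (s - 2 * pi) = ell s"
  by (simp_all add: ell_def add_divide_distrib diff_divide_distrib sin_diff)

lemma ell_total_finite: "ell_total < \<infinity>"
proof -
  let ?h = "\<lambda>s. ennreal (ell s) * indicator {-pi..pi} s"
  have "ell_total \<le> (\<integral>\<^sup>+s. ?h s + (?h (2 * pi + s) + ?h (- (2 * pi) + s)) \<partial>lborel)"
    unfolding ell_total_def
  proof (intro nn_integral_mono)
    fix s :: real
    have "ell (2 * pi + s) = ell s" "ell (- (2 * pi) + s) = ell s"
      using ell_periodic[of s] by (simp_all add: add.commute)
    then show "ennreal (ell s) * indicator {- (3 * pi)..3 * pi} s \<le> ?h s + (?h (2 * pi + s) + ?h (- (2 * pi) + s))"
      by (auto simp: indicator_def)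
  qed
  also have "\<dots> = (\<integral>\<^sup>+s. ?h s \<partial>lborel) + ((\<integral>\<^sup>+s. ?h (2 * pi + s) \<partial>lborel) + (\<integral>\<^sup>+s. ?h (- (2 * pi) + s) \<partial>lborel))"
    by (subst nn_integral_add; measurable)+
  also have "(\<integral>\<^sup>+s. ?h (2 * pi + s) \<partial>lborel) = (\<integral>\<^sup>+s. ?h s \<partial>lborel)"
    using nn_integral_real_affine[of ?h 1 "2 * pi"] by simp
  also have "(\<integral>\<^sup>+s. ?h (- (2 * pi) + s) \<partial>lborel) = (\<integral>\<^sup>+s. ?h s \<partial>lborel)"
    using nn_integral_real_affine[of ?h 1 "- (2 * pi)"] by simp
  finally show ?thesis using nn_integral_ell_pi by (auto simp: ennreal_add_less_top intro: le_less_trans)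
qed

lemma nn_integral_two:
  assumes [measurable]: "f \<in> borel_measurable borel"
  shows "(\<integral>\<^sup>+p. f p \<partial>(lborel :: (real^2) measure)) = (\<integral>\<^sup>+a. \<integral>\<^sup>+b. f (pt a b) \<partial>lborel \<partial>lborel)"
proof -
  have "(\<integral>\<^sup>+p. f p \<partial>(lborel :: (real^2) measure)) = (\<integral>\<^sup>+z. f (case z of (a, b) \<Rightarrow> pt a b) \<partial>(lborel \<Otimes>\<^sub>M lborel))"
    unfolding lborel_two by (subst nn_integral_distr) auto
  also have "\<dots> = (\<integral>\<^sup>+a. \<integral>\<^sup>+b. f (pt a b) \<partial>lborel \<partial>lborel)"
    by (subst lborel.nn_integral_fst[symmetric]) auto
  finally show ?thesis .
qed

text \<open>At a fixed time of \<open>p'\<close> the null coordinate is a reflected translate of the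
  angle of \<open>p'\<close>, so the inner integral is at most \<open>ell_total\<close>. The factor
  \<open>pi\<close> is the length of the time interval.\<close>

lemma null_ell_integral:
  fixes \<sigma> :: real
  assumes p: "p \<in> chart_domain" and \<sigma>: "\<bar>\<sigma>\<bar> = 1"
  shows "(\<integral>\<^sup>+p'. ennreal (ell ((p $ 1 - p' $ 1) + \<sigma> * (p $ 0 - p' $ 0))) * indicator chart_domain p' \<partial>lborel) \<le> ennreal pi * ell_total"
proof -
  have "(\<integral>\<^sup>+p'. ennreal (ell ((p $ 1 - p' $ 1) + \<sigma> * (p $ 0 - p' $ 0))) * indicator chart_domain p' \<partial>lborel)
    = (\<integral>\<^sup>+a. \<integral>\<^sup>+b. ennreal (ell ((p $ 1 - b) + \<sigma> * (p $ 0 - a))) * indicator chart_domain (pt a b) \<partial>lborel \<partial>lborel)"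
    by (subst nn_integral_two) auto
  also have "\<dots> \<le> (\<integral>\<^sup>+a. ell_total * indicator {-(pi/2)..pi/2} a \<partial>lborel)"
  proof (intro nn_integral_mono)
    fix a :: real
    show "(\<integral>\<^sup>+b. ennreal (ell ((p $ 1 - b) + \<sigma> * (p $ 0 - a))) * indicator chart_domain (pt a b) \<partial>lborel)
      \<le> ell_total * indicator {-(pi/2)..pi/2} a"
    proof (cases "\<bar>a\<bar> < pi / 2")
      case True
      let ?c = "p $ 1 + \<sigma> * (p $ 0 - a)"
      have "\<bar>\<sigma> * (p $ 0 - a)\<bar> < pi"
        using True p \<sigma> unfolding abs_mult by (auto simp: chart_domain_def abs_less_iff)
      then have c: "\<bar>?c\<bar> < 2 * pi" using p by (auto simp: chart_domain_def)
      have "(\<integral>\<^sup>+b. ennreal (ell ((p $ 1 - b) + \<sigma> * (p $ 0 - a))) * indicator chart_domain (pt a b) \<partial>lborel)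
        \<le> (\<integral>\<^sup>+b. ennreal (ell (?c + - 1 * b)) * indicator {- (3 * pi)..3 * pi} (?c + - 1 * b) \<partial>lborel)"
      proof (intro nn_integral_mono)
        fix b :: real
        have "(p $ 1 - b) + \<sigma> * (p $ 0 - a) = ?c + - 1 * b" by simp
        moreover have "pt a b \<in> chart_domain \<Longrightarrow> ?c + - 1 * b \<in> {- (3 * pi)..3 * pi}"
          using c by (auto simp: chart_domain_def)
        ultimately show "ennreal (ell ((p $ 1 - b) + \<sigma> * (p $ 0 - a))) * indicator chart_domain (pt a b) \<le>
           ennreal (ell (?c + - 1 * b)) * indicator {- (3 * pi)..3 * pi} (?c + - 1 * b)"
          by (auto simp: indicator_def diff_add_eq)
      qed
      also have "\<dots> = ell_total"
        unfolding ell_total_def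
        using nn_integral_real_affine[of "\<lambda>s. ennreal (ell s) * indicator {- (3 * pi)..3 * pi} s" "-1" ?c] by simp
      finally show ?thesis
        using True by (subst indicator_simps(1)) auto
    next
      case False
      then have "pt a b \<notin> chart_domain" for b by (auto simp: chart_domain_def)
      then show ?thesis by simp
    qed
  qed
  also have "\<dots> = ennreal pi * ell_total"
    by (subst nn_integral_cmult) (auto simp: mult.commute)
  finally show ?thesis .
qed

lemma null_u_measurable [measurable]: "(\<lambda>z. null_u (fst z) (snd z)) \<in> borel_measurable (borel \<Otimes>\<^sub>M borel)"
  unfolding null_u_def by measurable

lemma null_v_measurable [measurable]: "(\<lambda>z. null_v (fst z) (snd z)) \<in> borel_measurable (borel \<Otimes>\<^sub>M borel)"
  unfolding null_v_def by measurable

lemma null_u_eq: "null_u p p' = (p $ 1 - p' $ 1) + 1 * (p $ 0 - p' $ 0)"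
  and null_v_eq: "null_v p p' = (p $ 1 - p' $ 1) + -1 * (p $ 0 - p' $ 0)"
  by (simp_all add: null_u_def null_v_def)

text \<open>The slab indicators replace the unbounded densities by the constant \<open>K\<close>;
  what remains is an integral over the bounded \<open>chart_domain\<close>, singular only through
  \<open>ell\<close>.\<close>

lemma majorant_integrable:
  assumes R: "R > 0" and C: "C \<ge> 0"
  shows "integrable (chart_volume R \<Otimes>\<^sub>M chart_volume R) (\<lambda>(p, p').
    (C + ell (null_u p p') + ell (null_v p p')) * (indicator (slab T) (chart R p) * indicator (slab T) (chart R p')))"
proof (rule integrableI_nonneg)
  interpret M: sigma_finite_measure "chart_volume R" by (rule sigma_finite_chart_volume)
  let ?E = "\<lambda>p p'. C + ell (null_u p p') + ell (null_v p p')"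
  let ?I = "\<lambda>p. indicator (slab T) (chart R p) :: real"
  let ?D = "\<lambda>p. indicator chart_domain p :: real"
  define K where "K = R\<^sup>2 + T\<^sup>2"
  have E: "?E p p' \<ge> 0" for p p' using C ell_nonneg by simp
  show meas: "(\<lambda>(p, p'). ?E p p' * (?I p * ?I p')) \<in> borel_measurable (chart_volume R \<Otimes>\<^sub>M chart_volume R)"
    unfolding case_prod_unfold by measurable
  show "AE z in chart_volume R \<Otimes>\<^sub>M chart_volume R. 0 \<le> (case z of (p, p') \<Rightarrow> ?E p p' * (?I p * ?I p'))"
    using E by (auto simp: case_prod_unfold)
  have "(\<integral>\<^sup>+z. ennreal (case z of (p, p') \<Rightarrow> ?E p p' * (?I p * ?I p')) \<partial>(chart_volume R \<Otimes>\<^sub>M chart_volume R)) =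
    (\<integral>\<^sup>+p. \<integral>\<^sup>+p'. ennreal (?E p p' * (?I p * ?I p')) \<partial>chart_volume R \<partial>chart_volume R)"
    using meas by (subst M.nn_integral_fst[symmetric]) (auto simp: case_prod_unfold)
  also have "\<dots> = (\<integral>\<^sup>+p. ennreal (rho R p) * (\<integral>\<^sup>+p'. ennreal (rho R p') * ennreal (?E p p' * (?I p * ?I p')) \<partial>lborel) \<partial>lborel)"
  proof -
    have "(\<integral>\<^sup>+p'. ennreal (?E p p' * (?I p * ?I p')) \<partial>chart_volume R) =
      (\<integral>\<^sup>+p'. ennreal (rho R p') * ennreal (?E p p' * (?I p * ?I p')) \<partial>lborel)" for p
      unfolding chart_volume_eq null_u_def null_v_def by (subst nn_integral_density) auto
    then show ?thesis
      unfolding chart_volume_eq[of R] null_u_def null_v_def by (subst nn_integral_density) auto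
  qed
  also have "\<dots> \<le> (\<integral>\<^sup>+p. ennreal (K * K) * ((\<integral>\<^sup>+p'. ennreal (?E p p') * indicator chart_domain p' \<partial>lborel) * indicator chart_domain p) \<partial>lborel)"
  proof (intro nn_integral_mono)
    fix p :: "real^2"
    have r: "rho R q * ?I q \<le> K * ?D q" "rho R q * ?I q \<ge> 0" for q
      using rho_slab_le[OF R, of q T] rho_nonneg by (auto simp: K_def)
    have "ennreal (rho R p) * (\<integral>\<^sup>+p'. ennreal (rho R p') * ennreal (?E p p' * (?I p * ?I p')) \<partial>lborel) =
      (\<integral>\<^sup>+p'. ennreal ((rho R p * ?I p) * ((rho R p' * ?I p') * ?E p p')) \<partial>lborel)"
      unfolding null_u_def null_v_def
      by (subst nn_integral_cmult[symmetric]) (auto simp: ennreal_mult'[symmetric] rho_nonneg mult_ac intro!: nn_integral_cong)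
    also have "\<dots> \<le> (\<integral>\<^sup>+p'. ennreal ((K * ?D p) * ((K * ?D p') * ?E p p')) \<partial>lborel)"
    proof (intro nn_integral_mono ennreal_leI)
      fix p' show "(rho R p * ?I p) * ((rho R p' * ?I p') * ?E p p') \<le> (K * ?D p) * ((K * ?D p') * ?E p p')"
        by (rule mult_mono[OF r(1) mult_right_mono[OF r(1) E]]) (auto simp: K_def intro!: mult_nonneg_nonneg rho_nonneg E)
    qed
    also have "\<dots> = (\<integral>\<^sup>+p'. ennreal (K * K * ?D p) * (ennreal (?E p p') * indicator chart_domain p') \<partial>lborel)"
      using E by (intro nn_integral_cong) (auto simp: ennreal_mult'[symmetric] K_def indicator_def mult_ac)
    also have "\<dots> = ennreal (K * K * ?D p) * (\<integral>\<^sup>+p'. ennreal (?E p p') * indicator chart_domain p' \<partial>lborel)"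
      unfolding null_u_def null_v_def by (rule nn_integral_cmult) auto
    also have "\<dots> = ennreal (K * K) * ((\<integral>\<^sup>+p'. ennreal (?E p p') * indicator chart_domain p' \<partial>lborel) * indicator chart_domain p)"
      by (auto simp: indicator_def)
    finally show "ennreal (rho R p) * (\<integral>\<^sup>+p'. ennreal (rho R p') * ennreal (?E p p' * (?I p * ?I p')) \<partial>lborel) \<le>
      ennreal (K * K) * ((\<integral>\<^sup>+p'. ennreal (?E p p') * indicator chart_domain p' \<partial>lborel) * indicator chart_domain p)" .
  qed
  also have "\<dots> \<le> (\<integral>\<^sup>+p. ennreal (K * K) * ((ennreal C * emeasure lborel chart_domain + (ennreal pi * ell_total + ennreal pi * ell_total)) * indicator chart_domain p) \<partial>lborel)"
  proof (intro nn_integral_mono mult_left_mono)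
    fix p :: "real^2"
    show "(\<integral>\<^sup>+p'. ennreal (?E p p') * indicator chart_domain p' \<partial>lborel) * indicator chart_domain p \<le>
      (ennreal C * emeasure lborel chart_domain + (ennreal pi * ell_total + ennreal pi * ell_total)) * indicator chart_domain p"
    proof (cases "p \<in> chart_domain")
      case True
      have "(\<integral>\<^sup>+p'. ennreal (?E p p') * indicator chart_domain p' \<partial>lborel) =
        (\<integral>\<^sup>+p'. ennreal C * indicator chart_domain p' + (ennreal (ell ((p $ 1 - p' $ 1) + 1 * (p $ 0 - p' $ 0))) * indicator chart_domain p'
          + ennreal (ell ((p $ 1 - p' $ 1) + -1 * (p $ 0 - p' $ 0))) * indicator chart_domain p') \<partial>lborel)"
        unfolding null_u_eq null_v_eq
        using C by (intro nn_integral_cong) (auto simp: indicator_def ell_nonneg ennreal_plus[symmetric] simp del: ennreal_plus)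
      also have "\<dots> = ennreal C * emeasure lborel chart_domain +
          ((\<integral>\<^sup>+p'. ennreal (ell ((p $ 1 - p' $ 1) + 1 * (p $ 0 - p' $ 0))) * indicator chart_domain p' \<partial>lborel)
          + (\<integral>\<^sup>+p'. ennreal (ell ((p $ 1 - p' $ 1) + -1 * (p $ 0 - p' $ 0))) * indicator chart_domain p' \<partial>lborel))"
        by (subst nn_integral_add; (measurable; fail)?)+ (simp add: nn_integral_cmult)
      also have "\<dots> \<le> ennreal C * emeasure lborel chart_domain + (ennreal pi * ell_total + ennreal pi * ell_total)"
        by (intro add_mono order_refl null_ell_integral True) auto
      finally show ?thesis using True by simp
    qed simp
  qed auto
  also have "\<dots> = ennreal (K * K) * ((ennreal C * emeasure lborel chart_domain + (ennreal pi * ell_total + ennreal pi * ell_total)) * emeasure lborel chart_domain)"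
    by (simp add: nn_integral_cmult)
  also have "\<dots> < \<infinity>"
    using emeasure_chart_domain ell_total_finite by (simp add: ennreal_mult_less_top)
  finally show "(\<integral>\<^sup>+z. ennreal (case z of (p, p') \<Rightarrow> ?E p p' * (?I p * ?I p')) \<partial>(chart_volume R \<Otimes>\<^sub>M chart_volume R)) < \<infinity>" .
qed

text \<open>At each time only countably many angles lie on the null lines through \<open>p\<close>.
  For \<open>\<sigma> = 1\<close> and \<open>\<sigma> = -1\<close> this makes the light cone of
  \<open>p\<close> a null set.\<close>

lemma AE_null_sin:
  fixes \<sigma> :: real
  shows "AE p' in (lborel :: (real^2) measure). sin (((p $ 1 - p' $ 1) + \<sigma> * (p $ 0 - p' $ 0)) / 2) \<noteq> 0"
proof -
  let ?N = "{p'::real^2. sin (((p $ 1 - p' $ 1) + \<sigma> * (p $ 0 - p' $ 0)) / 2) = 0}"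
  have N: "?N \<in> sets borel" by measurable
  have "emeasure lborel ?N = (\<integral>\<^sup>+p'. indicator ?N p' \<partial>lborel)" using N by simp
  also have "\<dots> = (\<integral>\<^sup>+a. \<integral>\<^sup>+b. indicator ?N (pt a b) \<partial>lborel \<partial>lborel)"
    using N by (intro nn_integral_two) simp
  also have "\<dots> = (\<integral>\<^sup>+a. 0 \<partial>(lborel::real measure))"
  proof (intro nn_integral_cong)
    fix a :: real
    let ?B = "{b::real. pt a b \<in> ?N}"
    have "?B \<subseteq> range (\<lambda>k::int. p $ 1 + \<sigma> * (p $ 0 - a) - 2 * (of_int k * pi))"
    proof
      fix b assume "b \<in> ?B"
      then obtain k :: int where "((p $ 1 - b) + \<sigma> * (p $ 0 - a)) / 2 = of_int k * pi"
        by (auto simp: sin_zero_iff_int2)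
      then have "b = p $ 1 + \<sigma> * (p $ 0 - a) - 2 * (of_int k * pi)" by (simp add: field_simps)
      then show "b \<in> range (\<lambda>k::int. p $ 1 + \<sigma> * (p $ 0 - a) - 2 * (of_int k * pi))" by (rule range_eqI)
    qed
    then have "countable ?B" by (rule countable_subset) simp
    then have "emeasure lborel ?B = 0" by (rule emeasure_lborel_countable)
    moreover have "(\<integral>\<^sup>+b. indicator ?N (pt a b) \<partial>lborel) = (\<integral>\<^sup>+b. indicator ?B b \<partial>lborel)"
      by (intro nn_integral_cong) (simp add: indicator_def)
    moreover have "?B \<in> sets lborel" using \<open>countable ?B\<close> by (simp add: sets.countable)
    ultimately show "(\<integral>\<^sup>+b. indicator ?N (pt a b) \<partial>lborel) = 0" by simp
  qed
  finally have "?N \<in> null_sets lborel" using N by (auto simp: null_sets_def)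
  then show ?thesis by (rule AE_I') auto
qed

section \<open>The boundary value as an integral against the kernel\<close>

definition pair_volume :: "real \<Rightarrow> ((real^3) \<times> (real^3)) measure" where
  "pair_volume R = dS_volume R \<Otimes>\<^sub>M dS_volume R"

definition chart_pair :: "real \<Rightarrow> ((real^2) \<times> (real^2)) measure" where
  "chart_pair R = chart_volume R \<Otimes>\<^sub>M chart_volume R"

lemma sets_pair_volume [simp]: "sets (pair_volume R) = sets (borel \<Otimes>\<^sub>M borel)"
  unfolding pair_volume_def by (intro sets_pair_measure_cong) auto

lemma sets_chart_pair [simp]: "sets (chart_pair R) = sets (borel \<Otimes>\<^sub>M borel)"
  unfolding chart_pair_def by (intro sets_pair_measure_cong) auto

lemma measurable_pair_volume: "measurable (pair_volume R) N = measurable (borel \<Otimes>\<^sub>M borel) N"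
  by (rule measurable_cong_sets) simp_all

lemma measurable_chart_pair: "measurable (chart_pair R) N = measurable (borel \<Otimes>\<^sub>M borel) N"
  by (rule measurable_cong_sets) simp_all

lemma space_chart_pair [simp]: "space (chart_pair R) = UNIV"
  by (simp add: chart_pair_def space_pair_measure)

lemma cnj_measurable [measurable]: "cnj \<in> borel_measurable borel"
  by (intro borel_measurable_continuous_onI continuous_intros)

lemma pair_volume_distr:
  assumes "R > 0"
  shows "pair_volume R = distr (chart_pair R) (borel \<Otimes>\<^sub>M borel) (\<lambda>(p, p'). (chart R p, chart R p'))"
  unfolding pair_volume_def chart_pair_def dS_volume_def
  using sigma_finite_dS_volume[OF assms, unfolded dS_volume_def]
  by (intro pair_measure_distr) auto

lemma chart_map_measurable [measurable]:
  "(\<lambda>(p, p'). (chart R p, chart R p')) \<in> (borel :: (real^2) measure) \<Otimes>\<^sub>M (borel :: (real^2) measure) \<rightarrow>\<^sub>M borel \<Otimes>\<^sub>M borel"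
  unfolding case_prod_unfold by measurable

lemma kern_measurable [measurable]: "(\<lambda>z. kern R (fst z) (snd z)) \<in> borel_measurable (borel \<Otimes>\<^sub>M borel)"
  unfolding kern_def mink_def sgn_real_def by measurable

text \<open>\<open>pairing\<close> is a \<open>Lim\<close>, which is determined by convergence only
  along a nontrivial filter. Displacements in the time direction alone approach the origin inside
  the tubes.\<close>

lemma tube_displacements_nontrivial:
  assumes "R > 0"
  shows "at (0, 0) within tube_displacements R \<noteq> bot"
proof -
  have "(0, 0) islimpt tube_displacements R"
    unfolding islimpt_approachable
  proof (intro allI impI)
    fix e :: real assume e: "e > 0"
    let ?q = "(pt (e / 3) 0, pt (e / 3) 0) :: (real^2) \<times> (real^2)"
    have "norm (pt (e / 3) (0::real)) \<le> e / 3"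
      using norm_le_l1_cart[of "pt (e / 3) (0::real)"] e by (simp add: sum_two)
    then have "dist ?q (0, 0) < e"
      using norm_Pair_le[of "pt (e / 3) (0::real)" "pt (e / 3) (0::real)"] e by (simp add: dist_norm zero_prod_def[symmetric])
    moreover have "?q \<in> tube_displacements R" using e by (simp add: tube_displacements_eq[OF assms])
    moreover have "?q \<noteq> (0, 0)" using e by (auto simp: vec2_eq_iff)
    ultimately show "\<exists>x'\<in>tube_displacements R. x' \<noteq> (0, 0) \<and> dist x' (0, 0) < e" by blast
  qed
  then show ?thesis by (simp add: trivial_limit_within)
qed

lemma continuous_on_sin_general:
  fixes f :: "'a::topological_space \<Rightarrow> 'b::{real_normed_field,banach}"
  assumes "continuous_on S f"
  shows "continuous_on S (\<lambda>x. sin (f x))" "continuous_on S (\<lambda>x. cos (f x))"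
proof -
  have "continuous_on UNIV (sin :: 'b \<Rightarrow> 'b)" "continuous_on UNIV (cos :: 'b \<Rightarrow> 'b)"
    by (auto intro: continuous_at_imp_continuous_on isCont_sin isCont_cos)
  from continuous_on_compose2[OF this(1) assms] continuous_on_compose2[OF this(2) assms]
  show "continuous_on S (\<lambda>x. sin (f x))" "continuous_on S (\<lambda>x. cos (f x))" by auto
qed

lemma displaced_chart_continuous:
  assumes "\<bar>y $ 1\<bar> < \<bar>y $ 0\<bar>"
  shows "continuous_on UNIV (\<lambda>p. chart R (displace p y) $ i)"
proof -
  have c: "cos (Complex (p $ 0) (y $ 0)) \<noteq> 0" for p :: "real^2"
  proof -
    have "sinh (y $ 0) \<noteq> 0" using assms by simp
    then have "(cmod (cos (Complex (p $ 0) (y $ 0))))\<^sup>2 > 0" unfolding norm_cos_sq by (simp add: add_nonneg_pos)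
    then show ?thesis by auto
  qed
  have C: "continuous_on UNIV (\<lambda>p::real^2. Complex (p $ k) (y $ k))" for k
    by (intro continuous_intros)
  have "continuous_on UNIV (\<lambda>p. chart R (displace p y) $ 0)" "continuous_on UNIV (\<lambda>p. chart R (displace p y) $ 1)"
    "continuous_on UNIV (\<lambda>p. chart R (displace p y) $ 2)"
    unfolding chart_nth tan_def displace_nth
    by (intro continuous_intros continuous_on_sin_general C; use c in blast)+
  then have "\<forall>i. continuous_on UNIV (\<lambda>p. chart R (displace p y) $ i)" by (simp add: forall_three)
  then show ?thesis ..
qed

lemma continuous_on_W0_arg:
  fixes A B :: "'a::topological_space \<Rightarrow> complex^3"
  assumes "R > 0" "\<And>i. continuous_on S (\<lambda>z. A z $ i)" "\<And>i. continuous_on S (\<lambda>z. B z $ i)"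
  shows "continuous_on S (\<lambda>z. W0_arg R (A z) (B z))"
  unfolding W0_arg_def mink_def vector_minus_component
  by (intro continuous_on_minus continuous_on_divide continuous_on_diff continuous_on_mult continuous_on_const assms)
    (use assms(1) in simp)

text \<open>Measurability follows from continuity: displaced arguments never meet the branch
  cut.\<close>

lemma W0_displaced_measurable:
  assumes R: "R > 0" and y: "(y, y') \<in> tube_displacements R"
  shows "(\<lambda>z. W0 R (chart R (displace (fst z) (- y))) (chart R (displace (snd z) y'))) \<in> borel_measurable (borel \<Otimes>\<^sub>M borel)"
proof -
  have yy: "\<bar>y $ 1\<bar> < y $ 0" "\<bar>y' $ 1\<bar> < y' $ 0" using y by (auto simp: tube_displacements_eq[OF R])
  have 1: "continuous_on UNIV (\<lambda>z::(real^2) \<times> (real^2). chart R (displace (fst z) (- y)) $ i)" for i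
    by (rule continuous_on_compose2[OF displaced_chart_continuous[of "- y" R i]]) (use yy in \<open>auto intro: continuous_intros\<close>)
  have 2: "continuous_on UNIV (\<lambda>z::(real^2) \<times> (real^2). chart R (displace (snd z) y') $ i)" for i
    by (rule continuous_on_compose2[OF displaced_chart_continuous[of "y'" R i]]) (use yy in \<open>auto intro: continuous_intros\<close>)
  have "continuous_on UNIV (\<lambda>z. W0_arg R (chart R (displace (fst z) (- y))) (chart R (displace (snd z) y')))"
    by (rule continuous_on_W0_arg[OF R 1 2])
  then have "continuous_on UNIV (\<lambda>z. W0 R (chart R (displace (fst z) (- y))) (chart R (displace (snd z) y')))"
    unfolding W0_eq_Ln
    by (intro continuous_on_mult continuous_on_const continuous_on_Ln')
      (assumption, rule W0_arg_slit[OF R chart_in_tube_minus[OF R yy(1)] chart_in_tube_plus[OF R yy(2)]])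
  then show ?thesis unfolding borel_prod by (rule borel_measurable_continuous_onI)
qed

lemma AE_chart_pair:
  "AE z in chart_pair R. fst z \<in> chart_domain \<and> snd z \<in> chart_domain \<and>
     sin (null_u (fst z) (snd z) / 2) \<noteq> 0 \<and> sin (null_v (fst z) (snd z) / 2) \<noteq> 0"
proof -
  interpret M: sigma_finite_measure "chart_volume R" by (rule sigma_finite_chart_volume)
  interpret MM: pair_sigma_finite "chart_volume R" "chart_volume R" ..
  have dens: "AE p in chart_volume R. P p" if "AE p in lborel. P p" for P
    unfolding chart_volume_eq by (subst AE_density) (use that in auto)
  have "AE p in chart_volume R. AE p' in chart_volume R. p \<in> chart_domain \<and> p' \<in> chart_domain \<and>
     sin (null_u p p' / 2) \<noteq> 0 \<and> sin (null_v p p' / 2) \<noteq> 0"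
    using AE_chart_volume[of R]
  proof eventually_elim
    case (elim p)
    show ?case
      using AE_chart_volume[of R] dens[OF AE_null_sin[of p 1]] dens[OF AE_null_sin[of p "-1"]]
      unfolding null_u_eq null_v_eq by eventually_elim (use elim in blast)
  qed
  moreover have "{z \<in> space (borel \<Otimes>\<^sub>M borel). fst z \<in> chart_domain \<and> snd z \<in> chart_domain \<and>
     sin (null_u (fst z) (snd z) / 2) \<noteq> 0 \<and> sin (null_v (fst z) (snd z) / 2) \<noteq> 0} \<in> sets (borel \<Otimes>\<^sub>M borel)"
    by measurable
  then have "{z \<in> space (chart_pair R). fst z \<in> chart_domain \<and> snd z \<in> chart_domain \<and>
     sin (null_u (fst z) (snd z) / 2) \<noteq> 0 \<and> sin (null_v (fst z) (snd z) / 2) \<noteq> 0} \<in> sets (chart_pair R)"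
    by (simp add: space_pair_measure)
  ultimately show ?thesis
    unfolding chart_pair_def by (intro MM.AE_pair_measure) simp_all
qed

text \<open>Dominated convergence works along sequences, so the limit over the displacements is
  tested on sequences in \<open>tube_displacements R\<close>. Integrability of the limit integrand
  comes from the same argument, as such a sequence exists.\<close>

lemma pairing_kern_chart:
  assumes R: "R > 0" and f: "f \<in> test_fun R" and g: "g \<in> test_fun R"
  shows "integrable (chart_pair R) (\<lambda>z. kern R (chart R (fst z)) (chart R (snd z)) * cnj (f (chart R (fst z))) * g (chart R (snd z)))" (is ?A)
    and "pairing R f g = (LINT z|chart_pair R. kern R (chart R (fst z)) (chart R (snd z)) * cnj (f (chart R (fst z))) * g (chart R (snd z)))" (is ?B)
proof -
  have [measurable]: "f \<in> borel_measurable borel" "g \<in> borel_measurable borel" using f g by auto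
  obtain Cf where Cf: "Cf > 0" "\<And>x. norm (f x) \<le> Cf" using test_fun_bounded[OF f] by blast
  obtain Cg where Cg: "Cg > 0" "\<And>x. norm (g x) \<le> Cg" using test_fun_bounded[OF g] by blast
  obtain Tf where Tf: "Tf > 0" "\<And>x. f x \<noteq> 0 \<Longrightarrow> \<bar>x $ 0\<bar> \<le> Tf" using test_fun_time_bounded[OF f] by blast
  obtain Tg where Tg: "Tg > 0" "\<And>x. g x \<noteq> 0 \<Longrightarrow> \<bar>x $ 0\<bar> \<le> Tg" using test_fun_time_bounded[OF g] by blast
  define T where "T = max Tf Tg"
  \<comment> \<open>On the supports
    \<open>1 / cos^2 \<tau> = 1 + tan^2 \<tau> \<le> 1 + (T / R)^2\<close>, so \<open>K\<close>
    controls the logarithm of the cosine there.\<close>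
  define K where "K = ln (1 + (T / R)\<^sup>2)"
  have K0: "K \<ge> 0" unfolding K_def by simp
  have lnK: "\<bar>ln (cos (p $ 0))\<bar> \<le> K" if "p \<in> strip" "chart R p \<in> slab T" for p
  proof -
    have c: "cos (p $ 0) > 0" using strip_cos_pos that by blast
    have "\<bar>R * tan (p $ 0)\<bar> \<le> T" using that by (simp add: slab_def chart_nth)
    then have "\<bar>tan (p $ 0)\<bar> \<le> T / R" using R by (simp add: abs_mult field_simps)
    then have "(tan (p $ 0))\<^sup>2 \<le> (T / R)\<^sup>2" by (metis abs_ge_zero power2_abs power_mono)
    then have "(inverse (cos (p $ 0)))\<^sup>2 \<le> 1 + (T / R)\<^sup>2" using tan_sec[of "p $ 0"] c by (simp add: power_inverse)
    then have "ln ((inverse (cos (p $ 0)))\<^sup>2) \<le> K" unfolding K_def using c by (intro ln_mono) auto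
    then have "- 2 * ln (cos (p $ 0)) \<le> K" using c by (simp add: ln_realpow ln_inverse)
    moreover have "ln (cos (p $ 0)) \<le> 0" using c by simp
    ultimately show ?thesis by simp
  qed
  define \<Phi> where "\<Phi> = (\<lambda>(y, y') z. W0 R (chart R (displace (fst z) (- y))) (chart R (displace (snd z) y'))
         * cnj (f (chart R (fst z))) * g (chart R (snd z)))"
  define \<Phi>0 where "\<Phi>0 = (\<lambda>z. kern R (chart R (fst z)) (chart R (snd z)) * cnj (f (chart R (fst z))) * g (chart R (snd z)))"
  define C where "C = W0_const + 2 * K"
  have C0: "C \<ge> 0"
    using K0 pi_ge_zero ln_ge_zero[of "4::real"] ln_ge_zero[of "cosh (2::real)"] cosh_real_ge_1[of 2] unfolding C_def W0_const_def by linarith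
  define w where "w = (\<lambda>z. (Cf * Cg) * (case z of (p, p') \<Rightarrow>
    (C + ell (null_u p p') + ell (null_v p p')) * (indicator (slab T) (chart R p) * indicator (slab T) (chart R p'))))"
  have w: "integrable (chart_pair R) w"
    unfolding w_def chart_pair_def by (intro integrable_mult_right majorant_integrable R C0)
  have mP0: "\<Phi>0 \<in> borel_measurable (chart_pair R)"
  proof -
    have "(\<lambda>z. kern R (chart R (fst z)) (chart R (snd z))) \<in> borel_measurable (borel \<Otimes>\<^sub>M borel)"
      using measurable_compose[OF chart_map_measurable[of R] kern_measurable[of R]] by (simp add: case_prod_unfold)
    then show ?thesis unfolding \<Phi>0_def measurable_chart_pair by measurable
  qed
  have bound: "norm (\<Phi> (y, y') z) \<le> w z"
    if "(y, y') \<in> tube_displacements R" "y $ 0 \<le> 1" "y' $ 0 \<le> 1" "fst z \<in> chart_domain \<and> snd z \<in> chart_domain \<and>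
     sin (null_u (fst z) (snd z) / 2) \<noteq> 0 \<and> sin (null_v (fst z) (snd z) / 2) \<noteq> 0" for y y' z
  proof (cases "f (chart R (fst z)) = 0 \<or> g (chart R (snd z)) = 0")
    case True
    then have "\<Phi> (y, y') z = 0" by (auto simp: \<Phi>_def)
    moreover have "w z \<ge> 0" using Cf(1) Cg(1) C0 ell_nonneg by (auto simp: w_def case_prod_unfold intro!: mult_nonneg_nonneg add_nonneg_nonneg)
    ultimately show ?thesis by simp
  next
    case False
    then have sl: "chart R (fst z) \<in> slab T" "chart R (snd z) \<in> slab T"
      using Tf(2)[of "chart R (fst z)"] Tg(2)[of "chart R (snd z)"] by (auto simp: slab_def T_def)
    have st: "fst z \<in> strip" "snd z \<in> strip" using that chart_domain_subset_strip by auto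
    have "cmod (W0 R (chart R (displace (fst z) (- y))) (chart R (displace (snd z) y'))) \<le>
      W0_const + ell (null_u (fst z) (snd z)) + ell (null_v (fst z) (snd z)) + \<bar>ln (cos (fst z $ 0))\<bar> + \<bar>ln (cos (snd z $ 0))\<bar>"
      using that by (intro norm_W0_le R st) (auto simp: tube_displacements_eq[OF R])
    also have "\<dots> \<le> C + ell (null_u (fst z) (snd z)) + ell (null_v (fst z) (snd z))"
      using lnK[OF st(1) sl(1)] lnK[OF st(2) sl(2)] by (simp add: C_def)
    finally have 1: "cmod (W0 R (chart R (displace (fst z) (- y))) (chart R (displace (snd z) y'))) \<le>
      C + ell (null_u (fst z) (snd z)) + ell (null_v (fst z) (snd z))" .
    have "norm (\<Phi> (y, y') z) = cmod (W0 R (chart R (displace (fst z) (- y))) (chart R (displace (snd z) y'))) * (cmod (f (chart R (fst z))) * cmod (g (chart R (snd z))))"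
      by (simp add: \<Phi>_def norm_mult)
    also have "\<dots> \<le> (C + ell (null_u (fst z) (snd z)) + ell (null_v (fst z) (snd z))) * (Cf * Cg)"
      using 1 Cf Cg C0 ell_nonneg by (intro mult_mono) (auto intro!: add_nonneg_nonneg)
    also have "\<dots> = w z" using sl by (simp add: w_def case_prod_unfold mult.commute)
    finally show ?thesis .
  qed
  have seq: "integrable (chart_pair R) \<Phi>0 \<and> (\<lambda>n. LINT z|chart_pair R. \<Phi> (X n) z) \<longlonglongrightarrow> (LINT z|chart_pair R. \<Phi>0 z)"
    if X: "\<And>n. X n \<in> tube_displacements R" "X \<longlonglongrightarrow> (0, 0)" for X
  proof -
    have X1: "(\<lambda>n. fst (X n) $ k) \<longlonglongrightarrow> 0" "(\<lambda>n. snd (X n) $ k) \<longlonglongrightarrow> 0" for k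
      using tendsto_vec_nth[OF tendsto_fst[OF X(2)], of k] tendsto_vec_nth[OF tendsto_snd[OF X(2)], of k] by simp_all
    \<comment> \<open>The majorant needs displacements of size at most \<open>1\<close>, which holds
      only eventually; hence the offset \<open>N\<close> in what follows.\<close>
    have "\<forall>\<^sub>F n in sequentially. fst (X n) $ 0 < 1 \<and> snd (X n) $ 0 < 1"
      using order_tendstoD(2)[OF X1(1), of 1 0] order_tendstoD(2)[OF X1(2), of 1 0] by (simp add: eventually_conj)
    then obtain N where N: "\<And>n. n \<ge> N \<Longrightarrow> fst (X n) $ 0 < 1 \<and> snd (X n) $ 0 < 1"
      unfolding eventually_sequentially by blast
    have meas: "\<Phi> (X n) \<in> borel_measurable (chart_pair R)" for n
    proof -
      have "(\<lambda>z. W0 R (chart R (displace (fst z) (- fst (X n)))) (chart R (displace (snd z) (snd (X n))))) \<in> borel_measurable (borel \<Otimes>\<^sub>M borel)"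
        by (rule W0_displaced_measurable[OF R]) (use X(1)[of n] in simp)
      then show ?thesis unfolding \<Phi>_def case_prod_unfold measurable_chart_pair by measurable
    qed
    have lim: "AE z in chart_pair R. (\<lambda>n. \<Phi> (X (n + N)) z) \<longlonglongrightarrow> \<Phi>0 z"
      using AE_chart_pair[of R]
    proof eventually_elim
      case (elim z)
      have st: "fst z \<in> strip" "snd z \<in> strip" using elim chart_domain_subset_strip by auto
      have yy: "\<bar>fst (X n) $ 1\<bar> < fst (X n) $ 0" "\<bar>snd (X n) $ 1\<bar> < snd (X n) $ 0" for n
        using X(1)[of n] by (auto simp: tube_displacements_eq[OF R])
      have D: "(\<lambda>n. displace (fst z) (- fst (X n)) $ k) \<longlonglongrightarrow> of_real (fst z $ k)"
        "(\<lambda>n. displace (snd z) (snd (X n)) $ k) \<longlonglongrightarrow> of_real (snd z $ k)" for k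
        using tendsto_Complex[OF tendsto_const[of "fst z $ k"] tendsto_minus[OF X1(1)[of k]]]
          tendsto_Complex[OF tendsto_const[of "snd z $ k"] X1(2)[of k]]
        by (simp_all add: complex_of_real_def)
      have "(\<lambda>n. W0 R (chart R (displace (fst z) (- fst (X n)))) (chart R (displace (snd z) (snd (X n))))) \<longlonglongrightarrow> kern R (chart R (fst z)) (chart R (snd z))"
      proof (rule W0_tendsto[OF R])
        show "mink (chart R (fst z) - chart R (snd z)) (chart R (fst z) - chart R (snd z)) \<noteq> 0"
          using mink_chart_null[OF st, of R] elim strip_cos_pos[OF st(1)] strip_cos_pos[OF st(2)] R by simp
        show "(\<lambda>n. chart R (displace (fst z) (- fst (X n))) $ i) \<longlonglongrightarrow> of_real (chart R (fst z) $ i)" for i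
          by (rule chart_tendsto_real[OF D(1) st(1)])
        show "(\<lambda>n. chart R (displace (snd z) (snd (X n))) $ i) \<longlonglongrightarrow> of_real (chart R (snd z) $ i)" for i
          by (rule chart_tendsto_real[OF D(2) st(2)])
        show "\<forall>\<^sub>F n in sequentially. chart R (displace (fst z) (- fst (X n))) \<in> tube_minus R \<and> chart R (displace (snd z) (snd (X n))) \<in> tube_plus R"
          using chart_in_tube_minus[OF R yy(1)] chart_in_tube_plus[OF R yy(2)] by simp
      qed
      then have "(\<lambda>n. \<Phi> (X n) z) \<longlonglongrightarrow> \<Phi>0 z"
        unfolding \<Phi>_def \<Phi>0_def case_prod_unfold by (intro tendsto_mult tendsto_const)
      then show ?case by (rule LIMSEQ_ignore_initial_segment)
    qed
    have bd: "AE z in chart_pair R. norm (\<Phi> (X (n + N)) z) \<le> w z" for n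
      using AE_chart_pair[of R]
    proof eventually_elim
      case (elim z)
      then show ?case
        using bound[of "fst (X (n + N))" "snd (X (n + N))" z] X(1)[of "n + N"] N[of "n + N"] by simp
    qed
    have "integrable (chart_pair R) \<Phi>0"
      by (rule integrable_dominated_convergence[OF mP0 meas w lim bd])
    moreover have "(\<lambda>n. LINT z|chart_pair R. \<Phi> (X (n + N)) z) \<longlonglongrightarrow> (LINT z|chart_pair R. \<Phi>0 z)"
      by (rule integral_dominated_convergence[OF mP0 meas w lim bd])
    then have "(\<lambda>n. LINT z|chart_pair R. \<Phi> (X n) z) \<longlonglongrightarrow> (LINT z|chart_pair R. \<Phi>0 z)"
      by (rule LIMSEQ_offset)
    ultimately show ?thesis by blast
  qed
  have nt: "at (0, 0) within tube_displacements R \<noteq> bot" by (rule tube_displacements_nontrivial[OF R])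
  then have "(0, 0) islimpt tube_displacements R" by (simp add: trivial_limit_within)
  then obtain X where "\<And>n. X n \<in> tube_displacements R" "X \<longlonglongrightarrow> (0, 0)"
    unfolding islimpt_sequential by blast
  then show ?A using seq unfolding \<Phi>0_def by blast
  have "((\<lambda>y. LINT z|chart_pair R. \<Phi> y z) \<longlongrightarrow> (LINT z|chart_pair R. \<Phi>0 z)) (at (0, 0) within tube_displacements R)"
    unfolding tendsto_at_iff_sequentially o_def using seq by blast
  moreover have "(\<lambda>(y, y'). LINT (p, p')|(chart_volume R \<Otimes>\<^sub>M chart_volume R).
       W0 R (chart R (displace p (- y))) (chart R (displace p' y')) * cnj (f (chart R p)) * g (chart R p')) =
     (\<lambda>y. LINT z|chart_pair R. \<Phi> y z)"
    by (simp add: \<Phi>_def chart_pair_def case_prod_unfold)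
  ultimately have "pairing R f g = (LINT z|chart_pair R. \<Phi>0 z)"
    unfolding pairing_def using tendsto_Lim[OF nt] by simp
  then show ?B by (simp add: \<Phi>0_def)
qed

text \<open>Pushing forward along the chart removes it from the formula; in this form the action of
  the group becomes visible.\<close>

lemma
  assumes R: "R > 0" and f: "f \<in> test_fun R" and g: "g \<in> test_fun R"
  shows pairing_integrable: "integrable (pair_volume R) (\<lambda>z. kern R (fst z) (snd z) * cnj (f (fst z)) * g (snd z))"
    and pairing_kern: "pairing R f g = (LINT z|pair_volume R. kern R (fst z) (snd z) * cnj (f (fst z)) * g (snd z))"
proof -
  have [measurable]: "f \<in> borel_measurable borel" "g \<in> borel_measurable borel" using f g by auto
  have m: "(\<lambda>z. kern R (fst z) (snd z) * cnj (f (fst z)) * g (snd z)) \<in> borel_measurable (borel \<Otimes>\<^sub>M borel)"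
    by measurable
  have c: "(\<lambda>(p, p'). (chart R p, chart R p')) \<in> chart_pair R \<rightarrow>\<^sub>M borel \<Otimes>\<^sub>M borel"
    unfolding measurable_chart_pair by measurable
  show "integrable (pair_volume R) (\<lambda>z. kern R (fst z) (snd z) * cnj (f (fst z)) * g (snd z))"
    unfolding pair_volume_distr[OF R] integrable_distr_eq[OF c m]
    using pairing_kern_chart(1)[OF R f g] by (simp add: case_prod_unfold)
  show "pairing R f g = (LINT z|pair_volume R. kern R (fst z) (snd z) * cnj (f (fst z)) * g (snd z))"
    unfolding pair_volume_distr[OF R] integral_distr[OF c m]
    using pairing_kern_chart(2)[OF R f g] by (simp add: case_prod_unfold)
qed

section \<open>Properties of the pairing\<close>

text \<open>Exchanging the points keeps the interval but reverses the time order, hence the sign of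
  the phase. This gives the hermitian symmetry of the pairing.\<close>

lemma kern_cnj: "cnj (kern R x x') = kern R x' x"
proof -
  have "mink (x' - x) (x' - x) = mink (x - x') (x - x')" by (simp add: mink_def algebra_simps)
  moreover have "sgn (x' $ 0 - x $ 0) = - sgn (x $ 0 - x' $ 0)" by (simp add: sgn_if)
  ultimately show ?thesis by (simp add: kern_def)
qed

text \<open>Only the interval and, for timelike pairs, the time order enter; the latter is preserved
  by \<open>SO_sgn_time\<close>.\<close>

lemma kern_invariant:
  assumes "g \<in> SO0_1_2"
  shows "kern R (g *v x) (g *v x') = kern R x x'"
proof -
  have d: "g *v x - g *v x' = g *v (x - x')" by (simp add: matrix_vector_mult_diff_distrib)
  have "sgn ((g *v x) $ 0 - (g *v x') $ 0) = sgn (x $ 0 - x' $ 0)" if "mink (x - x') (x - x') > 0"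
    using SO_sgn_time[OF assms that] d by (metis vector_minus_component)
  then show ?thesis unfolding kern_def d SO_mink[OF assms] by simp
qed

lemma pairing_add_right:
  assumes "R > 0" "f \<in> test_fun R" "g \<in> test_fun R" "k \<in> test_fun R"
  shows "pairing R f (\<lambda>x. g x + k x) = pairing R f g + pairing R f k"
  using assms by (simp add: pairing_kern test_fun_add distrib_left pairing_integrable)

lemma pairing_scale_right:
  assumes "R > 0" "f \<in> test_fun R" "g \<in> test_fun R"
  shows "pairing R f (\<lambda>x. c * g x) = c * pairing R f g"
proof -
  have "pairing R f (\<lambda>x. c * g x) = (LINT z|pair_volume R. c * (kern R (fst z) (snd z) * cnj (f (fst z)) * g (snd z)))"
    using assms by (simp add: pairing_kern test_fun_scale mult_ac)
  then show ?thesis using assms by (simp add: pairing_kern)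
qed

lemma pairing_cnj:
  assumes R: "R > 0" and f: "f \<in> test_fun R" and g: "g \<in> test_fun R"
  shows "pairing R g f = cnj (pairing R f g)"
proof -
  interpret M: sigma_finite_measure "dS_volume R" by (rule sigma_finite_dS_volume[OF R])
  interpret MM: pair_sigma_finite "dS_volume R" "dS_volume R" ..
  have "cnj (pairing R f g) = (LINT z|pair_volume R. cnj (kern R (fst z) (snd z) * cnj (f (fst z)) * g (snd z)))"
    unfolding pairing_kern[OF assms] by (simp only: Bochner_Integration.integral_cnj)
  also have "\<dots> = (LINT z|pair_volume R. (case z of (x, y) \<Rightarrow> kern R y x * cnj (g y) * f x))"
    by (simp add: kern_cnj case_prod_unfold mult_ac)
  also have "\<dots> = (LINT (x, y)|pair_volume R. (\<lambda>z. kern R (fst z) (snd z) * cnj (g (fst z)) * f (snd z)) (y, x))"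
    by simp
  also have "\<dots> = (LINT z|pair_volume R. kern R (fst z) (snd z) * cnj (g (fst z)) * f (snd z))"
    unfolding pair_volume_def
    using pairing_integrable[OF R g f] unfolding pair_volume_def
    by (intro MM.integral_product_swap) (rule borel_measurable_integrable)
  finally show ?thesis unfolding pairing_kern[OF R g f] by simp
qed

lemma pairing_scale_left:
  assumes "R > 0" "f \<in> test_fun R" "g \<in> test_fun R"
  shows "pairing R (\<lambda>x. c * g x) f = cnj c * pairing R g f"
  using assms pairing_scale_right[OF assms] by (simp add: pairing_cnj[of R f] test_fun_scale)

lemma pair_volume_invariant:
  assumes R: "R > 0" and g: "g \<in> SO0_1_2"
  shows "distr (pair_volume R) (borel \<Otimes>\<^sub>M borel) (\<lambda>(x, y). (g *v x, g *v y)) = pair_volume R"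
proof -
  have "dS_volume R \<Otimes>\<^sub>M dS_volume R = distr (dS_volume R) borel ((*v) g) \<Otimes>\<^sub>M distr (dS_volume R) borel ((*v) g)"
    by (simp add: dS_volume_invariant[OF R g])
  also have "\<dots> = distr (pair_volume R) (borel \<Otimes>\<^sub>M borel) (\<lambda>(x, y). (g *v x, g *v y))"
    unfolding pair_volume_def
    by (rule pair_measure_distr) (simp_all add: dS_volume_invariant[OF R g] sigma_finite_dS_volume[OF R])
  finally show ?thesis by (simp add: pair_volume_def)
qed

lemma pairing_dS_act:
  assumes R: "R > 0" and g: "g \<in> SO0_1_2" and f: "f \<in> test_fun R" "k \<in> test_fun R"
  shows "pairing R (dS_act g f) (dS_act g k) = pairing R f k"
proof -
  let ?A = "matrix_inv g"
  have A: "?A \<in> SO0_1_2" by (rule SO_matrix_inv[OF g])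
  have [measurable]: "f \<in> borel_measurable borel" "k \<in> borel_measurable borel" using f by auto
  have c: "(\<lambda>(x, y). (?A *v x, ?A *v y)) \<in> pair_volume R \<rightarrow>\<^sub>M borel \<Otimes>\<^sub>M borel"
    unfolding measurable_pair_volume by measurable
  have m: "(\<lambda>z. kern R (fst z) (snd z) * cnj (f (fst z)) * k (snd z)) \<in> borel_measurable (borel \<Otimes>\<^sub>M borel)"
    by measurable
  have "pairing R f k = (LINT z|distr (pair_volume R) (borel \<Otimes>\<^sub>M borel) (\<lambda>(x, y). (?A *v x, ?A *v y)). kern R (fst z) (snd z) * cnj (f (fst z)) * k (snd z))"
    using pairing_kern[OF R f] by (simp add: pair_volume_invariant[OF R A])
  also have "\<dots> = (LINT z|pair_volume R. kern R (?A *v fst z) (?A *v snd z) * cnj (f (?A *v fst z)) * k (?A *v snd z))"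
    unfolding integral_distr[OF c m] by (simp add: case_prod_unfold)
  also have "\<dots> = pairing R (dS_act g f) (dS_act g k)"
    unfolding pairing_kern[OF R test_fun_dS_act[OF g f(1)] test_fun_dS_act[OF g f(2)]]
    by (simp add: kern_invariant[OF A] dS_act_def)
  finally show ?thesis by simp
qed

lemma test_fun_integrable:
  assumes R: "R > 0" and f: "f \<in> test_fun R"
  shows "integrable (dS_volume R) f"
proof -
  obtain C where C: "C > 0" "\<And>x. norm (f x) \<le> C" using test_fun_bounded[OF f] by blast
  obtain T where T: "T > 0" "\<And>x. f x \<noteq> 0 \<Longrightarrow> \<bar>x $ 0\<bar> \<le> T" using test_fun_time_bounded[OF f] by blast
  have [measurable]: "f \<in> borel_measurable borel" using f by simp
  have "integrable (dS_volume R) (\<lambda>x. C * indicator (slab T) x :: real)"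
    using emeasure_slab[OF R, of T] by (intro integrable_mult_right integrable_real_indicator) auto
  then show ?thesis
  proof (rule Bochner_Integration.integrable_bound)
    show "AE x in dS_volume R. norm (f x) \<le> norm (C * indicator (slab T) x :: real)"
      using C T by (intro AE_I2) (auto simp: slab_def indicator_def)
  qed measurable
qed

lemma integ_add:
  assumes "R > 0" "f \<in> test_fun R" "g \<in> test_fun R"
  shows "integ R (\<lambda>x. f x + g x) = integ R f + integ R g"
  unfolding integ_def using assms by (intro Bochner_Integration.integral_add test_fun_integrable)

lemma integ_scale: "integ R (\<lambda>x. c * f x) = c * integ R f"
  unfolding integ_def by simp

lemma integ_cnj: "integ R (\<lambda>x. cnj (f x)) = cnj (integ R f)"
  unfolding integ_def by (simp only: Bochner_Integration.integral_cnj)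

lemma integ_dS_act:
  assumes R: "R > 0" and g: "g \<in> SO0_1_2" and f: "f \<in> test_fun R"
  shows "integ R (dS_act g f) = integ R f"
proof -
  have [measurable]: "f \<in> borel_measurable borel" using f by simp
  have "integ R f = (LINT x|distr (dS_volume R) borel (\<lambda>x. matrix_inv g *v x). f x)"
    by (simp add: integ_def dS_volume_invariant[OF R SO_matrix_inv[OF g]])
  also have "\<dots> = integ R (dS_act g f)"
    unfolding integ_def by (subst integral_distr) (auto simp: dS_act_def[abs_def])
  finally show ?thesis by simp
qed

section \<open>Integration along null lines\<close>

text \<open>The circle is modelled by Lebesgue measure on one period; functions on it are periodic
  functions on the line.\<close>

definition circ :: "real measure" where
  "circ = density lborel (indicator {-pi<..pi})"

definition time_measure :: "real \<Rightarrow> real measure" where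
  "time_measure c = density lborel (indicator {-c..c})"

definition periodic :: "(real \<Rightarrow> 'a) \<Rightarrow> bool" where
  "periodic G \<longleftrightarrow> (\<forall>s. G (s + 2 * pi) = G s)"

text \<open>The representative modulo \<open>2 * pi\<close> in the half-open period carried by
  \<open>circ\<close>. The ceiling is used, not the floor, because that interval is closed on the
  right.\<close>

definition wrap :: "real \<Rightarrow> real" where
  "wrap s = s - 2 * pi * of_int \<lceil>(s - pi) / (2 * pi)\<rceil>"

lemma periodic_nat: "periodic G \<Longrightarrow> G (s + 2 * pi * real n) = G s"
proof (induction n)
  case (Suc n)
  have "G (s + 2 * pi * real (Suc n)) = G ((s + 2 * pi * real n) + 2 * pi)" by (simp add: algebra_simps)
  then show ?case using Suc unfolding periodic_def by metis
qed simp

lemma periodic_int: "periodic G \<Longrightarrow> G (s + 2 * pi * of_int k) = G s"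
proof (cases "k \<ge> 0")
  case True
  then show "periodic G \<Longrightarrow> ?thesis" using periodic_nat[of G s "nat k"] by simp
next
  case False
  then show "periodic G \<Longrightarrow> ?thesis" using periodic_nat[of G "s + 2 * pi * of_int k" "nat (- k)"] by (simp add: algebra_simps)
qed

lemma periodic_wrap: "periodic G \<Longrightarrow> G (wrap s) = G s"
  using periodic_int[of G s "- \<lceil>(s - pi) / (2 * pi)\<rceil>"] by (simp add: wrap_def)

lemma wrap_measurable [measurable]: "wrap \<in> borel_measurable borel"
  unfolding wrap_def[abs_def] by measurable

lemma wrap_in: "wrap s \<in> {-pi<..pi}"
proof -
  define k where "k = \<lceil>(s - pi) / (2 * pi)\<rceil>"
  have "(s - pi) / (2 * pi) \<le> of_int k" "of_int k - 1 < (s - pi) / (2 * pi)"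
    unfolding k_def using ceiling_correct[of "(s - pi) / (2 * pi)"] by simp_all
  then have "s - pi \<le> of_int k * (2 * pi)" "(of_int k - 1) * (2 * pi) < s - pi"
    by (simp_all add: pos_divide_le_eq pos_less_divide_eq)
  then show ?thesis unfolding wrap_def k_def[symmetric] by (simp add: algebra_simps)
qed

lemma wrap_id: "s \<in> {-pi<..pi} \<Longrightarrow> wrap s = s"
proof -
  assume s: "s \<in> {-pi<..pi}"
  have "\<lceil>(s - pi) / (2 * pi)\<rceil> = 0"
    using s by (intro ceiling_unique) (auto simp: field_simps)
  then show ?thesis by (simp add: wrap_def)
qed

lemma periodic_comp_wrap: "periodic (\<lambda>s. G (wrap s))"
proof -
  have "wrap (s + 2 * pi) = wrap s" for s
  proof -
    have "(s + 2 * pi - pi) / (2 * pi) = (s - pi) / (2 * pi) + 1" by (simp add: field_simps)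
    then have "\<lceil>(s + 2 * pi - pi) / (2 * pi)\<rceil> = \<lceil>(s - pi) / (2 * pi)\<rceil> + 1" by (simp only: ceiling_add_one)
    then show ?thesis unfolding wrap_def by (simp only: of_int_add of_int_1) (simp add: distrib_left)
  qed
  then show ?thesis by (simp add: periodic_def)
qed

lemma sets_circ [simp, measurable_cong]: "sets circ = sets borel" by (simp add: circ_def)
lemma sets_time_measure [simp, measurable_cong]: "sets (time_measure c) = sets borel" by (simp add: time_measure_def)
lemma space_circ [simp]: "space circ = UNIV" by (simp add: circ_def)
lemma space_time_measure [simp]: "space (time_measure c) = UNIV" by (simp add: time_measure_def)

lemma nn_integral_circ: "f \<in> borel_measurable borel \<Longrightarrow> (\<integral>\<^sup>+s. f s \<partial>circ) = (\<integral>\<^sup>+s. f s * indicator {-pi<..pi} s \<partial>lborel)"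
  unfolding circ_def by (subst nn_integral_density) (auto simp: mult.commute)

lemma finite_circ: "finite_measure circ"
  by (rule finite_measureI) (simp add: circ_def emeasure_density)

lemma finite_time_measure: "finite_measure (time_measure c)"
  by (rule finite_measureI) (simp add: time_measure_def emeasure_density emeasure_lborel_Icc_eq)

text \<open>Cut and paste: the part of the shifted period beyond \<open>pi\<close> is moved back by
  one period and fills the gap at the other end.\<close>

lemma nn_integral_circ_shift_aux:
  assumes [measurable]: "G \<in> borel_measurable borel" and G: "periodic G" and t: "0 \<le> t" "t \<le> 2 * pi"
  shows "(\<integral>\<^sup>+s. G (s + t) \<partial>circ) = (\<integral>\<^sup>+s. G s \<partial>circ)"
proof -
  have "(\<integral>\<^sup>+s. G (s + t) \<partial>circ) = (\<integral>\<^sup>+s. G (t + 1 * s) * indicator {-pi+t<..pi+t} (t + 1 * s) \<partial>lborel)"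
    by (subst nn_integral_circ) (auto simp: add.commute indicator_def intro!: nn_integral_cong)
  also have "\<dots> = (\<integral>\<^sup>+s. G s * indicator {-pi+t<..pi+t} s \<partial>lborel)"
    using nn_integral_real_affine[of "\<lambda>s. G s * indicator {-pi+t<..pi+t} s" 1 t] by simp
  also have "\<dots> = (\<integral>\<^sup>+s. G s * indicator {-pi+t<..pi} s + G s * indicator {pi<..pi+t} s \<partial>lborel)"
    using t by (intro nn_integral_cong) (auto simp: indicator_def)
  also have "\<dots> = (\<integral>\<^sup>+s. G s * indicator {-pi+t<..pi} s \<partial>lborel) + (\<integral>\<^sup>+s. G s * indicator {pi<..pi+t} s \<partial>lborel)"
    by (rule nn_integral_add) measurable
  also have "(\<integral>\<^sup>+s. G s * indicator {pi<..pi+t} s \<partial>lborel) = (\<integral>\<^sup>+s. G (2 * pi + 1 * s) * indicator {pi<..pi+t} (2 * pi + 1 * s) \<partial>lborel)"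
    using nn_integral_real_affine[of "\<lambda>s. G s * indicator {pi<..pi+t} s" 1 "2 * pi"] by simp
  also have "\<dots> = (\<integral>\<^sup>+s. G s * indicator {-pi<..-pi+t} s \<partial>lborel)"
    using G by (intro nn_integral_cong) (auto simp: periodic_def indicator_def add.commute)
  also have "(\<integral>\<^sup>+s. G s * indicator {-pi+t<..pi} s \<partial>lborel) + \<dots> =
    (\<integral>\<^sup>+s. G s * indicator {-pi+t<..pi} s + G s * indicator {-pi<..-pi+t} s \<partial>lborel)"
    by (rule nn_integral_add[symmetric]) measurable
  also have "\<dots> = (\<integral>\<^sup>+s. G s * indicator {-pi<..pi} s \<partial>lborel)"
    using t by (intro nn_integral_cong) (auto simp: indicator_def)
  finally show ?thesis by (simp add: nn_integral_circ)
qed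

lemma nn_integral_circ_shift:
  assumes [measurable]: "G \<in> borel_measurable borel" and G: "periodic G"
  shows "(\<integral>\<^sup>+s. G (s + t) \<partial>circ) = (\<integral>\<^sup>+s. G s \<partial>circ)"
proof -
  \<comment> \<open>An arbitrary shift is reduced to the range \<open>0\<close> to
    \<open>2 * pi\<close>: modulo the period, \<open>t\<close> agrees with
    \<open>r - pi\<close>.\<close>
  define r where "r = wrap t + pi"
  have r: "0 \<le> r" "r \<le> 2 * pi" using wrap_in[of t] by (auto simp: r_def)
  have p: "periodic (\<lambda>s. G (s - pi))" 
  proof (unfold periodic_def, intro allI)
    show "G (s + 2 * pi - pi) = G (s - pi)" for s
      using G[unfolded periodic_def, rule_format, of "s - pi"] by (simp only: diff_add_eq)
  qed
  have "G (s + t) = G (s + r - pi)" for s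
  proof -
    have "periodic (\<lambda>t. G (s + t))" using G by (simp add: periodic_def add.assoc[symmetric])
    from periodic_wrap[OF this, of t] show ?thesis by (simp add: r_def)
  qed
  then have "(\<integral>\<^sup>+s. G (s + t) \<partial>circ) = (\<integral>\<^sup>+s. G (s - pi) \<partial>circ)"
    using nn_integral_circ_shift_aux[OF _ p r] by simp
  also have "\<dots> = (\<integral>\<^sup>+s. G s \<partial>circ)"
    using nn_integral_circ_shift_aux[OF _ p, of pi] by simp
  finally show ?thesis .
qed

section \<open>Integration on the cylinder and null shears\<close>

definition cyl :: "real \<Rightarrow> (real \<times> real) measure" where
  "cyl c = time_measure c \<Otimes>\<^sub>M circ"

lemma sets_cyl [simp]: "sets (cyl c) = sets (borel \<Otimes>\<^sub>M borel)"
  unfolding cyl_def by (intro sets_pair_measure_cong) auto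

lemma measurable_cyl: "measurable (cyl c) N = measurable (borel \<Otimes>\<^sub>M borel) N"
  by (rule measurable_cong_sets) simp_all

lemma space_cyl [simp]: "space (cyl c) = UNIV"
  by (simp add: cyl_def space_pair_measure)

lemma shear_measurable:
  "(\<lambda>z. (fst z, wrap (snd z - \<sigma> * fst z))) \<in> borel \<Otimes>\<^sub>M borel \<rightarrow>\<^sub>M borel \<Otimes>\<^sub>M borel"
  by measurable

text \<open>At each fixed time the shear is a rotation of the circle, and rotations preserve
  \<open>circ\<close>. The shear straightens the null lines: a function of
  \<open>\<theta> + \<sigma> \<tau>\<close> becomes a function of the angle.\<close>

lemma cyl_shear: "distr (cyl c) (borel \<Otimes>\<^sub>M borel) (\<lambda>z. (fst z, wrap (snd z - \<sigma> * fst z))) = cyl c"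
proof (rule measure_eqI)
  interpret C: finite_measure circ by (rule finite_circ)
  fix A assume "A \<in> sets (distr (cyl c) (borel \<Otimes>\<^sub>M borel) (\<lambda>z. (fst z, wrap (snd z - \<sigma> * fst z))))"
  then have A [measurable]: "A \<in> sets (borel \<Otimes>\<^sub>M borel)" by simp
  have "emeasure (distr (cyl c) (borel \<Otimes>\<^sub>M borel) (\<lambda>z. (fst z, wrap (snd z - \<sigma> * fst z)))) A =
     (\<integral>\<^sup>+z. indicator A z \<partial>distr (cyl c) (borel \<Otimes>\<^sub>M borel) (\<lambda>z. (fst z, wrap (snd z - \<sigma> * fst z))))"
    by simp
  also have "\<dots> = (\<integral>\<^sup>+z. indicator A (fst z, wrap (snd z - \<sigma> * fst z)) \<partial>cyl c)"
    by (rule nn_integral_distr) (simp_all add: measurable_cyl shear_measurable)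
  also have "\<dots> = (\<integral>\<^sup>+t. \<integral>\<^sup>+s. indicator A (t, wrap (s - \<sigma> * t)) \<partial>circ \<partial>time_measure c)"
    unfolding cyl_def by (subst C.nn_integral_fst[symmetric]) auto
  also have "\<dots> = (\<integral>\<^sup>+t. \<integral>\<^sup>+s. indicator A (t, s) \<partial>circ \<partial>time_measure c)"
  proof (rule nn_integral_cong)
    fix t :: real
    have "(\<integral>\<^sup>+s. indicator A (t, wrap (s - \<sigma> * t)) \<partial>circ) = (\<integral>\<^sup>+s. indicator A (t, wrap s) \<partial>circ)"
      using nn_integral_circ_shift[of "\<lambda>s. indicator A (t, wrap s)" "- \<sigma> * t"] periodic_comp_wrap[of "\<lambda>s. indicator A (t, s)"] by simp
    also have "\<dots> = (\<integral>\<^sup>+s. indicator A (t, s) \<partial>circ)"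
    proof (rule nn_integral_cong_AE)
      have "AE s in circ. s \<in> {-pi<..pi}" unfolding circ_def by (subst AE_density) (auto simp: indicator_def)
      then show "AE s in circ. indicator A (t, wrap s) = (indicator A (t, s) :: ennreal)"
        by eventually_elim (simp add: wrap_id)
    qed
    finally show "(\<integral>\<^sup>+s. indicator A (t, wrap (s - \<sigma> * t)) \<partial>circ) = (\<integral>\<^sup>+s. indicator A (t, s) \<partial>circ)" .
  qed
  also have "\<dots> = (\<integral>\<^sup>+z. indicator A z \<partial>cyl c)"
    unfolding cyl_def by (subst C.nn_integral_fst) auto
  also have "\<dots> = emeasure (cyl c) A" by simp
  finally show "emeasure (distr (cyl c) (borel \<Otimes>\<^sub>M borel) (\<lambda>z. (fst z, wrap (snd z - \<sigma> * fst z)))) A = emeasure (cyl c) A" .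
qed simp

lemma
  fixes H :: "real \<times> real \<Rightarrow> complex"
  assumes H: "H \<in> borel_measurable (borel \<Otimes>\<^sub>M borel)" and per: "\<And>t. periodic (\<lambda>s. H (t, s))"
  shows cyl_shear_integrable: "integrable (cyl c) H \<longleftrightarrow> integrable (cyl c) (\<lambda>z. H (fst z, snd z - \<sigma> * fst z))"
    and cyl_shear_integral: "(LINT z|cyl c. H z) = (LINT z|cyl c. H (fst z, snd z - \<sigma> * fst z))"
proof -
  have *: "H (t, wrap s) = H (t, s)" for t s by (rule periodic_wrap[OF per])
  have m: "(\<lambda>z. (fst z, wrap (snd z - \<sigma> * fst z))) \<in> cyl c \<rightarrow>\<^sub>M borel \<Otimes>\<^sub>M borel"
    unfolding measurable_cyl by (rule shear_measurable)
  show "integrable (cyl c) H \<longleftrightarrow> integrable (cyl c) (\<lambda>z. H (fst z, snd z - \<sigma> * fst z))"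
    using integrable_distr_eq[OF m H] unfolding cyl_shear * .
  show "(LINT z|cyl c. H z) = (LINT z|cyl c. H (fst z, snd z - \<sigma> * fst z))"
    using integral_distr[OF m H] unfolding cyl_shear * .
qed

lemma time_measure_eq: "time_measure c = density lborel (\<lambda>t. ennreal (indicator {-c..c} t))"
  by (simp add: time_measure_def ennreal_indicator[abs_def])

lemma circ_eq: "circ = density lborel (\<lambda>t. ennreal (indicator {-pi<..pi} t))"
  by (simp add: circ_def ennreal_indicator[abs_def])

lemma AE_cyl: "AE z in cyl c. fst z \<in> {-c..c} \<and> snd z \<in> {-pi<..pi}"
proof -
  interpret C: finite_measure circ by (rule finite_circ)
  interpret T: finite_measure "time_measure c" by (rule finite_time_measure)
  interpret TC: pair_sigma_finite "time_measure c" circ ..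
  have t: "AE t in time_measure c. t \<in> {-c..c}" unfolding time_measure_eq by (subst AE_density) (auto simp: indicator_def)
  have s: "AE s in circ. s \<in> {-pi<..pi}" unfolding circ_eq by (subst AE_density) (auto simp: indicator_def)
  have "AE t in time_measure c. AE s in circ. fst (t, s) \<in> {-c..c} \<and> snd (t, s) \<in> {-pi<..pi}"
    using t
  proof eventually_elim
    case (elim t)
    show ?case using s by eventually_elim (use elim in simp)
  qed
  moreover have "{z \<in> space (cyl c). fst z \<in> {-c..c} \<and> snd z \<in> {-pi<..pi}} \<in> sets (cyl c)"
  proof -
    have "{z. fst z \<in> {-c..c} \<and> snd z \<in> {-pi<..pi}} = {-c..c} \<times> {-pi<..pi}" by auto
    then show ?thesis by simp
  qed
  ultimately show ?thesis
    unfolding cyl_def by (rule TC.AE_pair_measure[rotated])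
qed

lemma cyl_integrable_bounded:
  fixes K :: "real \<times> real \<Rightarrow> complex" and L :: "real \<Rightarrow> complex"
  assumes K: "K \<in> borel_measurable (borel \<Otimes>\<^sub>M borel)" "\<And>t s. t \<in> {-c..c} \<Longrightarrow> norm (K (t, s)) \<le> B"
    and L: "integrable circ L"
  shows "integrable (cyl c) (\<lambda>z. K z * L (snd z))"
proof -
  interpret C: finite_measure circ by (rule finite_circ)
  interpret T: finite_measure "time_measure c" by (rule finite_time_measure)
  interpret TC: pair_sigma_finite "time_measure c" circ ..
  have Lm [measurable]: "L \<in> borel_measurable borel"
    using borel_measurable_integrable[OF L] by (simp add: measurable_cong_sets[of circ borel borel borel])
  have "integrable (cyl c) (\<lambda>z. L (snd z))"
  proof (rule integrableI_bounded)
    show "(\<lambda>z. L (snd z)) \<in> borel_measurable (cyl c)" unfolding measurable_cyl by measurable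
    have "(\<integral>\<^sup>+z. ennreal (norm (L (snd z))) \<partial>cyl c) = (\<integral>\<^sup>+t. \<integral>\<^sup>+s. ennreal (norm (L s)) \<partial>circ \<partial>time_measure c)"
      unfolding cyl_def by (subst C.nn_integral_fst[symmetric]) auto
    also have "\<dots> = (\<integral>\<^sup>+s. ennreal (norm (L s)) \<partial>circ) * emeasure (time_measure c) UNIV" by simp
    also have "\<dots> < \<infinity>"
    proof -
      have "emeasure (time_measure c) UNIV < \<infinity>" using T.emeasure_finite[of UNIV] by (simp add: less_top[symmetric])
      then show ?thesis using L by (simp add: integrable_iff_bounded ennreal_mult_less_top)
    qed
    finally show "(\<integral>\<^sup>+z. ennreal (norm (L (snd z))) \<partial>cyl c) < \<infinity>" .
  qed
  then have "integrable (cyl c) (\<lambda>z. complex_of_real B * L (snd z))" by simp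
  then show ?thesis
  proof (rule Bochner_Integration.integrable_bound)
    show "(\<lambda>z. K z * L (snd z)) \<in> borel_measurable (cyl c)" unfolding measurable_cyl using K(1) by measurable
    show "AE z in cyl c. norm (K z * L (snd z)) \<le> norm (complex_of_real B * L (snd z))"
      using AE_cyl[of c]
    proof eventually_elim
      case (elim z)
      then have "norm (K z) \<le> \<bar>B\<bar>" using K(2)[of "fst z" "snd z"] by simp
      then show ?case by (simp add: norm_mult mult_right_mono)
    qed
  qed
qed

lemma time_measure_FTC:
  fixes F f :: "real \<Rightarrow> complex"
  assumes "0 \<le> c" and f: "f \<in> borel_measurable borel"
    and "\<And>t. t \<in> {-c..c} \<Longrightarrow> (F has_vector_derivative f t) (at t within {-c..c})" and "continuous_on {-c..c} f"
  shows "(LINT t|time_measure c. f t) = F c - F (- c)"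
proof -
  have "(LINT t|time_measure c. f t) = (LINT t|lborel. indicator {-c..c} t *\<^sub>R f t)"
    unfolding time_measure_eq by (rule integral_density) (use f in auto)
  also have "\<dots> = F c - F (- c)"
    using assms by (intro integral_FTC_Icc) auto
  finally show ?thesis .
qed

lemma time_measure_integrable:
  fixes f :: "real \<Rightarrow> complex"
  assumes f [measurable]: "f \<in> borel_measurable borel" and B: "\<And>t. t \<in> {-c..c} \<Longrightarrow> norm (f t) \<le> B"
  shows "integrable (time_measure c) f"
proof -
  interpret T: finite_measure "time_measure c" by (rule finite_time_measure)
  show ?thesis
  proof (rule T.integrable_const_bound)
    have "AE t in time_measure c. t \<in> {-c..c}" unfolding time_measure_eq by (subst AE_density) (auto simp: indicator_def)
    then show "AE t in time_measure c. norm (f t) \<le> B" by eventually_elim (rule B)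
  qed measurable
qed

text \<open>Integration by parts along the lines \<open>\<theta> + \<sigma> \<tau> = const\<close>: a factor depending only on \<open>\<theta> + \<sigma> \<tau>\<close>
  is a constant there, so it may be merely integrable.\<close>

lemma cyl_by_parts:
  fixes L a a' :: "real \<Rightarrow> complex" and G g :: "real \<times> real \<Rightarrow> complex"
  assumes c: "0 < c"
    and L: "integrable circ L" "periodic L"
    and a [measurable]: "a \<in> borel_measurable borel" "a' \<in> borel_measurable borel"
    and a': "\<And>t. t \<in> {-c..c} \<Longrightarrow> (a has_vector_derivative a' t) (at t within {-c..c})" "continuous_on {-c..c} a'"
    and Gm [measurable]: "G \<in> borel_measurable (borel \<Otimes>\<^sub>M borel)" "g \<in> borel_measurable (borel \<Otimes>\<^sub>M borel)"
    and per: "\<And>t. periodic (\<lambda>s. G (t, s))" "\<And>t. periodic (\<lambda>s. g (t, s))"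
    and B: "\<And>t s. t \<in> {-c..c} \<Longrightarrow> norm (G (t, s)) \<le> B" "\<And>t s. t \<in> {-c..c} \<Longrightarrow> norm (g (t, s)) \<le> B"
    and d: "\<And>s t. t \<in> {-c..c} \<Longrightarrow> ((\<lambda>t. G (t, s - \<sigma> * t)) has_vector_derivative g (t, s - \<sigma> * t)) (at t within {-c..c})"
    and cont: "\<And>s. continuous_on {-c..c} (\<lambda>t. g (t, s - \<sigma> * t))"
    and G0: "\<And>s. G (-c, s) = 0" "\<And>s. G (c, s) = 0"
  shows "integrable (cyl c) (\<lambda>z. a (fst z) * L (snd z + \<sigma> * fst z) * g z)" (is ?I)
    and "(LINT z|cyl c. a (fst z) * L (snd z + \<sigma> * fst z) * g z) = - (LINT z|cyl c. a' (fst z) * L (snd z + \<sigma> * fst z) * G z)" (is ?E)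
proof -
  interpret C: finite_measure circ by (rule finite_circ)
  interpret T: finite_measure "time_measure c" by (rule finite_time_measure)
  interpret TC: pair_sigma_finite "time_measure c" circ ..
  have Lm [measurable]: "L \<in> borel_measurable borel"
    using borel_measurable_integrable[OF L(1)] by (simp add: measurable_cong_sets[of circ borel borel borel])
  have ac: "continuous_on {-c..c} a"
    using a'(1) has_vector_derivative_continuous continuous_on_eq_continuous_within by blast
  obtain A where A: "\<And>t. t \<in> {-c..c} \<Longrightarrow> norm (a t) \<le> A"
    using compact_imp_bounded[OF compact_continuous_image[OF ac compact_Icc]] unfolding bounded_iff by blast
  obtain A' where A': "\<And>t. t \<in> {-c..c} \<Longrightarrow> norm (a' t) \<le> A'"
    using compact_imp_bounded[OF compact_continuous_image[OF a'(2) compact_Icc]] unfolding bounded_iff by blast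
  have bb: "norm (b t * k (t, s)) \<le> M * B"
    if "\<And>t. t \<in> {-c..c} \<Longrightarrow> norm (b t) \<le> M" "\<And>t s. t \<in> {-c..c} \<Longrightarrow> norm (k (t, s)) \<le> B" "t \<in> {-c..c}"
    for b :: "real \<Rightarrow> complex" and k :: "real \<times> real \<Rightarrow> complex" and M t s
    unfolding norm_mult using that order_trans[OF norm_ge_zero that(1)[OF that(3)]] by (intro mult_mono) auto
  \<comment> \<open>After the shear \<open>L\<close> depends on the angle \<open>s\<close> alone,
    and the other factors are evaluated along one null line for each \<open>s\<close>.\<close>
  have shear: "(integrable (cyl c) (\<lambda>z. b (fst z) * L (snd z + \<sigma> * fst z) * k z) \<longleftrightarrow>
        integrable (cyl c) (\<lambda>z. b (fst z) * k (fst z, snd z - \<sigma> * fst z) * L (snd z))) \<and>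
      (LINT z|cyl c. b (fst z) * L (snd z + \<sigma> * fst z) * k z) =
        (LINT z|cyl c. b (fst z) * k (fst z, snd z - \<sigma> * fst z) * L (snd z))"
    if [measurable]: "b \<in> borel_measurable borel" "k \<in> borel_measurable (borel \<Otimes>\<^sub>M borel)"
      and k: "\<And>t. periodic (\<lambda>s. k (t, s))" for b k
  proof -
    let ?H = "\<lambda>z. b (fst z) * L (snd z + \<sigma> * fst z) * k z"
    have m: "?H \<in> borel_measurable (borel \<Otimes>\<^sub>M borel)" by measurable
    have p: "periodic (\<lambda>s. ?H (t, s))" for t
    proof -
      have "L (s + 2 * pi + \<sigma> * t) = L (s + \<sigma> * t)" for s
        using L(2)[unfolded periodic_def, rule_format, of "s + \<sigma> * t"] by (simp add: add_ac)
      then show ?thesis using k by (simp add: periodic_def)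
    qed
    have e: "(\<lambda>z. ?H (fst z, snd z - \<sigma> * fst z)) = (\<lambda>z. b (fst z) * k (fst z, snd z - \<sigma> * fst z) * L (snd z))"
      by (simp add: mult_ac)
    show ?thesis
      using cyl_shear_integrable[OF m p, of c \<sigma>] cyl_shear_integral[OF m p, of c \<sigma>] unfolding e by blast
  qed
  have i1: "integrable (cyl c) (\<lambda>z. a (fst z) * g (fst z, snd z - \<sigma> * fst z) * L (snd z))"
    by (rule cyl_integrable_bounded[where B="A * B", OF _ _ L(1)]) (measurable, use bb[of a A g, OF A B(2)] in simp)
  have i2: "integrable (cyl c) (\<lambda>z. a' (fst z) * G (fst z, snd z - \<sigma> * fst z) * L (snd z))"
    by (rule cyl_integrable_bounded[where B="A' * B", OF _ _ L(1)]) (measurable, use bb[of a' A' G, OF A' B(1)] in simp)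
  show ?I using shear[of a g] i1 per(2) by simp
  \<comment> \<open>Fundamental theorem of calculus for \<open>a * G\<close> along a single null
    line; the boundary terms vanish by \<open>G0\<close>.\<close>
  have line: "(LINT t|time_measure c. a t * g (t, s - \<sigma> * t) * L s) = - (LINT t|time_measure c. a' t * G (t, s - \<sigma> * t) * L s)" for s
  proof -
    have "(LINT t|time_measure c. a t * g (t, s - \<sigma> * t) + a' t * G (t, s - \<sigma> * t)) = a c * G (c, s - \<sigma> * c) - a (- c) * G (- c, s - \<sigma> * (- c))"
    proof (rule time_measure_FTC[where F="\<lambda>t. a t * G (t, s - \<sigma> * t)"])
      show "(\<lambda>t. a t * g (t, s - \<sigma> * t) + a' t * G (t, s - \<sigma> * t)) \<in> borel_measurable borel" by measurable
      show "((\<lambda>t. a t * G (t, s - \<sigma> * t)) has_vector_derivative a t * g (t, s - \<sigma> * t) + a' t * G (t, s - \<sigma> * t)) (at t within {-c..c})"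
        if "t \<in> {-c..c}" for t
        by (rule has_vector_derivative_mult[OF a'(1)[OF that] d[OF that]])
      have "continuous_on {-c..c} (\<lambda>t. G (t, s - \<sigma> * t))"
        using d[of _ s] has_vector_derivative_continuous continuous_on_eq_continuous_within by blast
      then show "continuous_on {-c..c} (\<lambda>t. a t * g (t, s - \<sigma> * t) + a' t * G (t, s - \<sigma> * t))"
        using ac a'(2) cont[of s] by (intro continuous_on_add continuous_on_mult)
    qed (use c in simp)
    also have "\<dots> = 0" by (simp add: G0)
    finally have "(LINT t|time_measure c. a t * g (t, s - \<sigma> * t)) + (LINT t|time_measure c. a' t * G (t, s - \<sigma> * t)) = 0"
    proof (subst (asm) Bochner_Integration.integral_add)
      show "integrable (time_measure c) (\<lambda>t. a t * g (t, s - \<sigma> * t))"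
        by (rule time_measure_integrable[where B="A * B"]) (measurable, use bb[of a A g, OF A B(2)] in simp)
      show "integrable (time_measure c) (\<lambda>t. a' t * G (t, s - \<sigma> * t))"
        by (rule time_measure_integrable[where B="A' * B"]) (measurable, use bb[of a' A' G, OF A' B(1)] in simp)
    qed
    then show ?thesis by (simp add: add_eq_0_iff2)
  qed
  have "(LINT z|cyl c. a (fst z) * g (fst z, snd z - \<sigma> * fst z) * L (snd z)) =
      (LINT s|circ. LINT t|time_measure c. a t * g (t, s - \<sigma> * t) * L s)"
    using TC.integral_snd[of "\<lambda>t s. a t * g (t, s - \<sigma> * t) * L s"] i1 by (simp add: cyl_def case_prod_unfold)
  also have "\<dots> = - (LINT s|circ. LINT t|time_measure c. a' t * G (t, s - \<sigma> * t) * L s)"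
    unfolding line by simp
  also have "\<dots> = - (LINT z|cyl c. a' (fst z) * G (fst z, snd z - \<sigma> * fst z) * L (snd z))"
    using TC.integral_snd[of "\<lambda>t s. a' t * G (t, s - \<sigma> * t) * L s"] i2 by (simp add: cyl_def case_prod_unfold)
  finally show ?E using shear[of a g] shear[of a' G] per by simp
qed

lemma cyl_density:
  "cyl c = density (lborel \<Otimes>\<^sub>M lborel) (\<lambda>z. ennreal (indicator {-c..c} (fst z) * indicator {-pi<..pi} (snd z)))"
proof -
  interpret C: finite_measure circ by (rule finite_circ)
  have "cyl c = density (lborel \<Otimes>\<^sub>M lborel) (\<lambda>(x, y). ennreal (indicator {-c..c} x) * ennreal (indicator {-pi<..pi} y))"
    unfolding cyl_def time_measure_eq circ_eq
    using C.sigma_finite_measure_axioms unfolding circ_eq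
    by (intro pair_measure_density) (auto intro: sigma_finite_lborel)
  then show ?thesis by (simp add: case_prod_unfold ennreal_mult')
qed

text \<open>With the support inside \<open>\<bar>\<tau>\<bar> \<le> c\<close> and
  \<open>c < pi / 2\<close>, the chart domain may be replaced by a cylinder that stays away from the
  blow-up of the density.\<close>

lemma dS_integral_cyl:
  fixes F :: "real^3 \<Rightarrow> complex"
  assumes F [measurable]: "F \<in> borel_measurable borel" and c: "c < pi / 2"
    and supp: "\<And>p. p \<in> strip \<Longrightarrow> F (chart R p) \<noteq> 0 \<Longrightarrow> \<bar>p $ 0\<bar> \<le> c"
  shows "(LINT y|dS_volume R. F y) = (LINT z|cyl c. complex_of_real (R\<^sup>2 / (cos (fst z))\<^sup>2) * F (chart R (pt (fst z) (snd z))))"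
proof -
  have "(LINT y|dS_volume R. F y) = (LINT p|chart_volume R. F (chart R p))"
    unfolding dS_volume_def by (subst integral_distr) auto
  also have "\<dots> = (LINT p|lborel. rho R p *\<^sub>R F (chart R p))"
    unfolding chart_volume_eq by (subst integral_density) (auto simp: rho_nonneg)
  also have "\<dots> = (LINT z|(lborel \<Otimes>\<^sub>M lborel). rho R (pt (fst z) (snd z)) *\<^sub>R F (chart R (pt (fst z) (snd z))))"
    unfolding lborel_two by (subst integral_distr) (auto simp: case_prod_unfold)
  also have "\<dots> = (LINT z|(lborel \<Otimes>\<^sub>M lborel). (indicator {-c..c} (fst z) * indicator {-pi<..pi} (snd z)) *\<^sub>R
      (complex_of_real (R\<^sup>2 / (cos (fst z))\<^sup>2) * F (chart R (pt (fst z) (snd z)))))"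
  proof (rule Bochner_Integration.integral_cong[OF refl])
    fix z :: "real \<times> real"
    let ?p = "pt (fst z) (snd z)"
    show "rho R ?p *\<^sub>R F (chart R ?p) = (indicator {-c..c} (fst z) * indicator {-pi<..pi} (snd z)) *\<^sub>R
      (complex_of_real (R\<^sup>2 / (cos (fst z))\<^sup>2) * F (chart R ?p))"
    proof (cases "?p \<in> chart_domain")
      case True
      then have "F (chart R ?p) = 0 \<or> \<bar>fst z\<bar> \<le> c" using supp[of ?p] chart_domain_subset_strip by auto
      then show ?thesis using True by (auto simp: rho_def chart_domain_def scaleR_conv_of_real indicator_def)
    next
      case False
      then have "fst z \<notin> {-c..c} \<or> snd z \<notin> {-pi<..pi}" using c by (auto simp: chart_domain_def)
      then show ?thesis using False by (auto simp: rho_def indicator_def)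
    qed
  qed
  also have "\<dots> = integral\<^sup>L (density (lborel \<Otimes>\<^sub>M lborel) (\<lambda>z. ennreal (indicator {-c..c} (fst z) * indicator {-pi<..pi} (snd z))))
      (\<lambda>z. complex_of_real (R\<^sup>2 / (cos (fst z))\<^sup>2) * F (chart R (pt (fst z) (snd z))))"
    by (rule integral_density[symmetric]) auto
  also have "\<dots> = (LINT z|cyl c. complex_of_real (R\<^sup>2 / (cos (fst z))\<^sup>2) * F (chart R (pt (fst z) (snd z))))"
    by (simp add: cyl_density)
  finally show ?thesis .
qed

section \<open>The wave equation for the two-point kernel\<close>

lemma partial_translate:
  assumes "\<And>q. u (q + v) = u q"
  shows "partial i u (p + v) = partial i u p"
proof -
  have "u (p + v + s *\<^sub>R axis i 1) = u (p + s *\<^sub>R axis i 1)" for s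
    using assms[of "p + s *\<^sub>R axis i 1"] by (simp add: add_ac)
  then show ?thesis unfolding partial_def by simp
qed

lemma pt_period: "pt t (s + 2 * pi) = pt t s + pt 0 (2 * pi)"
  by (simp add: vec2_eq_iff)

lemma chart_period: "chart R (p + pt 0 (2 * pi)) = chart R (p :: real^2)"
  by (simp add: vec3_eq_iff chart_nth)

lemma periodic_chart: "periodic (\<lambda>s. F (chart R (pt t s) :: real^3))"
  by (simp add: periodic_def pt_period chart_period)

lemma periodic_bounded:
  fixes F :: "real \<times> real \<Rightarrow> complex"
  assumes "continuous_on ({-c..c} \<times> {-pi..pi}) F" and per: "\<And>t. periodic (\<lambda>s. F (t, s))"
  obtains B where "\<And>t s. t \<in> {-c..c} \<Longrightarrow> norm (F (t, s)) \<le> B"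
proof -
  have "compact (F ` ({-c..c} \<times> {-pi..pi}))"
    using assms(1) by (intro compact_continuous_image compact_Times compact_Icc)
  then obtain B where B: "\<And>z. z \<in> {-c..c} \<times> {-pi..pi} \<Longrightarrow> norm (F z) \<le> B"
    by (meson bounded_iff compact_imp_bounded imageI)
  have "norm (F (t, s)) \<le> B" if "t \<in> {-c..c}" for t s
    using B[of "(t, wrap s)"] wrap_in[of s] periodic_wrap[OF per, of t s] that by simp
  then show thesis by (rule that)
qed

lemma pt_curve_derivative: "((\<lambda>t. pt t (s - \<sigma> * t)) has_vector_derivative pt 1 (- \<sigma>)) (at t within S)"
proof -
  have "(\<lambda>t. pt t (s - \<sigma> * t)) = (\<lambda>t. pt 0 s + t *\<^sub>R pt 1 (- \<sigma>))"
    by (rule ext) (simp add: vec2_eq_iff)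
  then show ?thesis by (auto intro!: derivative_eq_intros)
qed

lemma pullback_curve_derivative:
  fixes u :: "real^2 \<Rightarrow> complex"
  assumes "Ck_on (Suc k) strip u" "pt t (s - \<sigma> * t) \<in> strip"
  shows "((\<lambda>t. u (pt t (s - \<sigma> * t))) has_vector_derivative
    partial 0 u (pt t (s - \<sigma> * t)) - \<sigma> *\<^sub>R partial 1 u (pt t (s - \<sigma> * t))) (at t within S)"
  using vector_derivative_diff_chain_within[OF pt_curve_derivative[of s \<sigma> t S] has_derivative_at_withinI[OF has_derivative_partials[OF assms]]]
  by (simp add: o_def)

section \<open>A test function and its d'Alembertian on the cylinder\<close>

locale wave_setup =
  fixes R :: real and h :: "real^3 \<Rightarrow> complex"
  assumes R: "R > 0" and h: "h \<in> test_fun R"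
begin

definition "\<phi> = h \<circ> chart R"

lemma Ck_phi: "Ck_on k strip \<phi>"
  unfolding \<phi>_def by (rule Ck_on_pullback[OF test_fun_smooth[OF h]])

lemma Ck_partial_phi: "Ck_on k strip (partial i \<phi>)" "Ck_on k strip (partial i (partial j \<phi>))"
  by (intro Ck_on_partial open_strip Ck_phi)+

text \<open>Vanishing on a neighbourhood, rather than at the point alone, is demanded so that the
  derivatives of \<open>\<phi>\<close> vanish at the ends of the cylinder as well.\<close>

definition cutoff :: real where
  "cutoff = (SOME c. 0 < c \<and> c < pi / 2 \<and> (\<forall>p\<in>strip. c \<le> \<bar>p $ 0\<bar> \<longrightarrow>
     (\<exists>U. open U \<and> p \<in> U \<and> U \<subseteq> strip \<and> (\<forall>q\<in>U. h (chart R q) = 0 \<and> dalembert R h (chart R q) = 0))))"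

lemma cutoff: "0 < cutoff" "cutoff < pi / 2"
  and cutoff_zero: "p \<in> strip \<Longrightarrow> cutoff \<le> \<bar>p $ 0\<bar> \<Longrightarrow>
     \<exists>U. open U \<and> p \<in> U \<and> U \<subseteq> strip \<and> (\<forall>q\<in>U. h (chart R q) = 0 \<and> dalembert R h (chart R q) = 0)"
proof -
  obtain T1 where T1: "T1 > 0" "\<And>x. h x \<noteq> 0 \<Longrightarrow> \<bar>x $ 0\<bar> \<le> T1" using test_fun_time_bounded[OF h] by blast
  obtain T2 where T2: "T2 > 0" "\<And>x. dalembert R h x \<noteq> 0 \<Longrightarrow> \<bar>x $ 0\<bar> \<le> T2"
    using test_fun_time_bounded[OF test_fun_dalembert[OF R h]] by blast
  define T where "T = max T1 T2"
  define c0 where "c0 = arctan (T / R)"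
  have c0: "0 < c0" "c0 < pi / 2" using arctan_ubound R T1(1) by (auto simp: c0_def T_def)
  \<comment> \<open>\<open>c\<close> lies strictly beyond \<open>c0\<close>, after which both
    functions vanish. The open region \<open>c0 < \<bar>q $ 0\<bar>\<close> is then a neighbourhood
    of every point of the strip with time at least \<open>c\<close> in modulus.\<close>
  define c where "c = (c0 + pi / 2) / 2"
  have c: "0 < c" "c0 < c" "c < pi / 2" using c0 by (auto simp: c_def)
  have "\<exists>U. open U \<and> p \<in> U \<and> U \<subseteq> strip \<and> (\<forall>q\<in>U. h (chart R q) = 0 \<and> dalembert R h (chart R q) = 0)"
    if p: "p \<in> strip" "c \<le> \<bar>p $ 0\<bar>" for p
  proof -
    define U where "U = strip \<inter> {q. c0 < \<bar>q $ 0\<bar>}"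
    have "open U" unfolding U_def
      by (intro open_Int open_strip open_Collect_less continuous_intros)
    moreover have "p \<in> U" using p c by (simp add: U_def)
    moreover have "T < \<bar>chart R q $ 0\<bar>" if "q \<in> U" for q
    proof -
      have "c0 < \<bar>q $ 0\<bar>" "\<bar>q $ 0\<bar> < pi / 2" using that by (auto simp: U_def strip_def)
      then have "tan c0 < tan \<bar>q $ 0\<bar>" using c0 by (intro tan_monotone) auto
      also have "tan \<bar>q $ 0\<bar> = \<bar>tan (q $ 0)\<bar>"
        using that tan_gt_zero[of "q $ 0"] tan_gt_zero[of "- (q $ 0)"]
        by (cases "q $ 0" "0::real" rule: linorder_cases) (auto simp: U_def strip_def)
      finally show ?thesis using R by (simp add: c0_def tan_arctan chart_nth abs_mult field_simps)
    qed
    then have "h (chart R q) = 0 \<and> dalembert R h (chart R q) = 0" if "q \<in> U" for q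
      using T1(2)[of "chart R q"] T2(2)[of "chart R q"] that by (force simp: T_def)
    ultimately show ?thesis unfolding U_def by blast
  qed
  then have "\<exists>c. 0 < c \<and> c < pi / 2 \<and> (\<forall>p\<in>strip. c \<le> \<bar>p $ 0\<bar> \<longrightarrow>
     (\<exists>U. open U \<and> p \<in> U \<and> U \<subseteq> strip \<and> (\<forall>q\<in>U. h (chart R q) = 0 \<and> dalembert R h (chart R q) = 0)))"
    using c by blast
  from someI_ex[OF this, folded cutoff_def]
  show "0 < cutoff" "cutoff < pi / 2"
    "p \<in> strip \<Longrightarrow> cutoff \<le> \<bar>p $ 0\<bar> \<Longrightarrow>
     \<exists>U. open U \<and> p \<in> U \<and> U \<subseteq> strip \<and> (\<forall>q\<in>U. h (chart R q) = 0 \<and> dalembert R h (chart R q) = 0)"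
    by blast+
qed

lemma pt_strip: "t \<in> {-cutoff..cutoff} \<Longrightarrow> pt t s \<in> strip"
  using cutoff by (auto simp: strip_def)

text \<open>The volume density cancels the conformal prefactor of the d'Alembertian, so on the
  cylinder \<open>b\<close> is the flat wave operator applied to \<open>\<phi>\<close> (see
  \<open>b_eq\<close>).\<close>

definition b :: "real \<times> real \<Rightarrow> complex" where
  "b z = complex_of_real (R\<^sup>2 / (cos (fst z))\<^sup>2) * dalembert R h (chart R (pt (fst z) (snd z)))"

text \<open>The derivative of \<open>\<phi>\<close> in one null direction, that is, one factor of
  the flat wave operator. The indicator confines it to times at which \<open>partial\<close> is
  controlled and so makes it measurable.\<close>

definition \<psi> :: "real \<Rightarrow> real \<times> real \<Rightarrow> complex" where
  "\<psi> \<sigma> z = indicator {-cutoff..cutoff} (fst z) *\<^sub>R (partial 0 \<phi> (pt (fst z) (snd z)) + \<sigma> *\<^sub>R partial 1 \<phi> (pt (fst z) (snd z)))"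

definition \<phi>z :: "real \<times> real \<Rightarrow> complex" where "\<phi>z z = \<phi> (pt (fst z) (snd z))"

lemma b_eq:
  assumes "t \<in> {-cutoff..cutoff}"
  shows "b (t, s) = partial 0 (partial 0 \<phi>) (pt t s) - partial 1 (partial 1 \<phi>) (pt t s)"
proof -
  have "pt t s \<in> strip" by (rule pt_strip[OF assms])
  then show ?thesis
    using dalembert_chart[OF R test_fun_smooth[OF h], of "pt t s"] strip_cos_pos[of "pt t s"] R
    by (simp add: b_def \<phi>_def scaleR_conv_of_real)
qed

lemma D_test: "dalembert R h \<in> test_fun R" by (rule test_fun_dalembert[OF R h])

lemma b_measurable [measurable]: "b \<in> borel_measurable (borel \<Otimes>\<^sub>M borel)"
proof -
  have [measurable]: "dalembert R h \<in> borel_measurable borel" using D_test by simp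
  show ?thesis unfolding b_def[abs_def] by measurable
qed

lemma phiz_measurable [measurable]: "\<phi>z \<in> borel_measurable (borel \<Otimes>\<^sub>M borel)"
proof -
  have [measurable]: "h \<in> borel_measurable borel" using h by simp
  show ?thesis unfolding \<phi>z_def[abs_def] \<phi>_def o_def by measurable
qed

lemma continuous_on_pt: "continuous_on S (\<lambda>z. pt (fst z) (snd z) :: real^2)"
proof -
  have "continuous_on S (\<lambda>z. fst z *\<^sub>R pt 1 0 + snd z *\<^sub>R (pt 0 1 :: real^2))"
    by (intro continuous_intros)
  then show ?thesis by (rule continuous_on_eq) (simp add: vec2_eq_iff)
qed

lemma continuous_on_strip_pt:
  assumes "Ck_on k strip u"
  shows "continuous_on ({-cutoff..cutoff} \<times> S) (\<lambda>z. u (pt (fst z) (snd z)))"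
  by (rule continuous_on_compose2[OF Ck_on_cont[OF open_strip assms] continuous_on_pt]) (auto intro: pt_strip)

lemma psi_continuous: "continuous_on ({-cutoff..cutoff} \<times> S) (\<psi> \<sigma>)"
proof -
  have "continuous_on ({-cutoff..cutoff} \<times> S) (\<lambda>z. partial 0 \<phi> (pt (fst z) (snd z)) + \<sigma> *\<^sub>R partial 1 \<phi> (pt (fst z) (snd z)))"
    using Ck_partial_phi by (intro continuous_on_add continuous_on_scaleR continuous_on_const continuous_on_strip_pt)
  then show ?thesis by (rule continuous_on_eq) (auto simp: \<psi>_def)
qed

lemma psi_measurable [measurable]: "\<psi> \<sigma> \<in> borel_measurable (borel \<Otimes>\<^sub>M borel)"
proof -
  have "(\<lambda>z. indicator ({-cutoff..cutoff} \<times> UNIV) z *\<^sub>R \<psi> \<sigma> z) \<in> borel_measurable borel"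
    by (intro borel_measurable_continuous_on_indicator psi_continuous) (auto intro!: borel_closed closed_Times)
  also have "(\<lambda>z. indicator ({-cutoff..cutoff} \<times> UNIV) z *\<^sub>R \<psi> \<sigma> z) = \<psi> \<sigma>"
    by (rule ext) (auto simp: \<psi>_def indicator_def)
  finally show ?thesis by (simp add: borel_prod)
qed

lemma periodic_b: "periodic (\<lambda>s. b (t, s))"
  using periodic_chart[of "dalembert R h" R t] by (simp add: b_def periodic_def)

lemma periodic_phiz: "periodic (\<lambda>s. \<phi>z (t, s))"
  using periodic_chart[of h R t] by (simp add: \<phi>z_def \<phi>_def)

lemma periodic_psi: "periodic (\<lambda>s. \<psi> \<sigma> (t, s))"
proof -
  have "\<phi> (q + pt 0 (2 * pi)) = \<phi> q" for q by (simp add: \<phi>_def chart_period)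
  then have "partial i \<phi> (pt t (s + 2 * pi)) = partial i \<phi> (pt t s)" for i s
    unfolding pt_period by (rule partial_translate)
  then show ?thesis by (simp add: periodic_def \<psi>_def)
qed

lemma b_continuous: "continuous_on ({-cutoff..cutoff} \<times> S) b"
proof -
  have "continuous_on ({-cutoff..cutoff} \<times> S) (\<lambda>z. partial 0 (partial 0 \<phi>) (pt (fst z) (snd z)) - partial 1 (partial 1 \<phi>) (pt (fst z) (snd z)))"
    using Ck_partial_phi by (intro continuous_on_diff continuous_on_strip_pt)
  then show ?thesis by (rule continuous_on_eq) (auto simp: b_eq)
qed

lemma phiz_continuous: "continuous_on ({-cutoff..cutoff} \<times> S) \<phi>z"
  unfolding \<phi>z_def[abs_def] by (rule continuous_on_strip_pt[OF Ck_phi])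

lemma line_continuous:
  assumes "continuous_on ({-cutoff..cutoff} \<times> UNIV) g"
  shows "continuous_on {-cutoff..cutoff} (\<lambda>t. g (t, s - \<sigma> * t))"
  by (rule continuous_on_compose2[OF assms]) (auto intro!: continuous_intros)

text \<open>Factorisation of the flat wave operator: for \<open>\<sigma> * \<sigma> = 1\<close> it
  is the derivative along \<open>\<theta> + \<sigma> \<tau> = const\<close> composed with the null
  derivative in \<open>\<psi> \<sigma>\<close>. The cross terms cancel by equality of the mixed
  derivatives.\<close>

lemma psi_line:
  assumes t: "t \<in> {-cutoff..cutoff}" and \<sigma>: "\<sigma> * \<sigma> = 1"
  shows "((\<lambda>t. \<psi> \<sigma> (t, s - \<sigma> * t)) has_vector_derivative b (t, s - \<sigma> * t)) (at t within {-cutoff..cutoff})"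
proof -
  let ?p = "pt t (s - \<sigma> * t)"
  have p: "?p \<in> strip" by (rule pt_strip[OF t])
  have "((\<lambda>t. partial 0 \<phi> (pt t (s - \<sigma> * t)) + \<sigma> *\<^sub>R partial 1 \<phi> (pt t (s - \<sigma> * t))) has_vector_derivative
    (partial 0 (partial 0 \<phi>) ?p - \<sigma> *\<^sub>R partial 1 (partial 0 \<phi>) ?p) +
     \<sigma> *\<^sub>R (partial 0 (partial 1 \<phi>) ?p - \<sigma> *\<^sub>R partial 1 (partial 1 \<phi>) ?p)) (at t within {-cutoff..cutoff})"
    by (intro has_vector_derivative_add bounded_linear.has_vector_derivative[OF bounded_linear_scaleR_right]
        pullback_curve_derivative[OF Ck_partial_phi(1) p])
  also have "(partial 0 (partial 0 \<phi>) ?p - \<sigma> *\<^sub>R partial 1 (partial 0 \<phi>) ?p) +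
     \<sigma> *\<^sub>R (partial 0 (partial 1 \<phi>) ?p - \<sigma> *\<^sub>R partial 1 (partial 1 \<phi>) ?p) = b (t, s - \<sigma> * t)"
    using partial_commute[OF open_strip p Ck_phi] \<sigma> by (simp add: b_eq[OF t] scaleR_diff_right)
  finally show ?thesis
    by (rule has_vector_derivative_transform[OF t, rotated]) (simp add: \<psi>_def)
qed

lemma phiz_line:
  assumes t: "t \<in> {-cutoff..cutoff}"
  shows "((\<lambda>t. \<phi>z (t, s - \<sigma> * t)) has_vector_derivative \<psi> (- \<sigma>) (t, s - \<sigma> * t)) (at t within {-cutoff..cutoff})"
  using pullback_curve_derivative[OF Ck_phi pt_strip[OF t], of s \<sigma>] t by (simp add: \<phi>z_def \<psi>_def)

lemma boundary_zero: "\<bar>t\<bar> = cutoff \<Longrightarrow> \<psi> \<sigma> (t, s) = 0" "\<bar>t\<bar> = cutoff \<Longrightarrow> \<phi>z (t, s) = 0"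
proof -
  assume t: "\<bar>t\<bar> = cutoff"
  then have "pt t s \<in> strip" by (intro pt_strip) auto
  then obtain U where U: "open U" "pt t s \<in> U" "\<And>q. q \<in> U \<Longrightarrow> \<phi> q = 0"
    using cutoff_zero[of "pt t s"] t by (auto simp: \<phi>_def)
  have "partial i \<phi> (pt t s) = partial i (\<lambda>_. 0) (pt t s)" for i
    by (rule partial_cong[OF U])
  then show "\<psi> \<sigma> (t, s) = 0" by (simp add: \<psi>_def partial_def)
  show "\<phi>z (t, s) = 0" using U by (simp add: \<phi>z_def)
qed

text \<open>Integration by parts with the constant weight \<open>a = 1\<close>, whose derivative is
  zero. Applied to the logarithms of the kernel, it states weakly that functions of one null
  coordinate solve the wave equation.\<close>

lemma null_integral:
  assumes L: "integrable circ L" "periodic L" and \<sigma>: "\<sigma> * \<sigma> = 1"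
  shows "integrable (cyl cutoff) (\<lambda>z. L (snd z + \<sigma> * fst z) * b z)"
    and "(LINT z|cyl cutoff. L (snd z + \<sigma> * fst z) * b z) = 0"
proof -
  obtain B1 where B1: "\<And>t s. t \<in> {-cutoff..cutoff} \<Longrightarrow> norm (\<psi> \<sigma> (t, s)) \<le> B1"
    using periodic_bounded[OF psi_continuous periodic_psi] by blast
  obtain B2 where B2: "\<And>t s. t \<in> {-cutoff..cutoff} \<Longrightarrow> norm (b (t, s)) \<le> B2"
    using periodic_bounded[OF b_continuous periodic_b] by blast
  have *: "norm (\<psi> \<sigma> (t, s)) \<le> max B1 B2" "norm (b (t, s)) \<le> max B1 B2" if "t \<in> {-cutoff..cutoff}" for t s
    using B1[OF that, of s] B2[OF that, of s] by auto
  have z: "\<psi> \<sigma> (- cutoff, s) = 0" "\<psi> \<sigma> (cutoff, s) = 0" for s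
    using cutoff by (auto intro!: boundary_zero)
  note P = cyl_by_parts[OF cutoff(1) L, where a="\<lambda>_. 1" and a'="\<lambda>_. 0" and G="\<psi> \<sigma>" and g=b and \<sigma>=\<sigma>,
      OF _ _ _ _ psi_measurable b_measurable periodic_psi periodic_b *(1) *(2) psi_line[OF _ \<sigma>] line_continuous[OF b_continuous] z]
  show "integrable (cyl cutoff) (\<lambda>z. L (snd z + \<sigma> * fst z) * b z)"
    "(LINT z|cyl cutoff. L (snd z + \<sigma> * fst z) * b z) = 0"
    using P by (simp_all add: has_vector_derivative_const)
qed

text \<open>Two integrations by parts, one along each null family (\<open>\<sigma> = 1\<close>, then
  \<open>\<sigma> = -1\<close>), move both derivatives to the weight; the two minus signs
  cancel.\<close>

lemma time_integral:
  assumes m: "a \<in> borel_measurable borel" "a' \<in> borel_measurable borel" "a'' \<in> borel_measurable borel"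
    and a: "\<And>t. t \<in> {-cutoff..cutoff} \<Longrightarrow> (a has_vector_derivative a' t) (at t within {-cutoff..cutoff})"
    and a': "\<And>t. t \<in> {-cutoff..cutoff} \<Longrightarrow> (a' has_vector_derivative a'' t) (at t within {-cutoff..cutoff})"
    and a'': "continuous_on {-cutoff..cutoff} a''"
  shows "integrable (cyl cutoff) (\<lambda>z. a (fst z) * b z)"
    and "(LINT z|cyl cutoff. a (fst z) * b z) = (LINT z|cyl cutoff. a'' (fst z) * \<phi>z z)"
proof -
  interpret C: finite_measure circ by (rule finite_circ)
  have one: "integrable circ (\<lambda>_. 1 :: complex)" "periodic (\<lambda>_. 1 :: complex)"
    by (simp_all add: periodic_def)
  have ca': "continuous_on {-cutoff..cutoff} a'"
    using a' has_vector_derivative_continuous continuous_on_eq_continuous_within by blast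
  obtain B1 where B1: "\<And>t s. t \<in> {-cutoff..cutoff} \<Longrightarrow> norm (\<psi> 1 (t, s)) \<le> B1"
    using periodic_bounded[OF psi_continuous periodic_psi] by blast
  obtain B2 where B2: "\<And>t s. t \<in> {-cutoff..cutoff} \<Longrightarrow> norm (b (t, s)) \<le> B2"
    using periodic_bounded[OF b_continuous periodic_b] by blast
  obtain B3 where B3: "\<And>t s. t \<in> {-cutoff..cutoff} \<Longrightarrow> norm (\<phi>z (t, s)) \<le> B3"
    using periodic_bounded[OF phiz_continuous periodic_phiz] by blast
  define B where "B = max B1 (max B2 B3)"
  have *: "norm (\<psi> 1 (t, s)) \<le> B" "norm (b (t, s)) \<le> B" "norm (\<phi>z (t, s)) \<le> B" if "t \<in> {-cutoff..cutoff}" for t s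
    using B1[OF that, of s] B2[OF that, of s] B3[OF that, of s] by (auto simp: B_def)
  have z: "\<psi> 1 (- cutoff, s) = 0" "\<psi> 1 (cutoff, s) = 0" "\<phi>z (- cutoff, s) = 0" "\<phi>z (cutoff, s) = 0" for s
    using cutoff by (auto intro!: boundary_zero)
  have \<psi>l: "((\<lambda>t. \<psi> 1 (t, s - 1 * t)) has_vector_derivative b (t, s - 1 * t)) (at t within {-cutoff..cutoff})"
    if "t \<in> {-cutoff..cutoff}" for s t using psi_line[OF that, of 1 s] by simp
  have \<phi>l: "((\<lambda>t. \<phi>z (t, s - (-1) * t)) has_vector_derivative \<psi> 1 (t, s - (-1) * t)) (at t within {-cutoff..cutoff})"
    if "t \<in> {-cutoff..cutoff}" for s t using phiz_line[OF that, of s "-1"] by simp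
  note P1 = cyl_by_parts[OF cutoff(1) one m(1,2) a ca' psi_measurable b_measurable periodic_psi periodic_b *(1) *(2)
      \<psi>l line_continuous[OF b_continuous] z(1,2)]
  note P2 = cyl_by_parts[OF cutoff(1) one m(2,3) a' a'' phiz_measurable psi_measurable periodic_phiz periodic_psi *(3) *(1)
      \<phi>l line_continuous[OF psi_continuous] z(3,4)]
  show "integrable (cyl cutoff) (\<lambda>z. a (fst z) * b z)" using P1(1) by simp
  show "(LINT z|cyl cutoff. a (fst z) * b z) = (LINT z|cyl cutoff. a'' (fst z) * \<phi>z z)"
    using P1(2) P2(2) by simp
qed

lemma cutoff_support: "p \<in> strip \<Longrightarrow> h (chart R p) \<noteq> 0 \<or> dalembert R h (chart R p) \<noteq> 0 \<Longrightarrow> \<bar>p $ 0\<bar> \<le> cutoff"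
  using cutoff_zero[of p] by force

lemma integ_cyl: "integ R h = (LINT z|cyl cutoff. complex_of_real (R\<^sup>2 / (cos (fst z))\<^sup>2) * \<phi>z z)"
proof -
  have "h \<in> borel_measurable borel" using h by simp
  from dS_integral_cyl[OF this cutoff(2), of R] cutoff_support
  show ?thesis by (simp add: integ_def \<phi>z_def \<phi>_def)
qed

lemma integral_dalembert_cyl:
  assumes K: "K \<in> borel_measurable borel"
  shows "(LINT y|dS_volume R. K y * dalembert R h y) = (LINT z|cyl cutoff. K (chart R (pt (fst z) (snd z))) * b z)"
proof -
  have [measurable]: "dalembert R h \<in> borel_measurable borel" "K \<in> borel_measurable borel" using D_test K by auto
  have "(\<lambda>y. K y * dalembert R h y) \<in> borel_measurable borel" by measurable
  from dS_integral_cyl[OF this cutoff(2), of R] cutoff_support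
  show ?thesis by (simp add: b_def mult_ac)
qed

lemma integ_dalembert: "integ R (dalembert R h) = 0"
proof -
  have "integ R (dalembert R h) = (LINT z|cyl cutoff. 1 * b z)"
    using integral_dalembert_cyl[of "\<lambda>_. 1"] by (simp add: integ_def)
  also have "\<dots> = (LINT z|cyl cutoff. 0 * \<phi>z z)"
    by (rule time_integral(2)[of "\<lambda>_. 1" "\<lambda>_. 0" "\<lambda>_. 0"]) (auto intro: has_vector_derivative_const)
  finally show ?thesis by simp
qed

end

section \<open>The phase of the kernel in null coordinates\<close>

lemma sgn_sin_half:
  assumes "sin (u / 2) \<noteq> 0"
  shows "sgn (sin (u / 2)) = (if even \<lfloor>u / (2 * pi)\<rfloor> then 1 else - 1)"
proof -
  define k where "k = \<lfloor>u / (2 * pi)\<rfloor>"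
  define r where "r = u / 2 - of_int k * pi"
  have "of_int k \<le> u / (2 * pi)" "u / (2 * pi) < of_int k + 1" unfolding k_def by simp_all
  then have "of_int k * (2 * pi) \<le> u" "u < (of_int k + 1) * (2 * pi)"
    by (simp_all add: pos_le_divide_eq pos_divide_less_eq)
  then have r: "0 \<le> r" "r < pi" by (simp_all add: r_def algebra_simps)
  have s: "sin (u / 2) = (if even k then 1 else - 1) * sin r"
  proof -
    have "u / 2 = pi * of_int k + r" by (simp add: r_def)
    then show ?thesis by (simp only: sin_add sin_npi_int cos_npi_int)
  qed
  then have "r \<noteq> 0" using assms by auto
  then have "sin r > 0" using r by (simp add: sin_gt_zero)
  then show ?thesis unfolding s k_def[symmetric] by (simp add: sgn_mult)
qed

text \<open>As \<open>\<bar>u - v\<bar> < 2 * pi\<close>, the floors differ by at most one. The sine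
  of the half argument changes sign from one period to the next, so the product is negative exactly
  when the floors differ, and their difference then has the sign of \<open>u - v\<close>.\<close>

lemma floor_phase:
  assumes u: "sin (u / 2) \<noteq> 0" and v: "sin (v / 2) \<noteq> 0" and uv: "\<bar>u - v\<bar> < 2 * pi"
  shows "(if sin (u / 2) * sin (v / 2) < 0 then sgn (u - v) else 0) = real_of_int (\<lfloor>u / (2 * pi)\<rfloor> - \<lfloor>v / (2 * pi)\<rfloor>)"
proof -
  define k l where "k = \<lfloor>u / (2 * pi)\<rfloor>" and "l = \<lfloor>v / (2 * pi)\<rfloor>"
  have K: "of_int k \<le> u / (2 * pi)" "u / (2 * pi) < of_int k + 1" unfolding k_def by simp_all
  have L: "of_int l \<le> v / (2 * pi)" "v / (2 * pi) < of_int l + 1" unfolding l_def by simp_all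
  have "\<bar>u / (2 * pi) - v / (2 * pi)\<bar> < 1"
    using uv by (simp add: diff_divide_distrib[symmetric] abs_divide)
  then have "real_of_int k < of_int l + 2" "real_of_int l < of_int k + 2" using K L by linarith+
  then have "k < l + 2" "l < k + 2" by linarith+
  then consider "k = l" | "k = l + 1" | "l = k + 1" by linarith
  moreover have neg: "sin (u / 2) * sin (v / 2) < 0 \<longleftrightarrow> even k \<noteq> even l"
  proof -
    have "sin (u / 2) * sin (v / 2) < 0 \<longleftrightarrow> sgn (sin (u / 2)) * sgn (sin (v / 2)) = - 1"
      unfolding sgn_mult[symmetric] by (simp add: sgn_1_neg)
    then show ?thesis using sgn_sin_half[OF u] sgn_sin_half[OF v] by (simp add: k_def l_def)
  qed
  ultimately show ?thesis
  proof cases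
    case 2
    then have "v / (2 * pi) < u / (2 * pi)" using K L by linarith
    then have "v < u" by (simp add: divide_less_cancel)
    then show ?thesis using 2 neg by (simp add: k_def[symmetric] l_def[symmetric])
  next
    case 3
    then have "u / (2 * pi) < v / (2 * pi)" using K L by linarith
    then have "u < v" by (simp add: divide_less_cancel)
    then show ?thesis using 3 neg by (simp add: k_def[symmetric] l_def[symmetric])
  qed (use neg in \<open>simp add: k_def[symmetric] l_def[symmetric]\<close>)
qed

text \<open>Off the multiples of \<open>2 * pi\<close>, \<open>sawlog (-1) s\<close> equals
  \<open>Ln (1 - exp (\<i> * s)) - \<i> * pi / 2\<close>, and \<open>sawlog 1 s\<close> is its
  complex conjugate. The sawtooth \<open>frac\<close> is what makes the phase periodic.\<close>

definition sawlog :: "real \<Rightarrow> real \<Rightarrow> complex" where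
  "sawlog \<epsilon> s = of_real (ln \<bar>2 * sin (s / 2)\<bar>) + \<i> * of_real (\<epsilon> * pi * frac (- s / (2 * pi)))"

text \<open>The two-point kernel in null coordinates: the phase \<open>\<plusminus>\<pi>\<close> of the timelike region is
  \<open>\<pi> (\<lfloor>u / 2\<pi>\<rfloor> - \<lfloor>v / 2\<pi>\<rfloor>)\<close>, which makes every summand a function of \<open>u\<close>, of \<open>v\<close> or of \<open>\<tau>\<close> alone.\<close>

lemma kern_chart:
  assumes R: "R > 0" and p: "p \<in> strip" "q \<in> strip"
    and uv: "sin (null_u p q / 2) \<noteq> 0" "sin (null_v p q / 2) \<noteq> 0"
  shows "kern R (chart R p) (chart R q) = - (1 / (4 * of_real pi)) *
    (sawlog (-1) (- null_u p q) + sawlog 1 (- null_v p q) +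
      (\<i> * of_real (p $ 0 - q $ 0) - of_real (ln (cos (q $ 0))) - of_real (ln (cos (p $ 0)))))"
proof -
  define u v where "u = null_u p q" and "v = null_v p q"
  define m where "m = mink (chart R p - chart R q) (chart R p - chart R q)"
  have c: "cos (p $ 0) > 0" "cos (q $ 0) > 0" using strip_cos_pos p by auto
  have m: "m = - (4 * R\<^sup>2 * (sin (u / 2) * sin (v / 2)) / (cos (p $ 0) * cos (q $ 0)))"
    unfolding m_def mink_chart_null[OF p] u_def v_def by simp
  have d: "u - v = 2 * (p $ 0 - q $ 0)" by (simp add: u_def v_def null_u_def null_v_def)
  have dpi: "\<bar>p $ 0 - q $ 0\<bar> < pi" using p by (auto simp: strip_def)
  have "\<bar>m\<bar> / R\<^sup>2 = \<bar>2 * sin (u / 2)\<bar> * \<bar>2 * sin (v / 2)\<bar> / (cos (p $ 0) * cos (q $ 0))"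
    using R c by (simp add: m abs_mult)
  then have ln: "ln (\<bar>m\<bar> / R\<^sup>2) = ln \<bar>2 * sin (u / 2)\<bar> + ln \<bar>2 * sin (v / 2)\<bar> - ln (cos (p $ 0)) - ln (cos (q $ 0))"
    using uv c by (simp add: u_def v_def ln_mult ln_div)
  have mpos: "m > 0 \<longleftrightarrow> sin (u / 2) * sin (v / 2) < 0"
    using R c by (simp add: m zero_less_mult_iff mult_less_0_iff zero_less_divide_iff divide_less_0_iff)
  have "sgn (chart R p $ 0 - chart R q $ 0) = sgn (u - v)"
  proof -
    have "tan (q $ 0) < tan (p $ 0) \<longleftrightarrow> q $ 0 < p $ 0" "tan (p $ 0) < tan (q $ 0) \<longleftrightarrow> p $ 0 < q $ 0"
      using p by (auto simp: strip_def tan_monotone'[symmetric])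
    then have "sgn (tan (p $ 0) - tan (q $ 0)) = sgn (p $ 0 - q $ 0)"
      by (auto simp: sgn_if)
    moreover have "chart R p $ 0 - chart R q $ 0 = R * (tan (p $ 0) - tan (q $ 0))"
      by (simp add: chart_nth algebra_simps)
    ultimately show ?thesis using R unfolding d sgn_mult by (simp add: sgn_mult)
  qed
  then have "(if m > 0 then pi * sgn (chart R p $ 0 - chart R q $ 0) else 0)
      = pi * (if sin (u / 2) * sin (v / 2) < 0 then sgn (u - v) else 0)"
    by (simp add: mpos)
  also have "\<dots> = pi * (of_int \<lfloor>u / (2 * pi)\<rfloor> - of_int \<lfloor>v / (2 * pi)\<rfloor>)"
    using floor_phase[of u v] uv dpi d by (simp add: u_def[symmetric] v_def[symmetric])
  \<comment> \<open>Each floor is its argument minus the fractional part: the linear parts combine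
    to the time difference, and the fractional parts are periodic, as functions on the circle have
    to be.\<close>
  also have "\<dots> = (p $ 0 - q $ 0) - pi * frac (u / (2 * pi)) + pi * frac (v / (2 * pi))"
  proof -
    have "pi * (u / (2 * pi)) - pi * (v / (2 * pi)) = p $ 0 - q $ 0" using d by simp
    then show ?thesis by (simp add: frac_def algebra_simps)
  qed
  finally have ph: "(if m > 0 then pi * sgn (chart R p $ 0 - chart R q $ 0) else 0)
     = (p $ 0 - q $ 0) - pi * frac (u / (2 * pi)) + pi * frac (v / (2 * pi))" .
  have "kern R (chart R p) (chart R q) = - (1 / (4 * of_real pi)) * (of_real (ln (\<bar>m\<bar> / R\<^sup>2)) +
     \<i> * of_real (if m > 0 then pi * sgn (chart R p $ 0 - chart R q $ 0) else 0))"
    by (simp add: kern_def m_def)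
  then show ?thesis
    unfolding ph ln sawlog_def u_def[symmetric] v_def[symmetric] by (simp add: algebra_simps)
qed

lemma sawlog_measurable [measurable]: "sawlog \<epsilon> \<in> borel_measurable borel"
  unfolding sawlog_def[abs_def] frac_def by measurable

lemma periodic_sawlog: "periodic (\<lambda>s. sawlog \<epsilon> (s - d))"
proof -
  have "sawlog \<epsilon> (s + 2 * pi) = sawlog \<epsilon> s" for s
  proof -
    have "- (s + 2 * pi) / (2 * pi) = - s / (2 * pi) + of_int (- 1)" by (simp add: field_simps)
    then have "frac (- (s + 2 * pi) / (2 * pi)) = frac (- s / (2 * pi))" by (simp only: frac_def floor_add_int) simp
    moreover have "sin ((s + 2 * pi) / 2) = - sin (s / 2)" by (simp add: add_divide_distrib)
    ultimately show ?thesis unfolding sawlog_def by simp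
  qed
  from this[of "s - d" for s] show ?thesis by (simp add: periodic_def algebra_simps)
qed

lemma sawlog_norm: "norm (sawlog \<epsilon> s) \<le> (ln 2 + \<bar>\<epsilon>\<bar> * pi) + ell s"
proof -
  have "\<bar>ln \<bar>2 * sin (s / 2)\<bar>\<bar> \<le> ln 2 + ell s"
  proof (cases "sin (s / 2) = 0")
    case False
    then have "ln \<bar>2 * sin (s / 2)\<bar> = ln 2 + ln \<bar>sin (s / 2)\<bar>" by (simp add: abs_mult ln_mult)
    then show ?thesis unfolding ell_def using ln_ge_zero[of "2::real"] by linarith
  qed (simp add: ell_def)
  moreover have "\<bar>\<epsilon> * pi * frac (- s / (2 * pi))\<bar> \<le> \<bar>\<epsilon>\<bar> * pi"
    using frac_ge_0[of "- s / (2 * pi)"] frac_lt_1[of "- s / (2 * pi)"]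
    by (simp add: abs_mult mult_left_le)
  moreover have "norm (sawlog \<epsilon> s) \<le> \<bar>ln \<bar>2 * sin (s / 2)\<bar>\<bar> + \<bar>\<epsilon> * pi * frac (- s / (2 * pi))\<bar>"
    unfolding sawlog_def by (rule order_trans[OF norm_triangle_ineq]) (simp add: norm_mult del: of_real_mult)
  ultimately show ?thesis by simp
qed

text \<open>Up to a constant the modulus is bounded by \<open>ell\<close>, whose integral over a
  period is finite and not changed by the shift.\<close>

lemma sawlog_integrable: "integrable circ (\<lambda>s. sawlog \<epsilon> (s - d))"
proof -
  interpret C: finite_measure circ by (rule finite_circ)
  have p: "periodic (\<lambda>s. ennreal (ell s))" by (simp add: periodic_def ell_periodic)
  have "integrable circ (\<lambda>s. ell (s - d))"
  proof (rule integrableI_nonneg)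
    have "(\<integral>\<^sup>+s. ennreal (ell (s - d)) \<partial>circ) = (\<integral>\<^sup>+s. ennreal (ell s) \<partial>circ)"
      using nn_integral_circ_shift[OF _ p, of "- d"] by simp
    also have "\<dots> \<le> (\<integral>\<^sup>+s. ennreal (ell s) * indicator {-pi..pi} s \<partial>lborel)"
      by (subst nn_integral_circ) (auto intro!: nn_integral_mono simp: indicator_def)
    also have "\<dots> < \<infinity>" by (rule nn_integral_ell_pi)
    finally show "(\<integral>\<^sup>+s. ennreal (ell (s - d)) \<partial>circ) < \<infinity>" .
  qed (auto simp: ell_nonneg)
  then have "integrable circ (\<lambda>s. (ln 2 + \<bar>\<epsilon>\<bar> * pi) + ell (s - d))" by simp
  then show ?thesis
    by (rule Bochner_Integration.integrable_bound)
      (auto intro!: AE_I2 order_trans[OF sawlog_norm] simp: ell_nonneg)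
qed

lemma AE_cyl_lborel:
  assumes "AE p in (lborel :: (real^2) measure). P p"
  shows "AE z in cyl c. P (pt (fst z) (snd z))"
proof -
  have "(\<lambda>(a, b). pt a b) \<in> lborel \<Otimes>\<^sub>M lborel \<rightarrow>\<^sub>M (borel :: (real^2) measure)"
    unfolding case_prod_unfold by measurable
  from AE_distrD[OF this] have "AE z in lborel \<Otimes>\<^sub>M lborel. P (pt (fst z) (snd z))"
    using assms unfolding lborel_two by (simp add: case_prod_unfold)
  then show ?thesis
    unfolding cyl_density by (subst AE_density) (auto elim: eventually_mono)
qed

context wave_setup
begin

text \<open>Each \<open>sawlog\<close> term depends on one null coordinate and drops out by
  \<open>null_integral\<close>; only the term \<open>a\<close> in the time of the second point
  contributes.\<close>

lemma kern_dalembert_integral: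
  assumes p: "p \<in> chart_domain"
  shows "(LINT y|dS_volume R. kern R (chart R p) y * dalembert R h y) = - (1 / (4 * of_real pi * (of_real R)\<^sup>2)) * integ R h"
proof -
  have ps: "p \<in> strip" using p chart_domain_subset_strip by blast
  define L1 where "L1 = (\<lambda>s. sawlog (-1) (s - (p $ 1 + p $ 0)))"
  define L2 where "L2 = (\<lambda>s. sawlog 1 (s - (p $ 1 - p $ 0)))"
  \<comment> \<open>The part of \<open>kern_chart\<close> that depends on the second point through
    its time \<open>t\<close> alone, followed by its two derivatives. Since \<open>R^2 * a''\<close>
    is the volume density, integrating \<open>a''\<close> against \<open>\<phi>z\<close> gives the
    integral of \<open>h\<close> divided by \<open>R^2\<close>.\<close>
  define a where "a t = \<i> * of_real (p $ 0 - t) - of_real (ln (cos t)) - complex_of_real (ln (cos (p $ 0)))" for t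
  define a' where "a' t = - \<i> + complex_of_real (tan t)" for t
  define a'' where "a'' t = complex_of_real (inverse ((cos t)\<^sup>2))" for t
  have cpos: "cos t > 0" if "t \<in> {-cutoff..cutoff}" for t
    using that cutoff by (intro cos_gt_zero_pi) auto
  have N1: "integrable (cyl cutoff) (\<lambda>z. L1 (snd z + 1 * fst z) * b z)" "(LINT z|cyl cutoff. L1 (snd z + 1 * fst z) * b z) = 0"
    unfolding L1_def by (rule null_integral[OF sawlog_integrable periodic_sawlog]; simp)+
  have N2: "integrable (cyl cutoff) (\<lambda>z. L2 (snd z + (-1) * fst z) * b z)" "(LINT z|cyl cutoff. L2 (snd z + (-1) * fst z) * b z) = 0"
    unfolding L2_def by (rule null_integral[OF sawlog_integrable periodic_sawlog]; simp)+
  have am: "a \<in> borel_measurable borel" "a' \<in> borel_measurable borel" "a'' \<in> borel_measurable borel"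
    unfolding a_def[abs_def] a'_def[abs_def] a''_def[abs_def] tan_def by measurable
  have ad: "(a has_vector_derivative a' t) (at t within {-cutoff..cutoff})" if "t \<in> {-cutoff..cutoff}" for t
  proof -
    have "((\<lambda>t. p $ 0 - t) has_real_derivative -1) (at t within {-cutoff..cutoff})"
      by (auto intro!: derivative_eq_intros)
    moreover have "((\<lambda>t. ln (cos t)) has_real_derivative - tan t) (at t within {-cutoff..cutoff})"
      using cpos[OF that] by (auto intro!: derivative_eq_intros simp: tan_def)
    ultimately have "((\<lambda>t. complex_of_real (p $ 0 - t)) has_vector_derivative of_real (-1)) (at t within {-cutoff..cutoff})"
      "((\<lambda>t. complex_of_real (ln (cos t))) has_vector_derivative of_real (- tan t)) (at t within {-cutoff..cutoff})"
      by (simp_all only: has_real_derivative_iff_has_vector_derivative has_vector_derivative_of_real)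
    from has_vector_derivative_diff[OF has_vector_derivative_diff[OF has_vector_derivative_mult_right[OF this(1), of \<i>] this(2)]
        has_vector_derivative_const[of "complex_of_real (ln (cos (p $ 0)))"]]
    show ?thesis unfolding a_def[abs_def] a'_def by simp
  qed
  have a'd: "(a' has_vector_derivative a'' t) (at t within {-cutoff..cutoff})" if "t \<in> {-cutoff..cutoff}" for t
  proof -
    have "(tan has_real_derivative inverse ((cos t)\<^sup>2)) (at t within {-cutoff..cutoff})"
      using cpos[OF that] by (intro DERIV_subset[OF DERIV_tan]) auto
    then have "((\<lambda>t. complex_of_real (tan t)) has_vector_derivative of_real (inverse ((cos t)\<^sup>2))) (at t within {-cutoff..cutoff})"
      by (intro has_vector_derivative_of_real) (simp add: has_real_derivative_iff_has_vector_derivative)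
    from has_vector_derivative_add[OF has_vector_derivative_const[of "- \<i>"] this]
    show ?thesis unfolding a'_def[abs_def] a''_def by simp
  qed
  have a''c: "continuous_on {-cutoff..cutoff} a''"
    unfolding a''_def[abs_def] by (intro continuous_intros) (use cpos in force)
  have T: "integrable (cyl cutoff) (\<lambda>z. a (fst z) * b z)"
    "(LINT z|cyl cutoff. a (fst z) * b z) = (LINT z|cyl cutoff. a'' (fst z) * \<phi>z z)"
    by (rule time_integral[OF am ad a'd a''c]; assumption)+
  have I: "integrable (cyl cutoff) (\<lambda>z. L1 (snd z + 1 * fst z) * b z + L2 (snd z + (-1) * fst z) * b z + a (fst z) * b z)"
    by (intro Bochner_Integration.integrable_add N1(1) N2(1) T(1))
  have "(LINT y|dS_volume R. kern R (chart R p) y * dalembert R h y) =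
      (LINT z|cyl cutoff. kern R (chart R p) (chart R (pt (fst z) (snd z))) * b z)"
  proof (rule integral_dalembert_cyl)
    have "(\<lambda>y. (chart R p, y)) \<in> borel \<rightarrow>\<^sub>M borel \<Otimes>\<^sub>M borel" by measurable
    from measurable_compose[OF this kern_measurable] show "(\<lambda>y. kern R (chart R p) y) \<in> borel_measurable borel" by simp
  qed
  also have "\<dots> = (LINT z|cyl cutoff. - (1 / (4 * of_real pi)) * (L1 (snd z + 1 * fst z) * b z + L2 (snd z + (-1) * fst z) * b z + a (fst z) * b z))"
  proof (rule integral_cong_AE)
    have "AE z in cyl cutoff. sin (null_u p (pt (fst z) (snd z)) / 2) \<noteq> 0"
      using AE_cyl_lborel[OF AE_null_sin[of p 1]] unfolding null_u_eq .
    moreover have "AE z in cyl cutoff. sin (null_v p (pt (fst z) (snd z)) / 2) \<noteq> 0"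
      using AE_cyl_lborel[OF AE_null_sin[of p "-1"]] unfolding null_v_eq .
    ultimately show "AE z in cyl cutoff. kern R (chart R p) (chart R (pt (fst z) (snd z))) * b z =
       - (1 / (4 * of_real pi)) * (L1 (snd z + 1 * fst z) * b z + L2 (snd z + (-1) * fst z) * b z + a (fst z) * b z)"
      using AE_cyl[of cutoff]
    proof eventually_elim
      case (elim z)
      let ?q = "pt (fst z) (snd z)"
      have q: "?q \<in> strip" using elim by (intro pt_strip) simp
      have "L1 (snd z + 1 * fst z) = sawlog (-1) (- null_u p ?q)" "L2 (snd z + (-1) * fst z) = sawlog 1 (- null_v p ?q)"
        by (simp_all add: L1_def L2_def null_u_def null_v_def algebra_simps)
      moreover have "a (fst z) = \<i> * of_real (p $ 0 - ?q $ 0) - of_real (ln (cos (?q $ 0))) - of_real (ln (cos (p $ 0)))"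
        by (simp add: a_def)
      ultimately show ?case
        using kern_chart[OF R ps q elim(1) elim(2)] by (simp only:) (simp only: distrib_right mult.assoc)
    qed
    have [measurable]: "(\<lambda>z. kern R (chart R p) (chart R (pt (fst z) (snd z)))) \<in> borel_measurable (borel \<Otimes>\<^sub>M borel)"
    proof -
      have "(\<lambda>z::real \<times> real. (chart R p, chart R (pt (fst z) (snd z)))) \<in> borel \<Otimes>\<^sub>M borel \<rightarrow>\<^sub>M borel \<Otimes>\<^sub>M borel" by measurable
      from measurable_compose[OF this kern_measurable] show ?thesis by simp
    qed
    show "(\<lambda>z. kern R (chart R p) (chart R (pt (fst z) (snd z))) * b z) \<in> borel_measurable (cyl cutoff)"
      unfolding measurable_cyl by measurable
    show "(\<lambda>z. - (1 / (4 * of_real pi)) * (L1 (snd z + 1 * fst z) * b z + L2 (snd z + (-1) * fst z) * b z + a (fst z) * b z)) \<in> borel_measurable (cyl cutoff)"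
      by (intro borel_measurable_integrable integrable_mult_right I)
  qed
  also have "\<dots> = - (1 / (4 * of_real pi)) * ((LINT z|cyl cutoff. L1 (snd z + 1 * fst z) * b z) +
      (LINT z|cyl cutoff. L2 (snd z + (-1) * fst z) * b z) + (LINT z|cyl cutoff. a (fst z) * b z))"
    unfolding integral_mult_right_zero
    by (simp only: Bochner_Integration.integral_add[OF Bochner_Integration.integrable_add[OF N1(1) N2(1)] T(1)]
        Bochner_Integration.integral_add[OF N1(1) N2(1)])
  also have "\<dots> = - (1 / (4 * of_real pi)) * (LINT z|cyl cutoff. a'' (fst z) * \<phi>z z)"
    unfolding N1(2) N2(2) T(2) by simp
  also have "(LINT z|cyl cutoff. a'' (fst z) * \<phi>z z) = integ R h / (of_real R)\<^sup>2"
  proof -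
    have "integ R h = (LINT z|cyl cutoff. (of_real R)\<^sup>2 * (a'' (fst z) * \<phi>z z))"
      unfolding integ_cyl by (simp add: a''_def divide_inverse mult_ac)
    then have "integ R h = (of_real R)\<^sup>2 * (LINT z|cyl cutoff. a'' (fst z) * \<phi>z z)"
      by (simp only: integral_mult_right_zero)
    then show ?thesis using R by simp
  qed
  finally show ?thesis by (simp add: mult_ac)
qed

text \<open>By Fubini the integral over the second point can be done first; it is the same constant
  for every first point of \<open>dS R\<close>, and elsewhere \<open>f\<close> vanishes.\<close>

lemma pairing_dalembert:
  assumes f: "f \<in> test_fun R"
  shows "pairing R f (dalembert R h) = - (1 / (4 * of_real pi * (of_real R)\<^sup>2)) * cnj (integ R f) * integ R h"
proof -
  interpret M: sigma_finite_measure "dS_volume R" by (rule sigma_finite_dS_volume[OF R])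
  interpret MM: pair_sigma_finite "dS_volume R" "dS_volume R" ..
  let ?C = "- (1 / (4 * of_real pi * (of_real R)\<^sup>2)) * integ R h"
  have "pairing R f (dalembert R h) = (LINT x|dS_volume R. LINT y|dS_volume R. kern R x y * cnj (f x) * dalembert R h y)"
    unfolding pairing_kern[OF R f D_test]
    using MM.integral_fst'[OF pairing_integrable[OF R f D_test, unfolded pair_volume_def]] by (simp add: pair_volume_def)
  also have "\<dots> = (LINT x|dS_volume R. cnj (f x) * ?C)"
  proof (rule Bochner_Integration.integral_cong[OF refl])
    fix x
    have "(LINT y|dS_volume R. kern R x y * cnj (f x) * dalembert R h y) = cnj (f x) * (LINT y|dS_volume R. kern R x y * dalembert R h y)"
      unfolding integral_mult_right_zero[symmetric] by (simp only: mult_ac)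
    also have "\<dots> = cnj (f x) * ?C"
    proof (cases "x \<in> dS R")
      case True
      then obtain p where "p \<in> chart_domain" "chart R p = x" using chart_surj[OF R] by blast
      then show ?thesis using kern_dalembert_integral[of p] by simp
    next
      case False
      then show ?thesis using test_fun_off[OF f] by simp
    qed
    finally show "(LINT y|dS_volume R. kern R x y * cnj (f x) * dalembert R h y) = cnj (f x) * ?C" .
  qed
  also have "\<dots> = cnj (integ R f) * ?C"
    unfolding integral_mult_left_zero by (simp only: integ_def Bochner_Integration.integral_cnj)
  finally show ?thesis by (simp add: mult_ac)
qed

end

section \<open>The extension to the Krein completion\<close>

context complex_hilbert_space
begin

lemma cinner_add_left: "cinner (x + y) z = cinner x z + cinner y z"
  by (metis cinner_add_right cinner_commute complex_cnj_add)

lemma cinner_scaleC_left: "cinner (scaleC c x) y = cnj c * cinner x y"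
  by (metis cinner_commute cinner_scaleC_right complex_cnj_mult)

lemma norm_scaleC: "norm (scaleC c x) = cmod c * norm x"
proof -
  have "complex_of_real ((norm (scaleC c x))\<^sup>2) = of_real ((cmod c * norm x)\<^sup>2)"
    unfolding cinner_self[symmetric] power_mult_distrib of_real_mult complex_norm_square
    by (simp add: cinner_scaleC_left cinner_scaleC_right)
  then have "(norm (scaleC c x))\<^sup>2 = (cmod c * norm x)\<^sup>2" by (simp only: of_real_eq_iff)
  then show ?thesis by (simp add: power2_eq_iff_nonneg)
qed

lemma cinner_Cauchy_Schwarz: "cmod (cinner x y) \<le> norm x * norm y"
proof (cases "y = 0")
  case True
  then have "scaleC 0 y = y" using scale_zero_left by simp
  then have "cinner x y = 0" by (metis cinner_scaleC_right mult_zero_left)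
  then show ?thesis by simp
next
  case False
  then have ny: "norm y > 0" by simp
  define N where "N = complex_of_real ((norm y)\<^sup>2)"
  have N: "N \<noteq> 0" "cnj N = N" using ny by (simp_all add: N_def)
  \<comment> \<open>The coefficient that makes \<open>x + scaleC c y\<close> orthogonal to
    \<open>y\<close>.\<close>
  define c where "c = - cinner y x / N"
  have "complex_of_real ((norm (x + scaleC c y))\<^sup>2) = of_real ((norm x)\<^sup>2) + c * cinner x y + cnj c * cinner y x + c * cnj c * of_real ((norm y)\<^sup>2)"
    unfolding cinner_self[symmetric]
    by (simp add: cinner_add_left cinner_add_right cinner_scaleC_left cinner_scaleC_right algebra_simps)
  also have "c * cnj c * of_real ((norm y)\<^sup>2) = - cnj c * cinner y x"
    using N unfolding N_def[symmetric] by (simp add: c_def)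
  also have "c * cinner x y = - of_real ((cmod (cinner x y))\<^sup>2 / (norm y)\<^sup>2)"
    unfolding of_real_divide N_def[symmetric] complex_norm_square
    by (simp add: c_def cinner_commute[of x y] mult.commute)
  finally have "complex_of_real ((norm (x + scaleC c y))\<^sup>2) = of_real ((norm x)\<^sup>2 - (cmod (cinner x y))\<^sup>2 / (norm y)\<^sup>2)"
    by simp
  then have "(norm (x + scaleC c y))\<^sup>2 = (norm x)\<^sup>2 - (cmod (cinner x y))\<^sup>2 / (norm y)\<^sup>2"
    by (simp only: of_real_eq_iff)
  then have "(cmod (cinner x y))\<^sup>2 / (norm y)\<^sup>2 \<le> (norm x)\<^sup>2"
    using zero_le_power2[of "norm (x + scaleC c y)"] by linarith
  then have "(cmod (cinner x y))\<^sup>2 \<le> (norm x * norm y)\<^sup>2"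
    using ny by (simp add: pos_divide_le_eq power_mult_distrib)
  then show ?thesis by (rule power2_le_imp_le) simp
qed

end

lemma dS_act_inverse:
  assumes "g \<in> SO0_1_2"
  shows "dS_act g (dS_act (matrix_inv g) f) = f"
  by (rule ext) (simp add: dS_act_def SO_matrix_inv_inv[OF assms] SO_inv_mult[OF assms])

text \<open>The bound makes the induced map uniformly continuous on the dense image of the test
  functions; completeness extends it, and limits along sequences of classes give linearity, the
  bound and uniqueness.\<close>

lemma (in krein_completion) continuous_extension_ex1:
  assumes U_test: "\<And>f. f \<in> test_fun R \<Longrightarrow> dS_act g f \<in> test_fun R"
    and bound: "\<And>f. f \<in> test_fun R \<Longrightarrow> norm (\<iota> (dS_act g f)) \<le> C * norm (\<iota> f)"
  shows "\<exists>!T. continuous_extension scaleC R \<iota> g T"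
proof -
  let ?E = "\<iota> ` test_fun R"
  \<comment> \<open>One representative is chosen for each class. The choice does not matter by
    \<open>lip\<close>, since representatives of the same class have images at distance
    \<open>0\<close>.\<close>
  define T0 where "T0 y = \<iota> (dS_act g (SOME f. f \<in> test_fun R \<and> \<iota> f = y))" for y
  have add: "\<iota> (dS_act g (\<lambda>x. f x + k x)) = \<iota> (dS_act g f) + \<iota> (dS_act g k)" if "f \<in> test_fun R" "k \<in> test_fun R" for f k
    using class_add[OF U_test[OF that(1)] U_test[OF that(2)]] by (simp add: dS_act_def[abs_def])
  have scale: "\<iota> (dS_act g (\<lambda>x. c * f x)) = scaleC c (\<iota> (dS_act g f))" if "f \<in> test_fun R" for c f
    using class_scale[OF U_test[OF that]] by (simp add: dS_act_def[abs_def])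
  have m1: "scaleC (- 1) x = - x" for x by simp
  have lip: "norm (\<iota> (dS_act g f) - \<iota> (dS_act g k)) \<le> C * norm (\<iota> f - \<iota> k)" if f: "f \<in> test_fun R" and k: "k \<in> test_fun R" for f k
  proof -
    have k': "(\<lambda>x. - 1 * k x) \<in> test_fun R" by (rule test_fun_scale[OF k])
    have "\<iota> (dS_act g (\<lambda>x. f x + - 1 * k x)) = \<iota> (dS_act g f) - \<iota> (dS_act g k)"
      unfolding add[OF f k'] scale[OF k] m1 by simp
    moreover have "\<iota> (\<lambda>x. f x + - 1 * k x) = \<iota> f - \<iota> k"
      unfolding class_add[OF f k'] class_scale[OF k] m1 by simp
    ultimately show ?thesis using bound[OF test_fun_add[OF f k']] by simp
  qed
  have T0: "T0 (\<iota> f) = \<iota> (dS_act g f)" if f: "f \<in> test_fun R" for f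
  proof -
    let ?k = "SOME k. k \<in> test_fun R \<and> \<iota> k = \<iota> f"
    have "?k \<in> test_fun R \<and> \<iota> ?k = \<iota> f" by (rule someI[of _ f]) (simp add: f)
    then show ?thesis using lip[of ?k f] f by (simp add: T0_def)
  qed
  have "uniformly_continuous_on ?E T0"
    unfolding uniformly_continuous_on_def
  proof (intro allI impI)
    fix e :: real assume e: "e > 0"
    \<comment> \<open>\<open>\<bar>C\<bar> + 1\<close> replaces \<open>C\<close>, which is not known
      to be positive.\<close>
    define d where "d = e / (\<bar>C\<bar> + 1)"
    have d: "d > 0" using e by (simp add: d_def)
    have "dist (T0 y) (T0 x) < e" if "x \<in> ?E" "y \<in> ?E" "dist y x < d" for x y
    proof -
      have "dist (T0 y) (T0 x) \<le> C * norm (y - x)"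
        using that lip T0 by (auto simp: dist_norm)
      also have "\<dots> \<le> (\<bar>C\<bar> + 1) * norm (y - x)" by (intro mult_right_mono) auto
      also have "\<dots> < (\<bar>C\<bar> + 1) * d" using that by (intro mult_strict_left_mono) (auto simp: dist_norm)
      also have "\<dots> = e" by (simp add: d_def)
      finally show ?thesis .
    qed
    then show "\<exists>d>0. \<forall>x\<in>?E. \<forall>x'\<in>?E. dist x' x < d \<longrightarrow> dist (T0 x') (T0 x) < e" using d by blast
  qed
  then obtain T where Tu: "uniformly_continuous_on (closure ?E) T" and TE: "\<And>x. x \<in> ?E \<Longrightarrow> T0 x = T x"
    using uniformly_continuous_on_extension_on_closure by metis
  have Tc: "continuous_on UNIV T"
    using uniformly_continuous_imp_continuous[OF Tu] by (simp only: class_dense)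
  have T: "T (\<iota> f) = \<iota> (dS_act g f)" if "f \<in> test_fun R" for f using TE[of "\<iota> f"] T0 that by simp
  have lim: "(\<lambda>n. T (X n)) \<longlonglongrightarrow> T x" if "X \<longlonglongrightarrow> x" for X x
    using continuous_on_tendsto_compose[OF Tc that] by simp
  have seq: "\<exists>F. (\<forall>n. F n \<in> test_fun R) \<and> (\<lambda>n. \<iota> (F n)) \<longlonglongrightarrow> x" for x
  proof -
    have "x \<in> closure ?E" unfolding class_dense by simp
    then obtain X where X: "\<And>n. X n \<in> ?E" "X \<longlonglongrightarrow> x" unfolding closure_sequential by blast
    then have "\<forall>n. \<exists>f. f \<in> test_fun R \<and> X n = \<iota> f" by blast
    then obtain F where F: "\<And>n. F n \<in> test_fun R" "\<And>n. X n = \<iota> (F n)" by metis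
    then have "X = (\<lambda>n. \<iota> (F n))" by blast
    then show ?thesis using X(2) F(1) by blast
  qed
  have Tadd: "T (x + y) = T x + T y" for x y
  proof -
    obtain F where F: "\<And>n. F n \<in> test_fun R" "(\<lambda>n. \<iota> (F n)) \<longlonglongrightarrow> x" using seq[of x] by blast
    obtain G where G: "\<And>n. G n \<in> test_fun R" "(\<lambda>n. \<iota> (G n)) \<longlonglongrightarrow> y" using seq[of y] by blast
    have "T (\<iota> (F n) + \<iota> (G n)) = T (\<iota> (F n)) + T (\<iota> (G n))" for n
      using T[OF test_fun_add[OF F(1) G(1)], of n n] T[OF F(1)] T[OF G(1)] add[OF F(1) G(1)] class_add[OF F(1) G(1)] by simp
    then have "(\<lambda>n. T (\<iota> (F n)) + T (\<iota> (G n))) \<longlonglongrightarrow> T (x + y)"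
      using lim[OF tendsto_add[OF F(2) G(2)]] by simp
    from LIMSEQ_unique[OF this tendsto_add[OF lim[OF F(2)] lim[OF G(2)]]] show ?thesis .
  qed
  have scaleC_lim: "(\<lambda>n. scaleC c (X n)) \<longlonglongrightarrow> scaleC c x" if "X \<longlonglongrightarrow> x" for c X x
  proof -
    have "(\<lambda>n. cmod c * norm (X n - x)) \<longlonglongrightarrow> cmod c * 0"
      using that by (intro tendsto_mult tendsto_const) (simp add: LIM_zero tendsto_norm_zero)
    then have "(\<lambda>n. norm (scaleC c (X n) - scaleC c x)) \<longlonglongrightarrow> 0"
      by (simp add: scale_right_diff_distrib[symmetric] norm_scaleC)
    then show ?thesis by (simp add: tendsto_norm_zero_iff LIM_zero_iff)
  qed
  have Tscale: "T (scaleC c x) = scaleC c (T x)" for c x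
  proof -
    obtain F where F: "\<And>n. F n \<in> test_fun R" "(\<lambda>n. \<iota> (F n)) \<longlonglongrightarrow> x" using seq[of x] by blast
    have "T (scaleC c (\<iota> (F n))) = scaleC c (T (\<iota> (F n)))" for n
      using T[OF test_fun_scale[OF F(1)], of c n] T[OF F(1)] scale[OF F(1)] class_scale[OF F(1)] by simp
    then have "(\<lambda>n. scaleC c (T (\<iota> (F n)))) \<longlonglongrightarrow> T (scaleC c x)"
      using lim[OF scaleC_lim[OF F(2), of c]] by simp
    from LIMSEQ_unique[OF this scaleC_lim[OF lim[OF F(2)]]] show ?thesis .
  qed
  have Tnorm: "norm (T x) \<le> norm x * C" for x
  proof -
    obtain F where F: "\<And>n. F n \<in> test_fun R" "(\<lambda>n. \<iota> (F n)) \<longlonglongrightarrow> x" using seq[of x] by blast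
    have "norm (T (\<iota> (F n))) \<le> norm (\<iota> (F n)) * C" for n
      using bound[OF F(1)] T[OF F(1)] by (simp add: mult.commute)
    then show ?thesis
      by (intro LIMSEQ_le[OF tendsto_norm[OF lim[OF F(2)]] tendsto_mult[OF tendsto_norm[OF F(2)] tendsto_const]]) auto
  qed
  have Tb: "bounded_linear T"
  proof (rule bounded_linear_intro)
    show "T (r *\<^sub>R x) = r *\<^sub>R T x" for r x
      using Tscale[of "of_real r" x] by (simp only: scaleC_of_real)
  qed (rule Tadd, rule Tnorm)
  show ?thesis
  proof (rule ex1I[of _ T])
    show "continuous_extension scaleC R \<iota> g T"
      unfolding continuous_extension_def using Tb Tscale T by blast
    fix S assume S: "continuous_extension scaleC R \<iota> g S"
    show "S = T"
    proof
      fix x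
      obtain F where F: "\<And>n. F n \<in> test_fun R" "(\<lambda>n. \<iota> (F n)) \<longlonglongrightarrow> x" using seq[of x] by blast
      have Sb: "bounded_linear S" using S by (simp add: continuous_extension_def)
      have "(\<lambda>n. S (\<iota> (F n))) \<longlonglongrightarrow> S x" by (rule bounded_linear.tendsto[OF Sb F(2)])
      moreover have "S (\<iota> (F n)) = T (\<iota> (F n))" for n
        using S F(1) T[OF F(1)] by (simp add: continuous_extension_def)
      ultimately have "(\<lambda>n. T (\<iota> (F n))) \<longlonglongrightarrow> S x" by simp
      from LIMSEQ_unique[OF this lim[OF F(2)]] show "S x = T x" .
    qed
  qed
qed

section \<open>Bounds in the Krein norm and the invariant vector\<close>

locale krein_setup = krein_completion scaleC cinner R h \<iota>
  for scaleC :: "complex \<Rightarrow> 'k::banach \<Rightarrow> 'k" and cinner R h \<iota> +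
  assumes R: "R > 0" and h: "h \<in> test_fun R"
    and h_integ: "integ R h = 1" and h_null: "pairing R h h = 0"
begin

text \<open>The factor inverts the constant \<open>- 1 / (4 * pi * R^2)\<close> of
  \<open>pairing_dalembert\<close>, so that pairing with \<open>v\<close> is exactly integration up
  to conjugation.\<close>

definition v :: "real^3 \<Rightarrow> complex" where
  "v = (\<lambda>x. - 4 * of_real pi * (of_real R)\<^sup>2 * dalembert R h x)"

lemma v_test: "v \<in> test_fun R"
  unfolding v_def by (rule test_fun_scale[OF test_fun_dalembert[OF R h]])

lemma integ_v: "integ R v = 0"
  using wave_setup.integ_dalembert[of R h] R h unfolding v_def integ_scale by (simp add: wave_setup_def)

lemma pairing_v_right:
  assumes f: "f \<in> test_fun R"
  shows "pairing R f v = cnj (integ R f)"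
  unfolding v_def pairing_scale_right[OF R f test_fun_dalembert[OF R h]]
  using wave_setup.pairing_dalembert[OF _ f] R h by (simp add: wave_setup_def h_integ field_simps)

lemma pairing_v_left: "f \<in> test_fun R \<Longrightarrow> pairing R v f = integ R f"
  using pairing_cnj[OF R _ v_test, of f] pairing_v_right[of f] by simp

lemma pairing_zero_left: "f \<in> test_fun R \<Longrightarrow> pairing R (\<lambda>x. 0) f = 0"
  using pairing_scale_left[OF R _ h, of f 0] by simp

lemma proj0_test: "f \<in> test_fun R \<Longrightarrow> proj0 R h f \<in> test_fun R"
  unfolding proj0_def by (intro test_fun_diff test_fun_scale h)

lemma integ_diff: "f \<in> test_fun R \<Longrightarrow> g \<in> test_fun R \<Longrightarrow> integ R (\<lambda>x. f x - g x) = integ R f - integ R g"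
  using integ_add[OF R _ test_fun_scale, of f g "- 1"] integ_scale[of R "- 1" g] by simp

lemma integ_proj0: "f \<in> test_fun R \<Longrightarrow> integ R (proj0 R h f) = 0"
  unfolding proj0_def by (simp add: integ_diff test_fun_scale h integ_scale h_integ)

lemma proj0_id: "integ R f = 0 \<Longrightarrow> proj0 R h f = f"
  by (simp add: proj0_def)

text \<open>As \<open>v\<close> has zero integral, it is its own projection; the first term is then
  the integral of a projected function, hence \<open>0\<close>, and the last one vanishes too. The
  middle term has \<open>\<langle>v, h\<rangle> = 1\<close>.\<close>

lemma krein_v: "f \<in> test_fun R \<Longrightarrow> krein R h v f = pairing R h f"
  by (simp add: krein_def proj0_id integ_v pairing_v_left proj0_test integ_proj0 h h_integ integ_cnj)

text \<open>The projection of \<open>h\<close> is zero and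
  \<open>\<langle>h, h\<rangle> = 0\<close>, so only the last term of the Krein form
  survives.\<close>

lemma krein_h: "f \<in> test_fun R \<Longrightarrow> krein R h h f = integ R f"
proof -
  assume f: "f \<in> test_fun R"
  have "proj0 R h h = (\<lambda>x. 0)" by (simp add: proj0_def h_integ)
  then show ?thesis
    using f by (simp add: krein_def pairing_zero_left proj0_test h_null integ_cnj h_integ)
qed

lemma krein_charge_zero:
  "integ R f = 0 \<Longrightarrow> integ R k = 0 \<Longrightarrow> krein R h f k = pairing R f k + pairing R f h * pairing R h k"
  by (simp add: krein_def proj0_id)

lemma krein_bound: "f \<in> test_fun R \<Longrightarrow> k \<in> test_fun R \<Longrightarrow> cmod (krein R h f k) \<le> norm (\<iota> f) * norm (\<iota> k)"
  using cinner_Cauchy_Schwarz[of "\<iota> f" "\<iota> k"] by (simp add: cinner_class)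

lemma pairing_h_bound: "f \<in> test_fun R \<Longrightarrow> cmod (pairing R f h) \<le> norm (\<iota> v) * norm (\<iota> f)"
  using krein_bound[OF v_test, of f] krein_v[of f] pairing_cnj[OF R h, of f] by simp

lemma integ_bound: "f \<in> test_fun R \<Longrightarrow> cmod (integ R f) \<le> norm (\<iota> h) * norm (\<iota> f)"
  using krein_bound[OF h, of f] krein_h[of f] by simp

text \<open>On functions of zero integral the pairing is the Krein product minus the rank-one term
  \<open>\<langle>f, h\<rangle> \<langle>h, k\<rangle>\<close>, and both are bounded in
  \<open>f\<close>. It is used for \<open>k\<close> the difference of a translate of
  \<open>h\<close> and \<open>h\<close>, whose integral is zero.\<close>

lemma pairing_charge_zero_bound:
  assumes f: "f \<in> test_fun R" "integ R f = 0" and k: "k \<in> test_fun R" "integ R k = 0"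
  shows "cmod (pairing R f k) \<le> (norm (\<iota> k) + norm (\<iota> v) * cmod (pairing R h k)) * norm (\<iota> f)"
proof -
  have "pairing R f k = krein R h f k - pairing R f h * pairing R h k"
    by (simp add: krein_charge_zero f k)
  then have "cmod (pairing R f k) \<le> cmod (krein R h f k) + cmod (pairing R f h) * cmod (pairing R h k)"
    by (metis norm_triangle_ineq4 norm_mult)
  also have "\<dots> \<le> norm (\<iota> f) * norm (\<iota> k) + (norm (\<iota> v) * norm (\<iota> f)) * cmod (pairing R h k)"
    by (intro add_mono krein_bound mult_right_mono pairing_h_bound f k) auto
  finally show ?thesis by (simp add: algebra_simps)
qed

lemma norm_charge_zero:
  assumes f: "f \<in> test_fun R" "integ R f = 0"
  shows "complex_of_real ((norm (\<iota> f))\<^sup>2) = pairing R f f + of_real ((cmod (pairing R f h))\<^sup>2)"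
proof -
  have "complex_of_real ((norm (\<iota> f))\<^sup>2) = krein R h f f"
    using cinner_self[of "\<iota> f"] cinner_class[OF f(1) f(1)] by simp
  also have "\<dots> = pairing R f f + pairing R f h * cnj (pairing R f h)"
    by (simp add: krein_charge_zero f pairing_cnj[OF R f(1) h])
  finally show ?thesis by (simp only: complex_norm_square)
qed

text \<open>For zero integral, invariance of the pairing leaves only
  \<open>\<langle>U f, h\<rangle>\<close> to control, and the group element can be moved to
  \<open>h\<close>. The general case follows by splitting off a multiple of
  \<open>h\<close>.\<close>

lemma dS_act_bounded:
  assumes g: "g \<in> SO0_1_2"
  obtains C where "\<And>f. f \<in> test_fun R \<Longrightarrow> norm (\<iota> (dS_act g f)) \<le> C * norm (\<iota> f)"
proof -
  define h' where "h' = dS_act (matrix_inv g) h"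
  define k where "k = (\<lambda>x. h' x - h x)"
  have h': "h' \<in> test_fun R" "integ R h' = 1" "dS_act g h' = h"
    using test_fun_dS_act[OF SO_matrix_inv[OF g] h] integ_dS_act[OF R SO_matrix_inv[OF g] h] h_integ dS_act_inverse[OF g]
    by (simp_all add: h'_def)
  have k: "k \<in> test_fun R" "integ R k = 0"
    using h' h by (simp_all add: k_def test_fun_diff integ_diff h_integ)
  \<comment> \<open>\<open>norm (\<iota> v)\<close> bounds the pairing with \<open>h\<close>, the
    bracket bounds the pairing with \<open>k\<close>; their sum bounds the pairing of
    \<open>f\<close> with \<open>h' = h + k\<close>.\<close>
  define C1 where "C1 = norm (\<iota> v) + (norm (\<iota> k) + norm (\<iota> v) * cmod (pairing R h k))"
  have C1: "C1 \<ge> 0" by (simp add: C1_def)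
  have zero: "norm (\<iota> (dS_act g f)) \<le> (1 + C1) * norm (\<iota> f)" if f: "f \<in> test_fun R" "integ R f = 0" for f
  proof -
    have Uf: "dS_act g f \<in> test_fun R" "integ R (dS_act g f) = 0"
      using test_fun_dS_act[OF g f(1)] integ_dS_act[OF R g f(1)] f(2) by simp_all
    have "pairing R (dS_act g f) h = pairing R f h'"
      using pairing_dS_act[OF R g f(1) h'(1)] h'(3) by simp
    also have "\<dots> = pairing R f h + pairing R f k"
      using pairing_add_right[OF R f(1) h k(1)] by (simp add: k_def)
    finally have "cmod (pairing R (dS_act g f) h) \<le> cmod (pairing R f h) + cmod (pairing R f k)"
      by (simp add: norm_triangle_ineq)
    also have "\<dots> \<le> C1 * norm (\<iota> f)"
      using pairing_h_bound[OF f(1)] pairing_charge_zero_bound[OF f k] by (simp add: C1_def algebra_simps)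
    finally have 1: "(cmod (pairing R (dS_act g f) h))\<^sup>2 \<le> (C1 * norm (\<iota> f))\<^sup>2" by (rule power_mono) simp
    have "complex_of_real ((norm (\<iota> (dS_act g f)))\<^sup>2) =
        of_real ((norm (\<iota> f))\<^sup>2 - (cmod (pairing R f h))\<^sup>2 + (cmod (pairing R (dS_act g f) h))\<^sup>2)"
      using norm_charge_zero[OF Uf] norm_charge_zero[OF f] pairing_dS_act[OF R g f(1) f(1)] by simp
    then have "(norm (\<iota> (dS_act g f)))\<^sup>2 = (norm (\<iota> f))\<^sup>2 - (cmod (pairing R f h))\<^sup>2 + (cmod (pairing R (dS_act g f) h))\<^sup>2"
      by (simp only: of_real_eq_iff)
    also have "\<dots> \<le> (norm (\<iota> f))\<^sup>2 + (C1 * norm (\<iota> f))\<^sup>2"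
      using 1 zero_le_power2[of "cmod (pairing R f h)"] by linarith
    \<comment> \<open>The mixed term of the square is nonnegative; the root can then be
      taken.\<close>
    also have "\<dots> \<le> (norm (\<iota> f) + C1 * norm (\<iota> f))\<^sup>2" using C1 by (simp add: power2_sum)
    finally have "norm (\<iota> (dS_act g f)) \<le> norm (\<iota> f) + C1 * norm (\<iota> f)"
      by (rule power2_le_imp_le) (simp add: C1)
    then show ?thesis by (simp add: algebra_simps)
  qed
  define N where "N = norm (\<iota> h)"
  have "norm (\<iota> (dS_act g f)) \<le> ((1 + C1) * (1 + N * N) + N * norm (\<iota> (dS_act g h))) * norm (\<iota> f)"
    if f: "f \<in> test_fun R" for f
  proof -
    \<comment> \<open>Decomposition \<open>f = f0 + c * h\<close>. Both parts are bounded by the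
      norm of \<open>f\<close>, because \<open>c\<close> is the Krein product of \<open>h\<close>
      with \<open>f\<close>.\<close>
    define c where "c = integ R f"
    define f0 where "f0 = proj0 R h f"
    have f0: "f0 \<in> test_fun R" "integ R f0 = 0" using proj0_test[OF f] integ_proj0[OF f] by (simp_all add: f0_def)
    have fx: "f = (\<lambda>x. f0 x + c * h x)" by (simp add: f0_def c_def proj0_def)
    have \<iota>f: "\<iota> f = \<iota> f0 + scaleC c (\<iota> h)"
      using class_add[OF f0(1) test_fun_scale[OF h]] class_scale[OF h] fx by metis
    have Uf: "dS_act g f = (\<lambda>x. dS_act g f0 x + c * dS_act g h x)"
      by (subst fx) (simp add: dS_act_def[abs_def])
    have \<iota>Uf: "\<iota> (dS_act g f) = \<iota> (dS_act g f0) + scaleC c (\<iota> (dS_act g h))"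
      unfolding Uf class_add[OF test_fun_dS_act[OF g f0(1)] test_fun_scale[OF test_fun_dS_act[OF g h]]]
        class_scale[OF test_fun_dS_act[OF g h]] ..
    have c: "cmod c \<le> N * norm (\<iota> f)" using integ_bound[OF f] by (simp add: c_def N_def)
    have "norm (\<iota> f0) = norm (\<iota> f - scaleC c (\<iota> h))" by (simp add: \<iota>f)
    also have "\<dots> \<le> norm (\<iota> f) + cmod c * N"
      using norm_triangle_ineq4[of "\<iota> f" "scaleC c (\<iota> h)"] by (simp add: norm_scaleC N_def)
    also have "\<dots> \<le> norm (\<iota> f) + (N * norm (\<iota> f)) * N" using c by (simp add: mult_right_mono N_def)
    finally have n0: "norm (\<iota> f0) \<le> (1 + N * N) * norm (\<iota> f)" by (simp add: algebra_simps)
    have "norm (\<iota> (dS_act g f)) \<le> norm (\<iota> (dS_act g f0)) + cmod c * norm (\<iota> (dS_act g h))"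
      unfolding \<iota>Uf norm_scaleC[symmetric] by (rule norm_triangle_ineq)
    also have "\<dots> \<le> (1 + C1) * ((1 + N * N) * norm (\<iota> f)) + (N * norm (\<iota> f)) * norm (\<iota> (dS_act g h))"
      using zero[OF f0] n0 c C1 by (intro add_mono mult_right_mono order_trans[OF zero[OF f0]] mult_left_mono) auto
    finally show ?thesis by (simp add: algebra_simps)
  qed
  then show thesis by (rule that)
qed

text \<open>\<open>\<langle>f, v\<rangle>\<close> depends on \<open>f\<close> only through its
  integral, which the action preserves. So the difference of the two functions pairs to zero with
  every test function, in particular with itself and with \<open>h\<close>.\<close>

lemma class_dS_act_v:
  assumes g: "g \<in> SO0_1_2"
  shows "\<iota> (dS_act g v) = \<iota> v"
proof -
  let ?w = "\<lambda>x. dS_act g v x - v x"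
  have Uv: "dS_act g v \<in> test_fun R" by (rule test_fun_dS_act[OF g v_test])
  have w: "?w \<in> test_fun R" by (rule test_fun_diff[OF Uv v_test])
  have "pairing R f ?w = 0" if f: "f \<in> test_fun R" for f
  proof -
    let ?f = "dS_act (matrix_inv g) f"
    have f': "?f \<in> test_fun R" by (rule test_fun_dS_act[OF SO_matrix_inv[OF g] f])
    have "pairing R f (dS_act g v) = pairing R ?f v"
      using pairing_dS_act[OF R g f' v_test] by (simp add: dS_act_inverse[OF g])
    also have "\<dots> = pairing R f v"
      by (simp add: pairing_v_right f f' integ_dS_act[OF R SO_matrix_inv[OF g] f])
    finally have "pairing R f (dS_act g v) = pairing R f v" .
    moreover have "pairing R f (\<lambda>x. ?w x + v x) = pairing R f ?w + pairing R f v"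
      by (rule pairing_add_right[OF R f w v_test])
    ultimately show ?thesis by simp
  qed
  moreover have "integ R ?w = 0"
    by (simp add: integ_diff Uv v_test integ_dS_act[OF R g v_test])
  ultimately have "?w \<in> krein_null R h"
    using w h by (simp add: krein_null_def test_fun0_def)
  then show ?thesis using class_eq_iff[OF Uv v_test] by simp
qed

end

theorem proposition3p2:
  fixes R :: real
    and h :: "real ^ 3 \<Rightarrow> complex"
    and scaleC :: "complex \<Rightarrow> 'k::banach \<Rightarrow> 'k"
    and cinner :: "'k \<Rightarrow> 'k \<Rightarrow> complex"
    and \<iota> :: "(real ^ 3 \<Rightarrow> complex) \<Rightarrow> 'k"
    and v0 :: 'k
  assumes "R > 0"
    and "h \<in> test_fun R" and "\<And>x. h x \<in> \<real>"
    and "integ R h = 1" and "pairing R h h = 0"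
    and "krein_completion scaleC cinner R h \<iota>"
    and "v0 = \<iota> (\<lambda>x. - 4 * of_real pi * (of_real R)\<^sup>2 * dalembert R h x)"
  shows "\<forall>g\<in>SO0_1_2. (\<exists>!T. continuous_extension scaleC R \<iota> g T) \<and>
    (\<forall>T. continuous_extension scaleC R \<iota> g T \<longrightarrow> T v0 = v0)"
proof -
  interpret krein_completion scaleC cinner R h \<iota> by fact
  interpret krein_setup scaleC cinner R h \<iota>
    by unfold_locales (use assms in auto)
  have v0: "v0 = \<iota> v" using assms(7) by (simp add: v_def)
  show ?thesis
  proof (intro ballI conjI allI impI)
    fix g assume g: "g \<in> SO0_1_2"
    obtain C where C: "\<And>f. f \<in> test_fun R \<Longrightarrow> norm (\<iota> (dS_act g f)) \<le> C * norm (\<iota> f)"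
      using dS_act_bounded[OF g] by blast
    show "\<exists>!T. continuous_extension scaleC R \<iota> g T"
      by (rule continuous_extension_ex1[OF test_fun_dS_act[OF g] C])
    fix T assume "continuous_extension scaleC R \<iota> g T"
    then show "T v0 = v0"
      using v_test class_dS_act_v[OF g] by (simp add: continuous_extension_def v0)
  qed
qed

end
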